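(* Let $u^{(0)}\in W^{1,1}(G)$ with $u^{(0)}=f$ on $\partial K$ (trace sense), and let $u^{(j+1)}:=T(u^{(j)})$ for $j\in\mathbb{N}_0$. Let $\rho:=\max\{\rho_1,\rho_2\}$, where $$\rho_1:=2\left(\frac{c_2}{c_1}\right)^{1/2}\|\nabla f\|_{L^2(G)}\left[1+\frac{|G|}{2\pi\sigma^4}c_P\left(\|f\|_{L^1(G)}+\|\nabla f\|_{L^1(G)}\right)\right],\qquad \rho_2:=2\left(\frac{c_2}{c_1}\right)^{1/2}\|\nabla f\|_{L^2(G)}\frac{|G|}{2\pi}c_P,$$ and suppose that $\sigma^4>\rho$. Then: 1. There exist a subsequence $(u^{(j_k)})_{k\in\mathbb{N}}$ of $(u^{(j)})_{j\in\mathbb{N}_0}$ and a function $u\in W^{1,1}(G)$ such that $u^{(j_k)}\to u$ in $W^{1,1}(G)$ as $k\to\infty$. 2. $\sup_{j\in\mathbb{N}_0}\|u^{(j)}\|_{W^{1,2}(G)}<\infty$.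
   Context: Setting. $\Omega\subset\mathbb{R}^2$ is a bounded Lipschitz domain. $C_1,\dots,C_N\subset\Omega$ ($N\ge 1$) are finitely many disjoint open Lipschitz domains, $C_i\neq\Omega$, with $\mathrm{dist}(C_i,C_j)>0$ for $i\ne j$. Put $C:=\bigcup_{i=1}^N C_i$, $K:=\overline{C}$, $G:=\Omega\setminus K$, and assume $K$ is a compact subset of $\Omega$ (so $\partial K\subset\partial G$). The function $f: C\to[0,1]$ is of class $W^{1,2}(C)$; a fixed extension of it to a function in $W^{1,2}(\Omega)$ is also denoted $f$. The map $D:\mathbb{R}^2\to\mathbb{R}^{2\times2}$ is continuous, $D(p)$ is symmetric for every $p\in\mathbb{R}^2$, and there are constants $c_1,c_2>0$ with (normalization $\lambda=1$) $$c_1\left(1+|p|^2\right)^{-1/2}|q|^2\le D(p)q\cdot q\le c_2|q|^2\quad\text{for all }p,q\in\mathbb{R}^2.$$ $\sigma>0$ is the smoothing parameter. For $w\in L^1(G)$ set $w_\sigma(x):=\int_G k_\sigma(x-z)w(z)\,dz$, $x\in\mathbb{R}^2$, where $k_\sigma(z)=\frac{1}{2\pi\sigma^2}\exp\left(-\frac{|z|^2}{2\sigma^2}\right)$. Operator $T$ (its dependence on $\sigma$ is not indicated in the notation). Let $\mathcal{C}:=\{v\in W^{1,2}(G): v=f \text{ on }\partial K\text{ in the trace sense}\}$. For $w\in W^{1,1}(G)$ and $v\in W^{1,2}(G)$ let $J_w(v):=\int_G D(\nabla w_\sigma)\nabla v\cdot\nabla v\,dx$. For $w\in W^{1,1}(G)$,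 $T(w)$ is defined as the unique minimiser of $J_w$ in $\mathcal{C}$; this defines $T:W^{1,1}(G)\to W^{1,1}(G)$. Constant $c_P$. $c_P>0$ is a (Poincaré) constant such that $\|w\|_{L^1(G)}\le c_P\left(\|\nabla(w-f)\|_{L^1(G)}+\|f\|_{L^1(G)}\right)$ for all $w\in W^{1,1}(G)$ with $w=f$ on $\partial K$ in the trace sense.
   Formalization: Item 2 fails as printed at j = 0, since u^(0) is only assumed in W^{1,1}(G) and may have infinite W^{1,2} norm; proved instead: the sup over j ≥ 1 is finite, and the sup over all j in N_0 is finite whenever u^(0) lies in W^{1,2}(G). *)

theory Defs
  imports "HOL-Analysis.Analysis"
begin

section \<open>Lipschitz domains\<close>

text \<open>Near each boundary point the domain is, in a suitable orthonormal frame
  \<open>(e, n)\<close> of the plane, the set strictly above the graph of a Lipschitz function.\<close>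

definition lipschitz_domain :: "(real^2) set \<Rightarrow> bool" where
  "lipschitz_domain \<Omega> \<longleftrightarrow>
     open \<Omega> \<and> connected \<Omega> \<and> bounded \<Omega> \<and> \<Omega> \<noteq> {} \<and>
     (\<forall>x\<in>frontier \<Omega>. \<exists>r>0. \<exists>e n. \<exists>\<gamma> :: real \<Rightarrow> real. \<exists>L.
        norm e = 1 \<and> norm n = 1 \<and> e \<bullet> n = 0 \<and> L-lipschitz_on UNIV \<gamma> \<and>
        (\<forall>y\<in>ball x r. y \<in> \<Omega> \<longleftrightarrow> \<gamma> (y \<bullet> e) < y \<bullet> n))"

section \<open>Lebesgue and Sobolev spaces\<close>

text \<open>Elements of these spaces are represented by functions on the whole space, of which only
  the values on \<open>G\<close> matter; equality in the spaces is equality almost everywhere on \<open>G\<close>.\<close>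

definition Lp :: "real \<Rightarrow> 'a::euclidean_space set \<Rightarrow> ('a \<Rightarrow> 'b::euclidean_space) set" where
  "Lp p G = {u \<in> borel_measurable (lebesgue_on G).
               integrable (lebesgue_on G) (\<lambda>x. norm (u x) powr p)}"

definition Lp_norm :: "real \<Rightarrow> 'a::euclidean_space set \<Rightarrow> ('a \<Rightarrow> 'b::euclidean_space) \<Rightarrow> real" where
  "Lp_norm p G u = (\<integral>x. norm (u x) powr p \<partial>lebesgue_on G) powr (1 / p)"

definition grad :: "(real^'n \<Rightarrow> real) \<Rightarrow> real^'n \<Rightarrow> real^'n" where
  "grad \<phi> x = (\<chi> i. frechet_derivative \<phi> (at x) (axis i 1))"

primrec Ck :: "nat \<Rightarrow> (real^'n \<Rightarrow> real) \<Rightarrow> bool" where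
  "Ck 0 \<phi> \<longleftrightarrow> continuous_on UNIV \<phi>"
| "Ck (Suc k) \<phi> \<longleftrightarrow> (\<forall>x. \<phi> differentiable (at x)) \<and> (\<forall>i. Ck k (\<lambda>x. grad \<phi> x $ i))"

definition test_functions :: "(real^'n) set \<Rightarrow> (real^'n \<Rightarrow> real) set" where
  "test_functions G = {\<phi>. (\<forall>k. Ck k \<phi>) \<and> compact (closure {x. \<phi> x \<noteq> 0}) \<and>
                          closure {x. \<phi> x \<noteq> 0} \<subseteq> G}"

definition locally_integrable :: "'a::euclidean_space set \<Rightarrow> ('a \<Rightarrow> 'b::euclidean_space) \<Rightarrow> bool" where
  "locally_integrable G u \<longleftrightarrow> (\<forall>S. compact S \<and> S \<subseteq> G \<longrightarrow> integrable (lebesgue_on S) u)"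

definition has_weak_grad :: "(real^'n) set \<Rightarrow> (real^'n \<Rightarrow> real) \<Rightarrow> (real^'n \<Rightarrow> real^'n) \<Rightarrow> bool" where
  "has_weak_grad G u g \<longleftrightarrow> locally_integrable G u \<and> locally_integrable G g \<and>
     (\<forall>\<phi>\<in>test_functions G.
        (\<integral>x. u x *\<^sub>R grad \<phi> x \<partial>lebesgue_on G) = - (\<integral>x. \<phi> x *\<^sub>R g x \<partial>lebesgue_on G))"

text \<open>A weak gradient on an open set is unique up to null sets, so the choice of the
  representative is immaterial.\<close>

definition weak_grad :: "(real^'n) set \<Rightarrow> (real^'n \<Rightarrow> real) \<Rightarrow> real^'n \<Rightarrow> real^'n" where
  "weak_grad G u = (SOME g. has_weak_grad G u g)"

definition W1p :: "real \<Rightarrow> (real^'n) set \<Rightarrow> (real^'n \<Rightarrow> real) set" where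
  "W1p p G = {u \<in> Lp p G. \<exists>g \<in> Lp p G. has_weak_grad G u g}"

definition W1p_norm :: "real \<Rightarrow> (real^'n) set \<Rightarrow> (real^'n \<Rightarrow> real) \<Rightarrow> real" where
  "W1p_norm p G u = (Lp_norm p G u powr p + Lp_norm p G (weak_grad G u) powr p) powr (1 / p)"

section \<open>Boundary traces\<close>

text \<open>One-dimensional Hausdorff measure, normalised so that a segment has its length as
  measure. The covering sets are required to be bounded because \<^const>\<open>diameter\<close> is not
  meaningful on unbounded sets.\<close>

definition hausdorff1_outer :: "'a::euclidean_space set \<Rightarrow> ennreal" where
  "hausdorff1_outer A =
     (SUP \<delta>\<in>{(0::real)<..}. INF E\<in>{E :: nat \<Rightarrow> 'a set. A \<subseteq> (\<Union>i. E i) \<and>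
        (\<forall>i. bounded (E i) \<and> diameter (E i) \<le> \<delta>)}. \<Sum>i. ennreal (diameter (E i)))"

definition hausdorff1 :: "'a::euclidean_space measure" where
  "hausdorff1 = measure_of UNIV (sets borel) hausdorff1_outer"

text \<open>\<open>g\<close> is the trace of \<open>v \<in> W\<^sup>1\<^sup>,\<^sup>1(G)\<close> on the portion \<open>S\<close> of the boundary of \<open>G\<close>: the graph of
  the continuous extension to \<open>W\<^sup>1\<^sup>,\<^sup>1(G)\<close> of the restriction map \<open>\<phi> \<mapsto> \<phi>|S\<close>, which is defined on
  functions of class \<open>C\<^sup>1\<close> up to the boundary and has values in \<open>L\<^sup>1(S)\<close> with respect to arc
  length. On a bounded set \<open>W\<^sup>1\<^sup>,\<^sup>2(G) \<subseteq> W\<^sup>1\<^sup>,\<^sup>1(G)\<close>, so this also covers traces of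
  \<open>W\<^sup>1\<^sup>,\<^sup>2\<close> functions.\<close>

definition has_trace ::
    "(real^2) set \<Rightarrow> (real^2) set \<Rightarrow> (real^2 \<Rightarrow> real) \<Rightarrow> (real^2 \<Rightarrow> real) \<Rightarrow> bool" where
  "has_trace G S v g \<longleftrightarrow> v \<in> W1p 1 G \<and> g \<in> borel_measurable borel \<and>
     (\<integral>\<^sup>+x\<in>S. ennreal \<bar>g x\<bar> \<partial>hausdorff1) < \<infinity> \<and>
     (\<exists>\<phi> :: nat \<Rightarrow> real^2 \<Rightarrow> real.
        (\<forall>n. Ck 1 (\<phi> n) \<and> \<phi> n \<in> W1p 1 G) \<and>
        (\<lambda>n. W1p_norm 1 G (\<lambda>x. \<phi> n x - v x)) \<longlonglongrightarrow> 0 \<and>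
        (\<lambda>n. \<integral>\<^sup>+x\<in>S. ennreal \<bar>\<phi> n x - g x\<bar> \<partial>hausdorff1) \<longlonglongrightarrow> 0)"

text \<open>As the trace map is linear, \<open>v = f\<close> on \<open>S\<close> means that \<open>v - f\<close> has trace zero on \<open>S\<close>.\<close>

definition eq_trace ::
    "(real^2) set \<Rightarrow> (real^2) set \<Rightarrow> (real^2 \<Rightarrow> real) \<Rightarrow> (real^2 \<Rightarrow> real) \<Rightarrow> bool" where
  "eq_trace G S v f \<longleftrightarrow> has_trace G S (\<lambda>x. v x - f x) (\<lambda>_. 0)"

section \<open>The operator T\<close>

definition gauss_kernel :: "real \<Rightarrow> real^2 \<Rightarrow> real" where
  "gauss_kernel \<sigma> z = 1 / (2 * pi * \<sigma>\<^sup>2) * exp (- ((norm z)\<^sup>2 / (2 * \<sigma>\<^sup>2)))"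

definition smoothed :: "(real^2) set \<Rightarrow> real \<Rightarrow> (real^2 \<Rightarrow> real) \<Rightarrow> real^2 \<Rightarrow> real" where
  "smoothed G \<sigma> w x = (\<integral>z. gauss_kernel \<sigma> (x - z) * w z \<partial>lebesgue_on G)"

definition J_functional :: "(real^2) set \<Rightarrow> (real^2 \<Rightarrow> real^2^2) \<Rightarrow> real \<Rightarrow>
    (real^2 \<Rightarrow> real) \<Rightarrow> (real^2 \<Rightarrow> real) \<Rightarrow> real" where
  "J_functional G D \<sigma> w v =
     (\<integral>x. (D (grad (smoothed G \<sigma> w) x) *v weak_grad G v x) \<bullet> weak_grad G v x \<partial>lebesgue_on G)"

definition admissible :: "(real^2) set \<Rightarrow> (real^2) set \<Rightarrow> (real^2 \<Rightarrow> real) \<Rightarrow> (real^2 \<Rightarrow> real) set" where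
  "admissible G K f = {v \<in> W1p 2 G. eq_trace G (frontier K) v f}"

text \<open>The minimiser is unique as an element of \<open>W\<^sup>1\<^sup>,\<^sup>2(G)\<close>; as in \<^const>\<open>weak_grad\<close>, the choice
  operator only selects a representative.\<close>

definition T_op :: "(real^2) set \<Rightarrow> (real^2) set \<Rightarrow> (real^2 \<Rightarrow> real) \<Rightarrow> (real^2 \<Rightarrow> real^2^2) \<Rightarrow>
    real \<Rightarrow> (real^2 \<Rightarrow> real) \<Rightarrow> real^2 \<Rightarrow> real" where
  "T_op G K f D \<sigma> w = (SOME v. v \<in> admissible G K f \<and>
     (\<forall>v'\<in>admissible G K f. J_functional G D \<sigma> w v \<le> J_functional G D \<sigma> w v'))"

end

theory Submission
  imports Defs "HOL-Complex_Analysis.Great_Picard"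
begin

text \<open>
  From the first step on, each iterate minimises a quadratic energy
  \<open>\<integral> A\<^sub>j \<nabla>v \<bullet> \<nabla>v\<close> with \<open>A\<^sub>j = D (\<nabla>(u\<^sub>j)\<^sub>\<sigma>)\<close> among the \<open>W\<^sup>1\<^sup>,\<^sup>2\<close> functions on \<open>G\<close> that equal \<open>f\<close>
  on \<open>\<partial>K\<close>. Both assertions rest on the fact that \<open>A\<^sub>j\<close> depends on \<open>u\<^sub>j\<close> only through a Gaussian
  average, which is controlled by the \<open>L\<^sup>1\<close> norm of \<open>u\<^sub>j\<close>.

  \<^emph>\<open>Bounds.\<close> Write \<open>b\<^sub>j\<close> for the \<open>L\<^sup>1\<close> norm of \<open>u\<^sub>j\<close>. The smoothed gradient is at most \<open>\<kappa> b\<^sub>j\<close>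
  (\<open>smoothed_gradient\<close>), so \<open>A\<^sub>j\<close> is elliptic with constant \<open>c1 / (1 + \<kappa> b\<^sub>j)\<close>, and comparing \<open>u\<^sub>j\<^sub>+\<^sub>1\<close>
  with the competitor \<open>f\<close> bounds the squared \<open>L\<^sup>2\<close> norm of its gradient by a multiple of \<open>1 + \<kappa> b\<^sub>j\<close>.
  With the Poincare inequality this gives \<open>b\<^sub>j\<^sub>+\<^sub>1 \<le> \<alpha> + \<beta> sqrt (1 + \<kappa> b\<^sub>j)\<close>. Such a recursion stays
  bounded (\<open>sublinear_recursion_bounded\<close>), whence uniform ellipticity and uniform bounds for the
  gradients in \<open>L\<^sup>2\<close>. The \<open>L\<^sup>2\<close> norms of the functions follow from a Poincare inequality in \<open>L\<^sup>2\<close>,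
  which is deduced from the one in \<open>L\<^sup>1\<close> by inserting a regularised square (\<open>square_le_poincare\<close>).

  \<^emph>\<open>Convergence.\<close> The smoothed gradients are uniformly Lipschitz, so along a subsequence the fields
  \<open>A\<^sub>j\<close> are uniformly Cauchy on \<open>G\<close>. Minimisers depend continuously on the field: the parallelogram
  law for quadratic energies controls the \<open>L\<^sup>2\<close> distance of the gradients of two minimisers by the
  uniform distance of the fields (\<open>minimiser_stability\<close>). Hence the gradients of the next iterates
  converge in \<open>L\<^sup>2\<close>, and by the Poincare inequality so do the functions. The same law shows that minimising
  sequences are Cauchy, which yields the minimisers in the first place (\<open>minimiser_exists\<close>).

  To speak about weak gradients at all, one needs that they are unique almost everywhere
  (\<open>weak_grad_unique\<close>), that they extend the classical gradient (\<open>has_weak_grad_C1\<close>), and that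
  vanishing of the trace is stable under linear combinations, \<open>L\<^sup>1\<close> limits and composition with
  Lipschitz functions of class \<open>C\<^sup>1\<close> that vanish at \<open>0\<close>
  (\<open>zero_trace_lincomb\<close>, \<open>zero_trace_closed\<close>, \<open>zero_trace_compose\<close>).
\<close>

section \<open>Smooth functions and bump functions\<close>

lemma has_derivative_grad:
  fixes \<phi> :: "real^'n \<Rightarrow> real"
  assumes "\<phi> differentiable (at x)"
  shows "(\<phi> has_derivative (\<lambda>h. grad \<phi> x \<bullet> h)) (at x)"
proof -
  let ?D = "frechet_derivative \<phi> (at x)"
  have D: "(\<phi> has_derivative ?D) (at x)" using assms frechet_derivative_works by blast
  then have lin: "linear ?D" by (rule has_derivative_linear)
  have "?D h = grad \<phi> x \<bullet> h" for h
  proof -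
    have "?D h = ?D (\<Sum>i\<in>UNIV. h $ i *s axis i 1)" by (simp add: basis_expansion)
    also have "\<dots> = (\<Sum>i\<in>UNIV. h $ i * ?D (axis i 1))"
      by (simp add: scalar_mult_eq_scaleR linear_sum[OF lin] linear_cmul[OF lin])
    finally show ?thesis by (simp add: grad_def inner_vec_def mult.commute)
  qed
  with D show ?thesis by (metis (no_types, lifting) ext)
qed

lemma grad_eqI:
  fixes \<phi> :: "real^'n \<Rightarrow> real"
  assumes "(\<phi> has_derivative (\<lambda>h. v \<bullet> h)) (at x)"
  shows "grad \<phi> x = v"
  by (simp add: grad_def vec_eq_iff inner_axis flip: frechet_derivative_at[OF assms])

text \<open>The classes \<open>Ck\<close> are defined through \<^const>\<open>frechet_derivative\<close>; this rule and its converse below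
  allow one to work with an explicit derivative \<open>P x \<bullet> h\<close> instead.\<close>

lemma Ck_SucI:
  fixes \<phi> :: "real^'n \<Rightarrow> real"
  assumes "\<And>x. (\<phi> has_derivative (\<lambda>h. P x \<bullet> h)) (at x)" and "\<And>i. Ck k (\<lambda>x. P x $ i)"
  shows "Ck (Suc k) \<phi>"
proof -
  have "grad \<phi> = P" using grad_eqI[OF assms(1)] by (intro ext)
  with assms show ?thesis by (auto simp: differentiable_def)
qed

lemma Ck_SucD:
  fixes \<phi> :: "real^'n \<Rightarrow> real"
  assumes "Ck (Suc k) \<phi>"
  shows "(\<phi> has_derivative (\<lambda>h. grad \<phi> x \<bullet> h)) (at x)" "Ck k (\<lambda>x. grad \<phi> x $ i)"
  using assms has_derivative_grad by auto

lemma Ck_SucD_Ck: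
  fixes \<phi> :: "real^'n \<Rightarrow> real"
  shows "Ck (Suc k) \<phi> \<Longrightarrow> Ck k \<phi>"
proof (induction k arbitrary: \<phi>)
  case 0
  then show ?case
    by (auto intro!: continuous_at_imp_continuous_on differentiable_imp_continuous_within)
next
  case (Suc k)
  have "Ck k (\<lambda>x. grad \<phi> x $ i)" for i
    by (rule Suc.IH) (use Suc.prems in simp)
  with Suc.prems show ?case by simp
qed

lemma Ck_const: "Ck k (\<lambda>x::real^'n. c::real)"
proof (induction k arbitrary: c)
  case (Suc k)
  show ?case by (rule Ck_SucI[where P = "\<lambda>x. 0"]) (auto simp: Suc)
qed simp

lemma Ck_add:
  fixes \<phi> \<psi> :: "real^'n \<Rightarrow> real"
  shows "Ck k \<phi> \<Longrightarrow> Ck k \<psi> \<Longrightarrow> Ck k (\<lambda>x. \<phi> x + \<psi> x)"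
proof (induction k arbitrary: \<phi> \<psi>)
  case 0 then show ?case by (auto intro: continuous_on_add)
next
  case (Suc k)
  note d = Suc.prems[THEN Ck_SucD(1)]
  show ?case
  proof (rule Ck_SucI[where P = "\<lambda>x. grad \<phi> x + grad \<psi> x"])
    show "((\<lambda>x. \<phi> x + \<psi> x) has_derivative (\<lambda>h. (grad \<phi> x + grad \<psi> x) \<bullet> h)) (at x)" for x
      using has_derivative_add[OF d(1)[of x] d(2)[of x]] by (simp add: inner_add_left)
    show "Ck k (\<lambda>x. (grad \<phi> x + grad \<psi> x) $ i)" for i
      using Suc.IH Suc.prems[THEN Ck_SucD(2)] by simp
  qed
qed

text \<open>The product rule only lowers the order of one factor at a time, so the induction needs that
  \<open>Ck (Suc k)\<close> is contained in \<open>Ck k\<close>.\<close>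

lemma Ck_mult:
  fixes \<phi> \<psi> :: "real^'n \<Rightarrow> real"
  shows "Ck k \<phi> \<Longrightarrow> Ck k \<psi> \<Longrightarrow> Ck k (\<lambda>x. \<phi> x * \<psi> x)"
proof (induction k arbitrary: \<phi> \<psi>)
  case 0 then show ?case by (auto intro: continuous_on_mult)
next
  case (Suc k)
  note d = Suc.prems[THEN Ck_SucD(1)]
  show ?case
  proof (rule Ck_SucI[where P = "\<lambda>x. \<phi> x *\<^sub>R grad \<psi> x + \<psi> x *\<^sub>R grad \<phi> x"])
    show "((\<lambda>x. \<phi> x * \<psi> x) has_derivative (\<lambda>h. (\<phi> x *\<^sub>R grad \<psi> x + \<psi> x *\<^sub>R grad \<phi> x) \<bullet> h)) (at x)" for x
      using has_derivative_mult[OF d(1)[of x] d(2)[of x]] by (simp add: inner_add_left algebra_simps)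
    show "Ck k (\<lambda>x. (\<phi> x *\<^sub>R grad \<psi> x + \<psi> x *\<^sub>R grad \<phi> x) $ i)" for i
      using Suc.IH Suc.prems[THEN Ck_SucD(2)] Suc.prems[THEN Ck_SucD_Ck] by (simp add: Ck_add)
  qed
qed

lemma Ck_prod:
  fixes \<phi> :: "'i \<Rightarrow> real^'n \<Rightarrow> real"
  assumes "finite I" "\<And>i. i \<in> I \<Longrightarrow> Ck k (\<phi> i)"
  shows "Ck k (\<lambda>x. \<Prod>i\<in>I. \<phi> i x)"
  using assms by (induction I rule: finite_induct) (auto intro: Ck_const Ck_mult)

text \<open>Up to the rational factor \<open>inverse t ^ m\<close> this is Cauchy's function \<open>exp (-1/t)\<close>, which is flat at
  \<open>0\<close>. The factor is built in because then the family is closed under differentiation, and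
  infinite differentiability follows by induction for all \<open>m\<close> at once.\<close>

definition flat_exp :: "nat \<Rightarrow> real \<Rightarrow> real" where
  "flat_exp m t = (if t > 0 then exp (- inverse t) * inverse t ^ m else 0)"

text \<open>In the variable \<open>1/t\<close> this is the domination of powers by the exponential. It gives both the
  continuity of \<^term>\<open>flat_exp m\<close> at the origin and, applied to \<open>Suc m\<close>, the vanishing of the
  difference quotient there.\<close>

lemma flat_exp_tendsto_0: "(flat_exp m \<longlongrightarrow> 0) (at 0)"
proof -
  have "((\<lambda>t. inverse t ^ m / exp (inverse t)) \<longlongrightarrow> (0::real)) (at_right 0)"
    by (rule filterlim_compose[OF tendsto_power_div_exp_0 filterlim_inverse_at_top_right])
  then have "(flat_exp m \<longlongrightarrow> 0) (at_right 0)"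
    by (rule Lim_transform_eventually)
      (auto simp: flat_exp_def exp_minus field_simps eventually_at_right_less intro: eventually_at_rightI[of 0 1])
  moreover have "(flat_exp m \<longlongrightarrow> 0) (at_left 0)"
    by (rule Lim_transform_eventually[OF tendsto_const])
      (auto simp: flat_exp_def intro: eventually_at_leftI[of "-1"])
  ultimately show ?thesis by (simp add: filterlim_at_split)
qed

lemma DERIV_flat_exp:
  "(flat_exp m has_real_derivative flat_exp (m + 2) t - m * flat_exp (m + 1) t) (at t)"
proof (cases t "0::real" rule: linorder_cases)
  case less
  have "((\<lambda>_. 0) has_real_derivative 0) (at t)" by simp
  then have "(flat_exp m has_real_derivative 0) (at t)"
    by (rule has_field_derivative_transform_within_open[where S = "{..<0}"])
      (use less in \<open>auto simp: flat_exp_def\<close>)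
  with less show ?thesis by (simp add: flat_exp_def)
next
  case equal
  have "(\<lambda>h. (flat_exp m (0 + h) - flat_exp m 0) / h) = flat_exp (Suc m)"
    by (auto simp: flat_exp_def field_simps)
  then show ?thesis
    using flat_exp_tendsto_0[of "Suc m"] equal by (simp add: DERIV_def flat_exp_def)
next
  case greater
  have "((\<lambda>t. exp (- inverse t) * inverse t ^ m) has_real_derivative
     flat_exp (m + 2) t - m * flat_exp (m + 1) t) (at t)"
  proof (cases m)
    case 0
    then show ?thesis using greater
      by (auto intro!: derivative_eq_intros simp: flat_exp_def power2_eq_square power_Suc)
  next
    case (Suc k)
    then show ?thesis using greater
      by (auto intro!: derivative_eq_intros simp: flat_exp_def power2_eq_square algebra_simps
                    simp flip: power_Suc power_Suc2)
  qed
  then show ?thesis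
    by (rule has_field_derivative_transform_within_open[where S = "{0<..}"])
      (use greater in \<open>auto simp: flat_exp_def\<close>)
qed

lemma continuous_flat_exp: "continuous_on UNIV (flat_exp m)"
  by (intro continuous_at_imp_continuous_on ballI DERIV_isCont[OF DERIV_flat_exp])

lemma flat_exp_bounds: "0 \<le> flat_exp 0 t" "flat_exp 0 t \<le> 1"
  by (auto simp: flat_exp_def)

lemma Ck_flat_exp: "Ck k (\<lambda>x::real^'n. flat_exp m (a * x $ j + b))"
proof (induction k arbitrary: m)
  case 0
  show ?case
    by (auto intro!: continuous_on_compose2[OF continuous_flat_exp] continuous_intros)
next
  case (Suc k)
  let ?d = "\<lambda>x::real^'n. flat_exp (m + 2) (a * x $ j + b) - m * flat_exp (m + 1) (a * x $ j + b)"
  have d: "Ck k ?d"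
    using Ck_add[OF Suc[of "m + 2"] Ck_mult[OF Ck_const[of k "- real m"] Suc[of "m + 1"]]] by simp
  show ?case
  proof (rule Ck_SucI[where P = "\<lambda>x. (?d x * a) *\<^sub>R axis j 1"])
    fix x :: "real^'n"
    have "((\<lambda>x::real^'n. a * x $ j + b) has_derivative (\<lambda>h. a * h $ j)) (at x)"
      by (auto intro!: derivative_eq_intros bounded_linear_imp_has_derivative bounded_linear_vec_nth)
    from has_derivative_compose[OF this DERIV_flat_exp[unfolded has_field_derivative_def]]
    show "((\<lambda>x::real^'n. flat_exp m (a * x $ j + b)) has_derivative
       (\<lambda>h. ((?d x * a) *\<^sub>R axis j 1) \<bullet> h)) (at x)"
      by (simp add: inner_axis' mult.assoc)
  next
    fix i
    show "Ck k (\<lambda>x. ((?d x * a) *\<^sub>R axis j 1) $ i)"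
      using Ck_mult[OF Ck_mult[OF d Ck_const[of k a]] Ck_const[of k "axis j 1 $ i"]]
      by simp
  qed
qed

text \<open>The scaling by \<^term>\<open>Suc n\<close> steepens the flanks while the support stays inside the box, since
  \<open>flat_exp 0 (c * t)\<close> tends to the indicator of \<open>t > 0\<close> as \<open>c\<close> grows.\<close>

definition box_bump :: "real^'n \<Rightarrow> real^'n \<Rightarrow> nat \<Rightarrow> real^'n \<Rightarrow> real" where
  "box_bump a b n x = (\<Prod>j\<in>UNIV. flat_exp 0 (real (Suc n) * (x $ j - a $ j))
                               * flat_exp 0 (real (Suc n) * (b $ j - x $ j)))"

lemma box_bump_nonzero_iff: "box_bump a b n x \<noteq> 0 \<longleftrightarrow> x \<in> box a b"
  by (auto simp: box_bump_def flat_exp_def mem_box_cart zero_less_mult_iff)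

lemma box_bump_bounds: "0 \<le> box_bump a b n x" "box_bump a b n x \<le> 1"
  unfolding box_bump_def
  by (auto intro!: prod_nonneg prod_le_1 mult_nonneg_nonneg mult_le_one flat_exp_bounds)

lemma box_bump_test_function:
  assumes "cbox a b \<subseteq> G"
  shows "box_bump a b n \<in> test_functions G"
proof -
  have "Ck k (box_bump a b n)" for k
    unfolding box_bump_def
    using Ck_flat_exp[of k 0 "real (Suc n)" _ "- real (Suc n) * a $ _"]
          Ck_flat_exp[of k 0 "- real (Suc n)" _ "real (Suc n) * b $ _"]
    by (intro Ck_prod Ck_mult) (simp_all add: algebra_simps)
  moreover have "closure {x. box_bump a b n x \<noteq> 0} \<subseteq> cbox a b"
    by (rule closure_minimal) (auto simp: box_bump_nonzero_iff closed_cbox intro: box_subset_cbox[THEN subsetD])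
  moreover from this have "compact (closure {x. box_bump a b n x \<noteq> 0})"
    by (meson bounded_cbox bounded_subset closed_closure compact_eq_bounded_closed)
  ultimately show ?thesis using assms by (auto simp: test_functions_def)
qed

lemma box_bump_tendsto: "(\<lambda>n. box_bump a b n x) \<longlonglongrightarrow> indicator (box a b) x"
proof (cases "x \<in> box a b")
  case True
  have e: "(\<lambda>n. flat_exp 0 (real (Suc n) * t)) \<longlonglongrightarrow> 1" if "t > 0" for t
  proof -
    have "(\<lambda>n. exp (- (inverse (real (Suc n)) * inverse t))) \<longlonglongrightarrow> exp (- (0 * inverse t))"
      by (intro tendsto_intros LIMSEQ_inverse_real_of_nat)
    then show ?thesis using that by (simp add: flat_exp_def zero_less_mult_iff)
  qed
  have "(\<lambda>n. box_bump a b n x) \<longlonglongrightarrow> (\<Prod>j\<in>(UNIV::'a set). 1 * 1)"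
    unfolding box_bump_def using True by (intro tendsto_prod tendsto_mult e) (auto simp: mem_box_cart)
  with True show ?thesis by simp
next
  case False
  then have "box_bump a b n x = 0" for n using box_bump_nonzero_iff by blast
  with False show ?thesis by simp
qed

section \<open>Uniqueness of weak gradients\<close>

text \<open>Boxes are stable under intersection and generate the Borel sets, and the sets over which \<open>h\<close>
  integrates to zero form a Dynkin system; Lebesgue sets differ from Borel sets by null sets.\<close>

lemma box_integrals_zero_imp_AE_zero:
  fixes h :: "'a::euclidean_space \<Rightarrow> 'b::euclidean_space"
  assumes h: "integrable lebesgue h"
    and box0: "\<And>a b. set_lebesgue_integral lebesgue (box a b) h = 0"
    and supp: "\<And>x. x \<notin> box p q \<Longrightarrow> h x = 0"
  shows "AE x in lebesgue. h x = 0"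
proof -
  have total: "integral\<^sup>L lebesgue h = 0"
  proof -
    have "(\<lambda>x. indicat_real (box p q) x *\<^sub>R h x) = h"
      using supp by (auto simp: indicator_def)
    then show ?thesis using box0[of p q] by (simp add: set_lebesgue_integral_def)
  qed
  have sint: "set_integrable lebesgue A h" if "A \<in> sets lebesgue" for A
    using h that by (simp add: set_integrable_def integrable_mult_indicator)
  have sb: "sigma_sets UNIV (range (\<lambda>(a, b). box a b)) = sets (borel :: 'a measure)"
    by (simp add: borel_eq_box)
  have borel0: "set_lebesgue_integral lebesgue A h = 0"
    if "A \<in> sigma_sets UNIV (range (\<lambda>(a, b). box a b))" for A
  proof -
    have stab: "Int_stable (range (\<lambda>(a, b). box a b :: 'a set))"
      by (auto simp: Int_stable_def box_Int_box)
    have sub: "range (\<lambda>(a, b). box a b :: 'a set) \<subseteq> Pow UNIV" by simp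
    from that show ?thesis
    proof (induction rule: sigma_sets_induct_disjoint[OF stab sub, consumes 1, case_names basic empty compl union])
      case (basic A) then show ?case using box0 by auto
    next
      case empty show ?case by (simp add: set_lebesgue_integral_def)
    next
      case (compl A)
      then have A: "A \<in> sets lebesgue" by (simp add: sb)
      have "indicat_real (UNIV - A) x *\<^sub>R h x = h x - indicat_real A x *\<^sub>R h x" for x
        by (auto simp: indicator_def)
      then show ?case
        using compl total h integrable_mult_indicator[OF A h]
        by (simp add: set_lebesgue_integral_def)
    next
      case (union A)
      then have A: "A i \<in> sets lebesgue" for i by (auto simp: sb)
      have "set_lebesgue_integral lebesgue (\<Union>i. A i) h = (\<Sum>i. set_lebesgue_integral lebesgue (A i) h)"
        using union(1) A by (intro lebesgue_integral_countable_add sint) (auto simp: disjoint_family_on_def)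
      then show ?case using union by simp
    qed
  qed
  interpret sigma_finite_measure "lebesgue :: 'a measure"
  proof
    obtain A :: "'a set set" where "countable A" "A \<subseteq> sets lborel" "\<Union>A = space lborel" "\<forall>a\<in>A. emeasure lborel a \<noteq> \<infinity>"
      using lborel.sigma_finite_countable by metis
    then show "\<exists>A::'a set set. countable A \<and> A \<subseteq> sets lebesgue \<and> \<Union>A = space lebesgue \<and> (\<forall>a\<in>A. emeasure lebesgue a \<noteq> \<infinity>)"
      by (intro exI[of _ A]) (auto simp: subset_iff)
  qed
  show ?thesis
  proof (rule density_zero[OF h])
    fix A :: "'a set" assume "A \<in> sets lebesgue"
    then obtain S N N' where S: "A = S \<union> N" "S \<in> sets lborel" "N' \<in> null_sets lborel" "N \<subseteq> N'"
      by (rule sets_completionE)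
    have N: "N' \<in> null_sets lebesgue" using S(3) by (rule null_sets_completionI)
    have "AE x in lebesgue. indicat_real A x *\<^sub>R h x = indicat_real S x *\<^sub>R h x"
      using AE_not_in[OF N] by eventually_elim (use S in \<open>auto simp: indicator_def\<close>)
    then have "set_lebesgue_integral lebesgue A h = set_lebesgue_integral lebesgue S h"
      unfolding set_lebesgue_integral_def
      using h \<open>A \<in> sets lebesgue\<close> S(2)
      by (intro integral_cong_AE borel_measurable_scaleR borel_measurable_indicator) auto
    also have "\<dots> = 0" using S(2) by (intro borel0) (simp add: sb)
    finally show "set_lebesgue_integral lebesgue A h = 0" .
  qed
qed

text \<open>Moves integrals between the domain and a compact set (or the whole space) that carries the
  integrand; test functions make such integrands out of locally integrable functions.\<close>

lemma integrable_restrict_supp: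
  fixes f :: "'a::euclidean_space \<Rightarrow> 'b::euclidean_space"
  assumes "S \<in> sets lebesgue" "G \<in> sets lebesgue" "S \<subseteq> G"
    and "\<And>x. x \<in> G \<Longrightarrow> x \<notin> S \<Longrightarrow> f x = 0"
  shows "integrable (lebesgue_on G) f \<longleftrightarrow> integrable (lebesgue_on S) f"
    and "integral\<^sup>L (lebesgue_on G) f = integral\<^sup>L (lebesgue_on S) f"
proof -
  have "(\<lambda>x. indicat_real G x *\<^sub>R f x) = (\<lambda>x. indicat_real S x *\<^sub>R f x)"
    using assms by (fastforce simp: indicator_def)
  then show "integrable (lebesgue_on G) f \<longleftrightarrow> integrable (lebesgue_on S) f"
    and "integral\<^sup>L (lebesgue_on G) f = integral\<^sup>L (lebesgue_on S) f"
    using assms by (simp_all add: integrable_restrict_space integral_restrict_space)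
qed

lemma integrable_norm_le_mult:
  fixes f :: "'a \<Rightarrow> 'b::{banach, second_countable_topology}" and g :: "'a \<Rightarrow> 'c::{banach, second_countable_topology}"
  assumes g: "integrable M g" and f: "f \<in> borel_measurable M"
    and le: "\<And>x. x \<in> space M \<Longrightarrow> norm (f x) \<le> B * norm (g x)"
  shows "integrable M f"
proof (rule Bochner_Integration.integrable_bound[OF _ f])
  show "integrable M (\<lambda>x. B * norm (g x))" using g by simp
  show "AE x in M. norm (f x) \<le> norm (B * norm (g x))"
    unfolding real_norm_def by (intro AE_I2) (rule order_trans[OF le abs_ge_self])
qed

lemma integrable_scaleR_bounded:
  fixes u :: "'a \<Rightarrow> real" and w :: "'a \<Rightarrow> 'b::{banach, second_countable_topology}"
  assumes "w \<in> borel_measurable M" "integrable M u" "\<And>x. x \<in> space M \<Longrightarrow> norm (w x) \<le> B"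
  shows "integrable M (\<lambda>x. u x *\<^sub>R w x)"
proof (rule integrable_norm_le_mult[OF assms(2)])
  show "norm (u x *\<^sub>R w x) \<le> B * norm (u x)" if "x \<in> space M" for x
    using mult_right_mono[OF assms(3)[OF that], of "\<bar>u x\<bar>"] by (simp add: mult.commute)
qed (use assms(1,2) in \<open>simp add: borel_measurable_scaleR borel_measurable_integrable\<close>)

lemma integrable_bounded_scaleR:
  fixes u :: "'a \<Rightarrow> real" and w :: "'a \<Rightarrow> 'b::{banach, second_countable_topology}"
  assumes "u \<in> borel_measurable M" "integrable M w" "\<And>x. x \<in> space M \<Longrightarrow> \<bar>u x\<bar> \<le> B"
  shows "integrable M (\<lambda>x. u x *\<^sub>R w x)"
proof (rule integrable_norm_le_mult[OF assms(2)])
  show "norm (u x *\<^sub>R w x) \<le> B * norm (w x)" if "x \<in> space M" for x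
    using mult_right_mono[OF assms(3)[OF that], of "norm (w x)"] by simp
qed (use assms(1,2) in \<open>simp add: borel_measurable_scaleR borel_measurable_integrable\<close>)

lemma continuous_measurable_lebesgue_on:
  fixes f :: "'a::euclidean_space \<Rightarrow> 'b::euclidean_space"
  assumes "continuous_on UNIV f"
  shows "f \<in> borel_measurable (lebesgue_on S)"
  by (intro measurable_restrict_space1 measurable_completion)
     (use borel_measurable_continuous_onI[OF assms] in simp)

lemma continuous_integrable_compact:
  fixes f :: "'a::euclidean_space \<Rightarrow> 'b::euclidean_space"
  assumes "continuous_on UNIV f" "compact S"
  shows "integrable (lebesgue_on S) f"
proof -
  interpret finite_measure "lebesgue_on S"
    using assms(2) by (intro finite_measure_lebesgue_on lmeasurable_compact)
  have "compact (f ` S)" using assms compact_continuous_image continuous_on_subset by blast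
  then obtain B where B: "\<And>x. x \<in> S \<Longrightarrow> norm (f x) \<le> B"
    using compact_imp_bounded bounded_iff by (metis imageI)
  show ?thesis
    by (rule integrable_const_bound[of _ B])
      (use B continuous_measurable_lebesgue_on[OF assms(1)] in auto)
qed

lemma test_functions_Ck: "\<phi> \<in> test_functions G \<Longrightarrow> Ck k \<phi>"
  by (simp add: test_functions_def)

lemma test_functions_continuous:
  assumes "\<phi> \<in> test_functions G"
  shows "continuous_on UNIV \<phi>" "continuous_on UNIV (grad \<phi>)"
proof -
  show "continuous_on UNIV \<phi>" using test_functions_Ck[OF assms, of 0] by simp
  have "continuous_on UNIV (\<lambda>x. grad \<phi> x $ i)" for i
    using test_functions_Ck[OF assms, of 1] by simp
  then show "continuous_on UNIV (grad \<phi>)"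
    using continuous_on_vec_lambda[of UNIV "\<lambda>i x. grad \<phi> x $ i"] by simp
qed

lemma grad_eq_0_outside:
  assumes "closed S" "\<And>x. x \<notin> S \<Longrightarrow> \<phi> x = 0" "x \<notin> S"
  shows "grad \<phi> x = 0"
proof (rule grad_eqI)
  have "((\<lambda>_. 0) has_derivative (\<lambda>_. 0)) (at x)" by simp
  then show "(\<phi> has_derivative (\<bullet>) 0) (at x)"
    by (rule has_derivative_transform_within_open[where s = "- S", THEN has_derivative_eq_rhs])
      (use assms in \<open>auto simp: open_Compl\<close>)
qed

lemma test_functions_support:
  assumes "\<phi> \<in> test_functions G"
  obtains S where "compact S" "S \<subseteq> G" "\<And>x. x \<notin> S \<Longrightarrow> \<phi> x = 0" "\<And>x. x \<notin> S \<Longrightarrow> grad \<phi> x = 0"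
proof
  let ?S = "closure {x. \<phi> x \<noteq> 0}"
  show "compact ?S" "?S \<subseteq> G" using assms by (auto simp: test_functions_def)
  show *: "\<phi> x = 0" if "x \<notin> ?S" for x
    using that closure_subset[of "{x. \<phi> x \<noteq> 0}"] by auto
  then show "grad \<phi> x = 0" if "x \<notin> ?S" for x
    using grad_eq_0_outside[of ?S \<phi>, OF closed_closure *] that by blast
qed

lemma test_function_integrable:
  fixes \<phi> :: "real^'n \<Rightarrow> real"
  assumes \<phi>: "\<phi> \<in> test_functions G" and G: "open G"
  shows "locally_integrable G g \<Longrightarrow> integrable (lebesgue_on G) (\<lambda>x. \<phi> x *\<^sub>R (g x :: 'b::euclidean_space))"
    and "locally_integrable G u \<Longrightarrow> integrable (lebesgue_on G) (\<lambda>x. u x *\<^sub>R grad \<phi> x)"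
proof -
  obtain S where S: "compact S" "S \<subseteq> G" "\<And>x. x \<notin> S \<Longrightarrow> \<phi> x = 0" "\<And>x. x \<notin> S \<Longrightarrow> grad \<phi> x = 0"
    using test_functions_support[OF \<phi>] by metis
  note cont = test_functions_continuous[OF \<phi>]
  have bnd: "\<exists>B. \<forall>x\<in>S. norm (f x) \<le> B" if "continuous_on UNIV f" for f :: "real^'n \<Rightarrow> 'c::real_normed_vector"
    using compact_imp_bounded[OF compact_continuous_image[OF continuous_on_subset[OF that] S(1)]]
    by (auto simp: bounded_iff)
  have SG: "S \<in> sets lebesgue" "G \<in> sets lebesgue"
    using S(1) G by (auto intro: lmeasurable_compact fmeasurableD)
  show "integrable (lebesgue_on G) (\<lambda>x. \<phi> x *\<^sub>R g x)" if "locally_integrable G g" for g :: "_ \<Rightarrow> 'b"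
  proof -
    obtain B where "\<And>x. x \<in> S \<Longrightarrow> \<bar>\<phi> x\<bar> \<le> B" using bnd[OF cont(1)] by auto
    moreover have "integrable (lebesgue_on S) g" using that S by (auto simp: locally_integrable_def)
    ultimately have "integrable (lebesgue_on S) (\<lambda>x. \<phi> x *\<^sub>R g x)"
      using continuous_measurable_lebesgue_on[OF cont(1)] by (intro integrable_bounded_scaleR) auto
    then show ?thesis using integrable_restrict_supp(1)[OF SG S(2), of "\<lambda>x. \<phi> x *\<^sub>R g x"] S(3) by auto
  qed
  show "integrable (lebesgue_on G) (\<lambda>x. u x *\<^sub>R grad \<phi> x)" if "locally_integrable G u"
  proof -
    obtain B where "\<And>x. x \<in> S \<Longrightarrow> norm (grad \<phi> x) \<le> B" using bnd[OF cont(2)] by auto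
    moreover have "integrable (lebesgue_on S) u" using that S by (auto simp: locally_integrable_def)
    ultimately have "integrable (lebesgue_on S) (\<lambda>x. u x *\<^sub>R grad \<phi> x)"
      using continuous_measurable_lebesgue_on[OF cont(2)] by (intro integrable_scaleR_bounded) auto
    then show ?thesis using integrable_restrict_supp(1)[OF SG S(2), of "\<lambda>x. u x *\<^sub>R grad \<phi> x"] S(4) by auto
  qed
qed

text \<open>The fundamental lemma of the calculus of variations. Bump functions converge boundedly to the
  indicator of any box whose closure lies in \<open>G\<close>, so dominated convergence turns orthogonality to test
  functions into vanishing integrals over all such boxes; countably many of them exhaust \<open>G\<close>.\<close>

lemma fundamental_lemma:
  fixes g :: "real^'n \<Rightarrow> 'b::euclidean_space"
  assumes G: "open G" and g: "locally_integrable G g"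
    and ortho: "\<And>\<phi>. \<phi> \<in> test_functions G \<Longrightarrow> (\<integral>x. \<phi> x *\<^sub>R g x \<partial>lebesgue_on G) = 0"
  shows "AE x in lebesgue_on G. g x = 0"
proof -
  have Gs: "G \<in> sets lebesgue" using G by auto
  have on_cbox: "AE x in lebesgue. x \<in> cbox a b \<longrightarrow> g x = 0" if ab: "cbox a b \<subseteq> G" for a b
  proof -
    let ?h = "\<lambda>x. indicat_real (box a b) x *\<^sub>R g x"
    have g': "integrable lebesgue (\<lambda>x. indicat_real (cbox a b) x *\<^sub>R g x)"
    proof -
      have "integrable (lebesgue_on (cbox a b)) g" using g ab by (simp add: locally_integrable_def)
      then show ?thesis by (subst (asm) integrable_restrict_space) auto
    qed
    have h: "integrable lebesgue ?h"
    proof -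
      have "?h = (\<lambda>x. indicat_real (box a b) x *\<^sub>R (indicat_real (cbox a b) x *\<^sub>R g x))"
        using box_subset_cbox[of a b] by (intro ext) (auto simp: indicator_def)
      then show ?thesis using integrable_mult_indicator[OF _ g', of "box a b"] by simp
    qed
    have "AE x in lebesgue. ?h x = 0"
    proof (rule box_integrals_zero_imp_AE_zero[OF h, where p = a and q = b])
      fix p q :: "real^'n"
      \<comment> \<open>the intersection of the two boxes is again a box, and its closure stays inside \<open>G\<close>\<close>
      define c where "c = (\<Sum>i\<in>Basis. max (a \<bullet> i) (p \<bullet> i) *\<^sub>R i)"
      define d where "d = (\<Sum>i\<in>Basis. min (b \<bullet> i) (q \<bullet> i) *\<^sub>R i)"
      have cd: "box c d = box a b \<inter> box p q" "cbox c d \<subseteq> G" "cbox c d \<subseteq> cbox a b"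
        using ab by (auto simp: c_def d_def box_Int_box simp flip: Int_interval)
      let ?k = "\<lambda>n x. box_bump c d n x *\<^sub>R g x"
      have zero: "integral\<^sup>L lebesgue (?k n) = 0" for n
      proof -
        have "integral\<^sup>L (lebesgue_on UNIV) (?k n) = integral\<^sup>L (lebesgue_on G) (?k n)"
          using cd(2) box_bump_nonzero_iff[of c d n] box_subset_cbox[of c d] Gs
          by (intro integrable_restrict_supp(2)) auto
        then show ?thesis using ortho[OF box_bump_test_function[OF cd(2)]]
          by (simp add: lebesgue_on_UNIV_eq)
      qed
      have km: "?k n = (\<lambda>x. box_bump c d n x *\<^sub>R (indicat_real (cbox a b) x *\<^sub>R g x))" for n
        using cd(3) box_bump_nonzero_iff[of c d n] box_subset_cbox[of c d]
        by (fastforce simp: indicator_def)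
      have bm: "box_bump c d n \<in> borel_measurable lebesgue" for n
        using continuous_measurable_lebesgue_on[OF test_functions_continuous(1)[OF box_bump_test_function[OF cd(2)]], of n UNIV]
        by (simp add: lebesgue_on_UNIV_eq)
      have "(\<lambda>n. integral\<^sup>L lebesgue (?k n)) \<longlonglongrightarrow> (\<integral>x. indicat_real (box c d) x *\<^sub>R g x \<partial>lebesgue)"
      proof (rule integral_dominated_convergence[where w = "\<lambda>x. norm (indicat_real (cbox a b) x *\<^sub>R g x)"])
        have "(\<lambda>x. indicat_real (box c d) x *\<^sub>R g x) = (\<lambda>x. indicat_real (box c d) x *\<^sub>R (indicat_real (cbox a b) x *\<^sub>R g x))"
          using cd(3) box_subset_cbox[of c d] by (fastforce simp: indicator_def)
        then show "(\<lambda>x. indicat_real (box c d) x *\<^sub>R g x) \<in> borel_measurable lebesgue"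
          using borel_measurable_integrable[OF integrable_mult_indicator[OF _ g', of "box c d"]] by simp
        show "?k n \<in> borel_measurable lebesgue" for n
          unfolding km using bm[of n] borel_measurable_integrable[OF g'] by measurable
        show "integrable lebesgue (\<lambda>x. norm (indicat_real (cbox a b) x *\<^sub>R g x))"
          using g' by (rule integrable_norm)
        show "AE x in lebesgue. (\<lambda>n. ?k n x) \<longlonglongrightarrow> indicat_real (box c d) x *\<^sub>R g x"
          by (intro AE_I2 tendsto_intros box_bump_tendsto)
        show "AE x in lebesgue. norm (?k n x) \<le> norm (indicat_real (cbox a b) x *\<^sub>R g x)" for n
          unfolding fun_cong[OF km] using box_bump_bounds[of c d n]
          by (intro AE_I2) (simp add: mult_left_le_one_le mult.assoc)
      qed
      then have "(\<integral>x. indicat_real (box c d) x *\<^sub>R g x \<partial>lebesgue) = 0"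
        using zero LIMSEQ_unique by (metis (no_types, lifting) tendsto_const ext)
      moreover have "(\<lambda>x. indicat_real (box p q) x *\<^sub>R ?h x) = (\<lambda>x. indicat_real (box c d) x *\<^sub>R g x)"
        by (auto simp: cd(1) indicator_def)
      ultimately show "set_lebesgue_integral lebesgue (box p q) ?h = 0"
        by (simp add: set_lebesgue_integral_def)
    qed auto
    moreover have "AE x in lebesgue. x \<notin> cbox a b - box a b"
      using negligible_frontier_interval[of a b] by (intro AE_not_in) (simp add: negligible_iff_null_sets)
    ultimately show ?thesis by eventually_elim (auto simp: indicator_def)
  qed
  obtain \<D> where \<D>: "countable \<D>" "\<D> \<subseteq> Pow G" "\<And>X. X \<in> \<D> \<Longrightarrow> \<exists>a b. X = cbox a b" "\<Union>\<D> = G"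
    using open_countable_Union_open_cbox[OF G] by metis
  have "AE x in lebesgue. \<forall>X\<in>\<D>. x \<in> X \<longrightarrow> g x = 0"
    using \<D> by (intro AE_ball_countable'[OF _ \<D>(1)]) (metis Pow_iff on_cbox subset_iff)
  then have "AE x in lebesgue. x \<in> G \<longrightarrow> g x = 0"
    by eventually_elim (use \<D>(4) in auto)
  then show ?thesis using Gs by (simp add: AE_restrict_space_iff)
qed

text \<open>This makes the choice in \<^const>\<open>weak_grad\<close> harmless: all that is proved below for an explicit
  weak gradient carries over to the chosen one almost everywhere.\<close>

lemma weak_grad_unique:
  fixes u :: "real^'n \<Rightarrow> real"
  assumes G: "open G" and g: "has_weak_grad G u g" and h: "has_weak_grad G u h"
  shows "AE x in lebesgue_on G. g x = h x"
proof -
  have li: "locally_integrable G g" "locally_integrable G h"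
    using g h by (auto simp: has_weak_grad_def)
  have "AE x in lebesgue_on G. g x - h x = 0"
  proof (rule fundamental_lemma[OF G])
    show "locally_integrable G (\<lambda>x. g x - h x)" using li by (auto simp: locally_integrable_def)
    fix \<phi> :: "real^'n \<Rightarrow> real" assume \<phi>: "\<phi> \<in> test_functions G"
    have "(\<integral>x. \<phi> x *\<^sub>R g x \<partial>lebesgue_on G) = (\<integral>x. \<phi> x *\<^sub>R h x \<partial>lebesgue_on G)"
      using g h \<phi> by (auto simp: has_weak_grad_def)
    then show "(\<integral>x. \<phi> x *\<^sub>R (g x - h x) \<partial>lebesgue_on G) = 0"
      using test_function_integrable(1)[OF \<phi> G li(1)] test_function_integrable(1)[OF \<phi> G li(2)]
      by (simp add: scaleR_right_diff_distrib)
  qed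
  then show ?thesis by simp
qed

lemma has_weak_grad_weak_grad: "has_weak_grad G u g \<Longrightarrow> has_weak_grad G u (weak_grad G u)"
  unfolding weak_grad_def by (rule someI[of "has_weak_grad G u"])

lemma has_weak_grad_lincomb:
  fixes u v :: "real^'n \<Rightarrow> real"
  assumes G: "open G" and g: "has_weak_grad G u g" and h: "has_weak_grad G v h"
  shows "has_weak_grad G (\<lambda>x. a * u x + b * v x) (\<lambda>x. a *\<^sub>R g x + b *\<^sub>R h x)"
  unfolding has_weak_grad_def
proof (intro conjI ballI)
  let ?M = "lebesgue_on G"
  have li: "locally_integrable G g" "locally_integrable G h" "locally_integrable G u" "locally_integrable G v"
    using g h by (auto simp: has_weak_grad_def)
  then show "locally_integrable G (\<lambda>x. a * u x + b * v x)" "locally_integrable G (\<lambda>x. a *\<^sub>R g x + b *\<^sub>R h x)"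
    by (auto simp: locally_integrable_def)
  fix \<phi> :: "real^'n \<Rightarrow> real" assume \<phi>: "\<phi> \<in> test_functions G"
  note int = test_function_integrable(1)[OF \<phi> G li(1)] test_function_integrable(1)[OF \<phi> G li(2)]
     test_function_integrable(2)[OF \<phi> G li(3)] test_function_integrable(2)[OF \<phi> G li(4)]
  have e: "(\<integral>x. u x *\<^sub>R grad \<phi> x \<partial>?M) = - (\<integral>x. \<phi> x *\<^sub>R g x \<partial>?M)"
     "(\<integral>x. v x *\<^sub>R grad \<phi> x \<partial>?M) = - (\<integral>x. \<phi> x *\<^sub>R h x \<partial>?M)"
    using g h \<phi> by (auto simp: has_weak_grad_def)
  have "(\<integral>x. (a * u x + b * v x) *\<^sub>R grad \<phi> x \<partial>?M)
      = (\<integral>x. a *\<^sub>R (u x *\<^sub>R grad \<phi> x) + b *\<^sub>R (v x *\<^sub>R grad \<phi> x) \<partial>?M)"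
    by (simp add: scaleR_add_left)
  also have "\<dots> = a *\<^sub>R (\<integral>x. u x *\<^sub>R grad \<phi> x \<partial>?M) + b *\<^sub>R (\<integral>x. v x *\<^sub>R grad \<phi> x \<partial>?M)"
    using int by (simp del: scaleR_scaleR)
  also have "\<dots> = - (a *\<^sub>R (\<integral>x. \<phi> x *\<^sub>R g x \<partial>?M) + b *\<^sub>R (\<integral>x. \<phi> x *\<^sub>R h x \<partial>?M))"
    by (simp add: e)
  also have "\<dots> = - (\<integral>x. a *\<^sub>R (\<phi> x *\<^sub>R g x) + b *\<^sub>R (\<phi> x *\<^sub>R h x) \<partial>?M)"
    using int by (simp del: scaleR_scaleR)
  also have "\<dots> = - (\<integral>x. \<phi> x *\<^sub>R (a *\<^sub>R g x + b *\<^sub>R h x) \<partial>?M)"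
    by (simp add: scaleR_add_right mult.commute)
  finally show "(\<integral>x. (a * u x + b * v x) *\<^sub>R grad \<phi> x \<partial>?M)
      = - (\<integral>x. \<phi> x *\<^sub>R (a *\<^sub>R g x + b *\<^sub>R h x) \<partial>?M)" .
qed

section \<open>Classical gradients and limits of weak gradients\<close>

lemma continuous_integrable_compact_support:
  fixes f :: "'a::euclidean_space \<Rightarrow> 'b::euclidean_space"
  assumes "continuous_on UNIV f" "compact S" "\<And>x. x \<notin> S \<Longrightarrow> f x = 0"
  shows "integrable lebesgue f"
  using integrable_restrict_supp(1)[of S UNIV f] continuous_integrable_compact[OF assms(1,2)]
    fmeasurableD[OF lmeasurable_compact[OF assms(2)]] assms(3)
  by (simp add: lebesgue_on_UNIV_eq)

lemma continuous_compact_support_bounded: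
  fixes f :: "'a::topological_space \<Rightarrow> 'b::real_normed_vector"
  assumes "continuous_on UNIV f" "compact S" "\<And>x. x \<notin> S \<Longrightarrow> f x = 0"
  obtains B where "\<And>x. norm (f x) \<le> B"
proof -
  have "bounded (f ` S)"
    using assms by (intro compact_imp_bounded compact_continuous_image continuous_on_subset[OF assms(1)]) auto
  then obtain B where B: "\<And>x. x \<in> S \<Longrightarrow> norm (f x) \<le> B" by (auto simp: bounded_iff)
  show thesis
  proof (rule that)
    show "norm (f x) \<le> max B 0" for x
      using B[of x] assms(3)[of x] by (cases "x \<in> S") (simp_all add: le_max_iff_disj)
  qed
qed

lemma integral_translate:
  fixes f :: "'a::euclidean_space \<Rightarrow> real"
  assumes "continuous_on UNIV f"
  shows "(\<integral>x. f (c + x) \<partial>lebesgue) = (\<integral>x. f x \<partial>lebesgue)"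
proof -
  have [measurable]: "f \<in> borel_measurable borel"
    using assms by (rule borel_measurable_continuous_onI)
  have "integral\<^sup>L lborel f = integral\<^sup>L (distr lborel borel ((+) c)) f"
    by (simp add: lborel_distr_plus)
  also have "\<dots> = (\<integral>x. f (c + x) \<partial>lborel)"
    by (rule integral_distr) auto
  finally show ?thesis by (simp add: integral_completion)
qed

lemma Ck_1_continuous_grad: "Ck 1 \<phi> \<Longrightarrow> continuous_on UNIV (grad \<phi>)"
  using continuous_on_vec_lambda[of UNIV "\<lambda>i x. grad \<phi> x $ i"] by simp

lemma Ck_1_continuous: "Ck 1 \<phi> \<Longrightarrow> continuous_on UNIV \<phi>"
  using Ck_SucD_Ck[of 0 \<phi>] by simp

text \<open>The difference quotients of \<open>F\<close> in direction \<open>axis i 1\<close> have integral zero by translation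
  invariance; they are bounded by the Lipschitz constant of \<open>F\<close> on a fixed ball, vanish outside it,
  and converge to the partial derivative.\<close>

lemma integral_partial_derivative_eq_0:
  fixes F :: "real^'n \<Rightarrow> real"
  assumes F: "Ck 1 F" and S: "compact S" and supp: "\<And>x. x \<notin> S \<Longrightarrow> F x = 0"
  shows "(\<integral>x. grad F x $ i \<partial>lebesgue) = 0"
proof -
  note cF = Ck_1_continuous[OF F] and cg = Ck_1_continuous_grad[OF F]
  have g0: "grad F x = 0" if "x \<notin> S" for x
    using grad_eq_0_outside[of S F, OF compact_imp_closed[OF S] supp that] by blast
  obtain R where R: "\<And>x. x \<in> S \<Longrightarrow> norm x \<le> R"
    using compact_imp_bounded[OF S] by (auto simp: bounded_iff)
  obtain B where B': "\<And>x. norm (grad F x) \<le> B"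
    using continuous_compact_support_bounded[OF cg S g0] by metis
  have B: "norm (grad F x) \<le> \<bar>B\<bar>" for x
    by (rule order_trans[OF B' abs_ge_self])
  have lip: "\<bar>F x - F y\<bar> \<le> \<bar>B\<bar> * norm (x - y)" for x y
  proof -
    have "norm (F x - F y) \<le> \<bar>B\<bar> * norm (x - y)"
    proof (rule differentiable_bound[of UNIV])
      show "(F has_derivative (\<lambda>h. grad F x \<bullet> h)) (at x within UNIV)" for x
        using F Ck_SucD(1)[of 0] by simp
      show "onorm (\<lambda>h. grad F x \<bullet> h) \<le> \<bar>B\<bar>" for x
      proof (rule onorm_bound)
        fix h
        have "\<bar>grad F x \<bullet> h\<bar> \<le> norm (grad F x) * norm h" by (rule Cauchy_Schwarz_ineq2)
        also have "\<dots> \<le> \<bar>B\<bar> * norm h" using B[of x] by (rule mult_right_mono) simp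
        finally show "norm (grad F x \<bullet> h) \<le> \<bar>B\<bar> * norm h" by simp
      qed simp
    qed auto
    then show ?thesis by simp
  qed
  let ?e = "axis i 1 :: real^'n"
  let ?q = "\<lambda>n x. real (Suc n) * (F (inverse (real (Suc n)) *\<^sub>R ?e + x) - F x)"
  have iF: "integrable lebesgue F"
    by (rule continuous_integrable_compact_support[OF cF S supp])
  have iFt: "integrable lebesgue (\<lambda>x. F (c + x))" for c
  proof (rule continuous_integrable_compact_support[of _ "(\<lambda>x. x - c) ` S"])
    show "continuous_on UNIV (\<lambda>x. F (c + x))"
      by (auto intro!: continuous_on_compose2[OF cF] continuous_intros)
    show "compact ((\<lambda>x. x - c) ` S)"
      by (intro compact_continuous_image continuous_intros S)
    show "F (c + x) = 0" if "x \<notin> (\<lambda>x. x - c) ` S" for x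
      using that by (intro supp) (auto simp: image_iff)
  qed
  have zero: "(\<integral>x. ?q n x \<partial>lebesgue) = 0" for n
    using integral_translate[OF cF] iF iFt by simp
  have "(\<lambda>n. \<integral>x. ?q n x \<partial>lebesgue) \<longlonglongrightarrow> (\<integral>x. grad F x $ i \<partial>lebesgue)"
  proof (rule integral_dominated_convergence[where w = "\<lambda>x. indicat_real (cball 0 (R + 1)) x *\<^sub>R \<bar>B\<bar>"])
    show "(\<lambda>x. grad F x $ i) \<in> borel_measurable lebesgue"
      using continuous_measurable_lebesgue_on[of "\<lambda>x. grad F x $ i" UNIV] F
      by (simp add: lebesgue_on_UNIV_eq)
    show "?q n \<in> borel_measurable lebesgue" for n
      using iF iFt by (intro borel_measurable_integrable) simp
    show "integrable lebesgue (\<lambda>x::real^'n. indicat_real (cball 0 (R + 1)) x *\<^sub>R \<bar>B\<bar>)"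
      by (intro integrable_scaleR_left integrable_real_indicator)
         (use lmeasurable_cball[of "0::real^'n" "R + 1"] in \<open>auto simp: fmeasurable_def\<close>)
    show "AE x in lebesgue. (\<lambda>n. ?q n x) \<longlonglongrightarrow> grad F x $ i"
    proof (rule AE_I2)
      fix x
      let ?f = "\<lambda>t. F (t *\<^sub>R ?e + x)"
      have "((\<lambda>t::real. t *\<^sub>R ?e + x) has_derivative (\<lambda>t. t *\<^sub>R ?e)) (at 0)"
        by (auto intro!: derivative_eq_intros)
      moreover have "(F has_derivative (\<lambda>h. grad F x \<bullet> h)) (at (0 *\<^sub>R ?e + x))"
        using F Ck_SucD(1)[of 0] by simp
      ultimately have "(?f has_derivative (\<lambda>t. grad F x \<bullet> (t *\<^sub>R ?e))) (at 0)"
        by (rule has_derivative_compose)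
      then have "(?f has_real_derivative grad F x $ i) (at 0)"
        by (rule has_derivative_imp_has_field_derivative) (simp add: inner_axis)
      then have "((\<lambda>t. (?f t - ?f 0) / t) \<longlongrightarrow> grad F x $ i) (at 0)"
        by (simp add: DERIV_def)
      moreover have "filterlim (\<lambda>n. inverse (real (Suc n))) (at 0) sequentially"
        by (intro filterlim_atI LIMSEQ_inverse_real_of_nat) simp
      ultimately have "(\<lambda>n. (?f (inverse (real (Suc n))) - ?f 0) / inverse (real (Suc n))) \<longlonglongrightarrow> grad F x $ i"
        by (rule filterlim_compose)
      then show "(\<lambda>n. ?q n x) \<longlonglongrightarrow> grad F x $ i"
        by (simp add: divide_inverse mult.commute)
    qed
    show "AE x in lebesgue. norm (?q n x) \<le> indicat_real (cball 0 (R + 1)) x *\<^sub>R \<bar>B\<bar>" for n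
    proof (rule AE_I2)
      fix x
      let ?y = "inverse (real (Suc n)) *\<^sub>R ?e + x"
      show "norm (?q n x) \<le> indicat_real (cball 0 (R + 1)) x *\<^sub>R \<bar>B\<bar>"
      proof (cases "norm x \<le> R + 1")
        case True
        have "\<bar>F ?y - F x\<bar> \<le> \<bar>B\<bar> * inverse (real (Suc n))"
          using lip[of ?y x] by (simp add: norm_axis_1)
        then have "\<bar>F ?y - F x\<bar> \<le> \<bar>B\<bar> / real (Suc n)" by (simp only: divide_inverse)
        then have "real (Suc n) * \<bar>F ?y - F x\<bar> \<le> \<bar>B\<bar>"
          by (subst (asm) pos_le_divide_eq) (simp_all only: of_nat_0_less_iff zero_less_Suc mult.commute)
        moreover have "norm (?q n x) = real (Suc n) * \<bar>F ?y - F x\<bar>" by (simp only: real_norm_def abs_mult abs_of_nat)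
        ultimately show ?thesis using True by (simp only: indicator_simps mem_cball_0 scaleR_one)
      next
        case False
        have "norm x \<le> norm ?y + norm (inverse (real (Suc n)) *\<^sub>R ?e)"
          using norm_triangle_ineq4[of ?y "inverse (real (Suc n)) *\<^sub>R ?e"] by simp
        also have "norm (inverse (real (Suc n)) *\<^sub>R ?e) \<le> 1"
          by (simp add: norm_axis_1 inverse_le_1_iff)
        finally have "norm x \<le> norm ?y + 1" by simp
        then have "F x = 0" "F ?y = 0" using False R by (force intro!: supp)+
        then show ?thesis by simp
      qed
    qed
  qed
  then show ?thesis unfolding zero by (simp add: LIMSEQ_const_iff)
qed

text \<open>Integration by parts: the gradient of the compactly supported product of \<open>\<phi>\<close> with a test
  function integrates to zero.\<close>

lemma has_weak_grad_C1:
  fixes \<phi> :: "real^'n \<Rightarrow> real"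
  assumes G: "open G" and \<phi>: "Ck 1 \<phi>"
  shows "has_weak_grad G \<phi> (grad \<phi>)"
  unfolding has_weak_grad_def
proof (intro conjI ballI)
  let ?M = "lebesgue_on G"
  show li: "locally_integrable G \<phi>" "locally_integrable G (grad \<phi>)"
    using continuous_integrable_compact[OF Ck_1_continuous[OF \<phi>]]
      continuous_integrable_compact[OF Ck_1_continuous_grad[OF \<phi>]]
    by (auto simp: locally_integrable_def)
  fix \<eta> :: "real^'n \<Rightarrow> real" assume \<eta>: "\<eta> \<in> test_functions G"
  obtain S where S: "compact S" "S \<subseteq> G" "\<And>x. x \<notin> S \<Longrightarrow> \<eta> x = 0" "\<And>x. x \<notin> S \<Longrightarrow> grad \<eta> x = 0"
    using test_functions_support[OF \<eta>] by metis
  note int = test_function_integrable(2)[OF \<eta> G li(1)] test_function_integrable(1)[OF \<eta> G li(2)]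
  have \<eta>1: "Ck 1 \<eta>" using test_functions_Ck[OF \<eta>] .
  let ?F = "\<lambda>x. \<phi> x * \<eta> x"
  have F1: "Ck 1 ?F" by (rule Ck_mult[OF \<phi> \<eta>1])
  have gF: "grad ?F x = \<phi> x *\<^sub>R grad \<eta> x + \<eta> x *\<^sub>R grad \<phi> x" for x
  proof (rule grad_eqI)
    have "(\<phi> has_derivative (\<lambda>h. grad \<phi> x \<bullet> h)) (at x)" "(\<eta> has_derivative (\<lambda>h. grad \<eta> x \<bullet> h)) (at x)"
      using \<phi> \<eta>1 Ck_SucD(1)[of 0] by simp_all
    from has_derivative_mult[OF this]
    show "(?F has_derivative (\<lambda>h. (\<phi> x *\<^sub>R grad \<eta> x + \<eta> x *\<^sub>R grad \<phi> x) \<bullet> h)) (at x)"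
      by (simp add: inner_add_left algebra_simps)
  qed
  have igF: "integrable ?M (grad ?F)"
    unfolding ext[of "grad ?F", OF gF] using int by (rule Bochner_Integration.integrable_add)
  have off: "grad ?F x = 0" if "x \<notin> G" for x
  proof -
    have "x \<notin> S" using that S(2) by auto
    then show ?thesis by (simp add: gF S(3,4))
  qed
  have "integral\<^sup>L ?M (grad ?F) $ i = 0" for i
  proof -
    have "integral\<^sup>L ?M (grad ?F) $ i = (\<integral>x. grad ?F x $ i \<partial>?M)"
      by (rule integral_bounded_linear[OF bounded_linear_vec_nth igF, symmetric])
    also have "\<dots> = (\<integral>x. grad ?F x $ i \<partial>lebesgue_on UNIV)"
      using G off by (intro integrable_restrict_supp(2)[symmetric]) auto
    also have "\<dots> = 0"
      using integral_partial_derivative_eq_0[OF F1 S(1), of i] S(3) by (simp add: lebesgue_on_UNIV_eq)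
    finally show ?thesis .
  qed
  then have "integral\<^sup>L ?M (grad ?F) = 0" by (simp add: vec_eq_iff)
  then show "(\<integral>x. \<phi> x *\<^sub>R grad \<eta> x \<partial>?M) = - (\<integral>x. \<eta> x *\<^sub>R grad \<phi> x \<partial>?M)"
    using int by (simp add: ext[of "grad ?F", OF gF] eq_neg_iff_add_eq_0)
qed

abbreviation norm_dist :: "'a measure \<Rightarrow> ('a \<Rightarrow> 'b::real_normed_vector) \<Rightarrow> ('a \<Rightarrow> 'b) \<Rightarrow> real" where
  "norm_dist M f g \<equiv> \<integral>x. norm (f x - g x) \<partial>M"

abbreviation abs_dist :: "'a measure \<Rightarrow> ('a \<Rightarrow> real) \<Rightarrow> ('a \<Rightarrow> real) \<Rightarrow> real" where
  "abs_dist M f g \<equiv> \<integral>x. \<bar>f x - g x\<bar> \<partial>M"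

abbreviation sq_norm :: "'a measure \<Rightarrow> ('a \<Rightarrow> 'b::real_normed_vector) \<Rightarrow> real" where
  "sq_norm M f \<equiv> \<integral>x. (norm (f x))\<^sup>2 \<partial>M"

abbreviation sq_dist :: "'a measure \<Rightarrow> ('a \<Rightarrow> 'b::real_normed_vector) \<Rightarrow> ('a \<Rightarrow> 'b) \<Rightarrow> real" where
  "sq_dist M f g \<equiv> \<integral>x. (norm (f x - g x))\<^sup>2 \<partial>M"

abbreviation boundary_L1 :: "'a::euclidean_space set \<Rightarrow> ('a \<Rightarrow> real) \<Rightarrow> ennreal" where
  "boundary_L1 S f \<equiv> \<integral>\<^sup>+x\<in>S. ennreal \<bar>f x\<bar> \<partial>hausdorff1"

text \<open>Convergence of integrals whose integrands are controlled by an \<open>L\<^sup>1\<close> distance tending to zero.\<close>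

lemma tendsto_integral_dominated_diff:
  fixes F :: "nat \<Rightarrow> 'a \<Rightarrow> 'b::{banach, second_countable_topology}"
  assumes "\<And>n. integrable M (F n)" "integrable M f" "\<And>n. integrable M (d n)"
    and le: "\<And>n x. x \<in> space M \<Longrightarrow> norm (F n x - f x) \<le> B * d n x"
    and lim: "(\<lambda>n. \<integral>x. d n x \<partial>M) \<longlonglongrightarrow> 0"
  shows "(\<lambda>n. integral\<^sup>L M (F n)) \<longlonglongrightarrow> integral\<^sup>L M f"
proof -
  have bound: "norm (integral\<^sup>L M (F n) - integral\<^sup>L M f) \<le> B * (\<integral>x. d n x \<partial>M)" for n
  proof -
    have "norm (integral\<^sup>L M (F n) - integral\<^sup>L M f) = norm (\<integral>x. F n x - f x \<partial>M)"
      by (simp add: assms(1,2))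
    also have "\<dots> \<le> norm_dist M (F n) f" by (rule integral_norm_bound)
    also have "\<dots> \<le> (\<integral>x. B * d n x \<partial>M)"
      by (intro integral_mono integrable_norm Bochner_Integration.integrable_diff integrable_mult_right assms)
    finally show ?thesis by simp
  qed
  have "(\<lambda>n. integral\<^sup>L M (F n) - integral\<^sup>L M f) \<longlonglongrightarrow> 0"
    by (rule Lim_null_comparison[OF always_eventually[OF allI[OF bound]] tendsto_mult_right_zero[OF lim]])
  then show ?thesis by (rule LIM_zero_cancel)
qed

lemma integrable_lebesgue_on_iff:
  fixes f :: "'a::euclidean_space \<Rightarrow> 'b::euclidean_space"
  assumes "S \<in> sets lebesgue"
  shows "integrable (lebesgue_on S) f \<longleftrightarrow> integrable lebesgue (\<lambda>x. indicat_real S x *\<^sub>R f x)"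
  using assms by (intro integrable_restrict_space) simp

lemma integrable_lebesgue_on_subset:
  fixes f :: "'a::euclidean_space \<Rightarrow> 'b::euclidean_space"
  assumes G: "G \<in> sets lebesgue" and S: "S \<in> sets lebesgue" "S \<subseteq> G"
    and f: "integrable (lebesgue_on G) f"
  shows "integrable (lebesgue_on S) f"
proof -
  have "integrable lebesgue (\<lambda>x. indicat_real G x *\<^sub>R f x)"
    using f by (simp only: integrable_lebesgue_on_iff[OF G])
  note int = integrable_mult_indicator[OF S(1) this]
  have eq: "(\<lambda>x. indicat_real S x *\<^sub>R (indicat_real G x *\<^sub>R f x)) = (\<lambda>x. indicat_real S x *\<^sub>R f x)"
  proof
    fix x show "indicat_real S x *\<^sub>R (indicat_real G x *\<^sub>R f x) = indicat_real S x *\<^sub>R f x"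
      using S(2) by (cases "x \<in> S") auto
  qed
  from int have "integrable lebesgue (\<lambda>x. indicat_real S x *\<^sub>R f x)" unfolding eq .
  then show "integrable (lebesgue_on S) f"
    by (simp only: integrable_lebesgue_on_iff[OF S(1)])
qed

lemma integrable_imp_locally_integrable:
  fixes f :: "'a::euclidean_space \<Rightarrow> 'b::euclidean_space"
  assumes "G \<in> sets lebesgue" and "integrable (lebesgue_on G) f"
  shows "locally_integrable G f"
  unfolding locally_integrable_def
  using integrable_lebesgue_on_subset[OF assms(1) _ _ assms(2)] fmeasurableD[OF lmeasurable_compact] by blast

text \<open>Both sides of the defining identity are continuous in \<open>L\<^sup>1\<close>, because test functions and their
  gradients are bounded.\<close>

lemma has_weak_grad_L1_limit:
  fixes u :: "nat \<Rightarrow> real^'n \<Rightarrow> real"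
  assumes G: "open G"
    and u: "\<And>n. has_weak_grad G (u n) (g n)" "\<And>n. integrable (lebesgue_on G) (u n)"
      "\<And>n. integrable (lebesgue_on G) (g n)"
    and v: "integrable (lebesgue_on G) v" "integrable (lebesgue_on G) h"
    and lim: "(\<lambda>n. abs_dist (lebesgue_on G) (u n) v) \<longlonglongrightarrow> 0"
      "(\<lambda>n. norm_dist (lebesgue_on G) (g n) h) \<longlonglongrightarrow> 0"
  shows "has_weak_grad G v h"
  unfolding has_weak_grad_def
proof (intro conjI ballI)
  let ?M = "lebesgue_on G"
  have Gs: "G \<in> sets lebesgue" using G by auto
  show li: "locally_integrable G v" "locally_integrable G h"
    using v integrable_imp_locally_integrable[OF Gs] by auto
  fix \<phi> :: "real^'n \<Rightarrow> real" assume \<phi>: "\<phi> \<in> test_functions G"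
  obtain S where S: "compact S" "S \<subseteq> G" "\<And>x. x \<notin> S \<Longrightarrow> \<phi> x = 0" "\<And>x. x \<notin> S \<Longrightarrow> grad \<phi> x = 0"
    using test_functions_support[OF \<phi>] by metis
  note cont = test_functions_continuous[OF \<phi>]
  obtain B where B: "\<And>x. \<bar>\<phi> x\<bar> \<le> B"
    using continuous_compact_support_bounded[OF cont(1) S(1,3)] by (metis real_norm_def)
  obtain B' where B': "\<And>x. norm (grad \<phi> x) \<le> B'" using continuous_compact_support_bounded[OF cont(2) S(1,4)] by metis
  have lu: "locally_integrable G (u n)" "locally_integrable G (g n)" for n
    using u(1)[of n] by (auto simp: has_weak_grad_def)
  have 1: "(\<lambda>n. \<integral>x. u n x *\<^sub>R grad \<phi> x \<partial>?M) \<longlonglongrightarrow> (\<integral>x. v x *\<^sub>R grad \<phi> x \<partial>?M)"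
  proof (rule tendsto_integral_dominated_diff[OF _ _ _ _ lim(1), where B = B'])
    fix n x
    have "norm (u n x *\<^sub>R grad \<phi> x - v x *\<^sub>R grad \<phi> x) = norm (grad \<phi> x) * \<bar>u n x - v x\<bar>"
      by (metis norm_scaleR scaleR_left_diff_distrib mult.commute)
    then show "norm (u n x *\<^sub>R grad \<phi> x - v x *\<^sub>R grad \<phi> x) \<le> B' * \<bar>u n x - v x\<bar>"
      using B'[of x] by (simp add: mult_right_mono)
  qed (intro test_function_integrable(2)[OF \<phi> G] lu(1) li(1) integrable_abs
      Bochner_Integration.integrable_diff u v)+
  have 2: "(\<lambda>n. \<integral>x. \<phi> x *\<^sub>R g n x \<partial>?M) \<longlonglongrightarrow> (\<integral>x. \<phi> x *\<^sub>R h x \<partial>?M)"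
  proof (rule tendsto_integral_dominated_diff[OF _ _ _ _ lim(2), where B = B])
    fix n x
    have "norm (\<phi> x *\<^sub>R g n x - \<phi> x *\<^sub>R h x) = \<bar>\<phi> x\<bar> * norm (g n x - h x)"
      by (metis norm_scaleR scaleR_right_diff_distrib)
    then show "norm (\<phi> x *\<^sub>R g n x - \<phi> x *\<^sub>R h x) \<le> B * norm (g n x - h x)"
      using B[of x] by (simp add: mult_right_mono)
  qed (intro test_function_integrable(1)[OF \<phi> G] lu(2) li(2) integrable_norm
      Bochner_Integration.integrable_diff u v)+
  have "(\<integral>x. u n x *\<^sub>R grad \<phi> x \<partial>?M) = - (\<integral>x. \<phi> x *\<^sub>R g n x \<partial>?M)" for n
    using u(1)[of n] \<phi> by (auto simp: has_weak_grad_def)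
  with 1 have "(\<lambda>n. - (\<integral>x. \<phi> x *\<^sub>R g n x \<partial>?M)) \<longlonglongrightarrow> (\<integral>x. v x *\<^sub>R grad \<phi> x \<partial>?M)" by simp
  with tendsto_minus[OF 2]
  show "(\<integral>x. v x *\<^sub>R grad \<phi> x \<partial>?M) = - (\<integral>x. \<phi> x *\<^sub>R h x \<partial>?M)"
    using LIMSEQ_unique[of "\<lambda>n. - (\<integral>x. \<phi> x *\<^sub>R g n x \<partial>?M)"] by simp
qed

section \<open>Square-integrable functions\<close>

definition square_integrable :: "'a measure \<Rightarrow> ('a \<Rightarrow> 'b::euclidean_space) \<Rightarrow> bool" where
  "square_integrable M f \<longleftrightarrow> f \<in> borel_measurable M \<and> integrable M (\<lambda>x. (norm (f x))\<^sup>2)"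

lemma square_integrable_dominated:
  assumes g: "g \<in> borel_measurable M" and h: "integrable M h"
    and le: "\<And>x. (norm (g x))\<^sup>2 \<le> h x"
  shows "square_integrable M g"
  unfolding square_integrable_def
proof
  show "integrable M (\<lambda>x. (norm (g x))\<^sup>2)"
  proof (rule Bochner_Integration.integrable_bound[OF h])
    show "(\<lambda>x. (norm (g x))\<^sup>2) \<in> borel_measurable M" using g by measurable
    show "AE x in M. norm ((norm (g x))\<^sup>2) \<le> norm (h x)"
      using le by (intro AE_I2) (metis abs_ge_self norm_of_real order_trans real_norm_def abs_power2)
  qed
qed (fact g)

lemma norm_add_sq_le: "(norm (a + b :: 'b::real_inner))\<^sup>2 \<le> 2 * (norm a)\<^sup>2 + 2 * (norm b)\<^sup>2"
proof -
  have "(norm (a + b))\<^sup>2 + (norm (a - b))\<^sup>2 = 2 * (norm a)\<^sup>2 + 2 * (norm b)\<^sup>2"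
    by (simp add: power2_norm_eq_inner inner_add_left inner_add_right inner_diff_left inner_diff_right inner_commute)
  then show ?thesis by (smt (verit) zero_le_power2)
qed

lemma square_integrable_lincomb:
  fixes f g :: "'a \<Rightarrow> 'b::euclidean_space"
  assumes f: "square_integrable M f" and g: "square_integrable M g"
  shows "square_integrable M (\<lambda>x. a *\<^sub>R f x + b *\<^sub>R g x)"
proof (rule square_integrable_dominated)
  show "(\<lambda>x. a *\<^sub>R f x + b *\<^sub>R g x) \<in> borel_measurable M"
    using f[unfolded square_integrable_def] g[unfolded square_integrable_def]
    by (intro borel_measurable_add borel_measurable_scaleR borel_measurable_const) simp_all
  show "integrable M (\<lambda>x. 2 * a\<^sup>2 * (norm (f x))\<^sup>2 + 2 * b\<^sup>2 * (norm (g x))\<^sup>2)"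
    using f g by (intro Bochner_Integration.integrable_add integrable_mult_right) (simp_all add: square_integrable_def)
  show "(norm (a *\<^sub>R f x + b *\<^sub>R g x))\<^sup>2 \<le> 2 * a\<^sup>2 * (norm (f x))\<^sup>2 + 2 * b\<^sup>2 * (norm (g x))\<^sup>2" for x
    using norm_add_sq_le[of "a *\<^sub>R f x" "b *\<^sub>R g x"] by (simp add: power_mult_distrib mult.assoc)
qed

lemma square_integrable_diff:
  "square_integrable M f \<Longrightarrow> square_integrable M g \<Longrightarrow> square_integrable M (\<lambda>x. f x - g x)"
  using square_integrable_lincomb[of M f g 1 "-1"] by simp

lemma square_integrable_add:
  "square_integrable M f \<Longrightarrow> square_integrable M g \<Longrightarrow> square_integrable M (\<lambda>x. f x + g x)"
  using square_integrable_lincomb[of M f g 1 1] by simp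

lemma (in finite_measure) square_integrable_integrable:
  assumes f: "square_integrable M f"
  shows "integrable M f"
proof (rule Bochner_Integration.integrable_bound)
  show "integrable M (\<lambda>x. 1 + (norm (f x))\<^sup>2)"
    using f by (intro Bochner_Integration.integrable_add integrable_const) (simp add: square_integrable_def)
  show "AE x in M. norm (f x) \<le> norm (1 + (norm (f x))\<^sup>2)"
  proof (rule AE_I2)
    fix x
    have "norm (f x) \<le> 1 + (norm (f x))\<^sup>2"
    proof -
      have "0 \<le> (norm (f x))\<^sup>2 - 2 * norm (f x) * 1 + 1\<^sup>2"
        using zero_le_power2[of "norm (f x) - 1"] unfolding power2_diff by linarith
      then show ?thesis using norm_ge_zero[of "f x"] by (simp del: norm_ge_zero)
    qed
    then show "norm (f x) \<le> norm (1 + (norm (f x))\<^sup>2)" by simp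
  qed
qed (use f in \<open>simp add: square_integrable_def\<close>)

text \<open>Expand the variance-like integral of \<open>(A \<parallel>f\<parallel> - I)\<^sup>2 \<ge> 0\<close>, with \<open>A\<close> the total mass and \<open>I\<close> the integral of the norm.\<close>

lemma (in finite_measure) integral_norm_sq_le:
  assumes f: "square_integrable M f"
  shows "(\<integral>x. norm (f x) \<partial>M)\<^sup>2 \<le> measure M (space M) * sq_norm M f"
proof -
  let ?A = "measure M (space M)" and ?I = "\<integral>x. norm (f x) \<partial>M"
  have i1: "integrable M (\<lambda>x. norm (f x))" using square_integrable_integrable[OF f] by simp
  have i2: "integrable M (\<lambda>x. (norm (f x))\<^sup>2)" using f by (simp add: square_integrable_def)
  show ?thesis
  proof (cases "?A = 0")
    case True
    then have "emeasure M (space M) = 0" by (simp add: emeasure_eq_measure)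
    then have "AE x in M. False" by (auto intro!: AE_I[of _ _ "space M"])
    then have "?I = 0" by (intro integral_eq_zero_AE) auto
    then show ?thesis using True by simp
  next
    case False
    then have A: "?A > 0" using measure_nonneg[of M "space M"] by linarith
    have "0 \<le> (\<integral>x. (?A * norm (f x) - ?I)\<^sup>2 \<partial>M)" by simp
    also have "(\<lambda>x. (?A * norm (f x) - ?I)\<^sup>2) =
        (\<lambda>x. ?A\<^sup>2 * (norm (f x))\<^sup>2 - 2 * ?A * ?I * norm (f x) + ?I\<^sup>2)"
      by (intro ext) (simp add: power2_diff power_mult_distrib algebra_simps)
    also have "(\<integral>x. ?A\<^sup>2 * (norm (f x))\<^sup>2 - 2 * ?A * ?I * norm (f x) + ?I\<^sup>2 \<partial>M)
        = ?A\<^sup>2 * (sq_norm M f) - 2 * ?A * ?I * ?I + ?A * ?I\<^sup>2"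
      using i1 i2 by simp
    finally have "0 \<le> ?A * (?A * (sq_norm M f) - ?I\<^sup>2)"
      by (simp add: power2_eq_square algebra_simps)
    then show ?thesis using A by (simp add: zero_le_mult_iff)
  qed
qed

lemma (in finite_measure) integral_norm_le_sqrt:
  assumes "square_integrable M f"
  shows "(\<integral>x. norm (f x) \<partial>M) \<le> sqrt (measure M (space M)) * sqrt (sq_norm M f)"
proof -
  have "(\<integral>x. norm (f x) \<partial>M) \<le> sqrt (measure M (space M) * sq_norm M f)"
    by (rule real_le_rsqrt[OF integral_norm_sq_le[OF assms]])
  then show ?thesis by (simp only: real_sqrt_mult)
qed

lemma (in finite_measure) square_limit_imp_L1_limit:
  fixes f :: "nat \<Rightarrow> 'a \<Rightarrow> 'b::euclidean_space"
  assumes "\<And>n. square_integrable M (f n)" "(\<lambda>n. sq_norm M (f n)) \<longlonglongrightarrow> 0"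
  shows "(\<lambda>n. \<integral>x. norm (f n x) \<partial>M) \<longlonglongrightarrow> 0"
proof (rule Lim_null_comparison)
  show "\<forall>\<^sub>F n in sequentially. norm (\<integral>x. norm (f n x) \<partial>M)
      \<le> sqrt (measure M (space M)) * sqrt (sq_norm M (f n))"
    using integral_norm_le_sqrt[OF assms(1)] by simp
  have "(\<lambda>n. sqrt (sq_norm M (f n))) \<longlonglongrightarrow> sqrt 0"
    using assms(2) by (rule tendsto_real_sqrt)
  then show "(\<lambda>n. sqrt (measure M (space M)) * sqrt (sq_norm M (f n))) \<longlonglongrightarrow> 0"
    using tendsto_mult_right_zero by simp
qed

text \<open>The Riesz--Fischer theorem on a finite measure space. Along a rapidly converging subsequence the
  increments have summable \<open>L\<^sup>1\<close> norms, hence are summable almost everywhere, which defines the limit;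
  Fatou's lemma then bounds the distance to it.\<close>

lemma (in finite_measure) square_integrable_complete:
  fixes f :: "nat \<Rightarrow> 'a \<Rightarrow> 'b::euclidean_space"
  assumes f: "\<And>n. square_integrable M (f n)"
    and cauchy: "\<And>e. e > 0 \<Longrightarrow> \<exists>N. \<forall>m\<ge>N. \<forall>n\<ge>N. sq_dist M (f m) (f n) < e"
  shows "\<exists>F. square_integrable M F \<and> (\<lambda>n. sq_dist M (f n) F) \<longlonglongrightarrow> 0"
proof -
  let ?A = "sqrt (measure M (space M))"
  note [measurable] = f[unfolded square_integrable_def, THEN conjunct1]
  have dsq: "square_integrable M (\<lambda>x. f m x - f n x)" for m n
    by (intro square_integrable_diff f)
  \<comment> \<open>subsequence whose consecutive distances are summable\<close>
  have "\<exists>N. \<forall>m\<ge>N. \<forall>n\<ge>N. sq_dist M (f m) (f n) < ((1/2)^k)\<^sup>2" for k :: nat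
    by (rule cauchy) simp
  then obtain N where N: "\<And>k m n. m \<ge> N k \<Longrightarrow> n \<ge> N k \<Longrightarrow> sq_dist M (f m) (f n) < ((1/2)^k)\<^sup>2"
    by metis
  define r where "r = rec_nat (N 0) (\<lambda>k p. max (Suc p) (N (Suc k)))"
  have r0: "r 0 = N 0" and rS: "r (Suc k) = max (Suc (r k)) (N (Suc k))" for k
    by (simp_all add: r_def)
  have rN: "r k \<ge> N k" for k by (cases k) (simp_all add: r0 rS)
  have sm: "strict_mono r" unfolding strict_mono_Suc_iff rS by (intro allI less_max_iff_disj[THEN iffD2] disjI1 lessI)
  have L1: "norm_dist M (f (r (Suc k))) (f (r k)) \<le> ?A * (1/2)^k" for k
  proof -
    have "N k \<le> r (Suc k)" using rN[of k] rS[of k] by simp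
    then have "sqrt (sq_dist M (f (r (Suc k))) (f (r k))) \<le> (1/2)^k"
      using N[OF _ rN, of k "r (Suc k)"] by (intro real_le_lsqrt) auto
    then have "?A * sqrt (sq_dist M (f (r (Suc k))) (f (r k))) \<le> ?A * (1/2)^k"
      by (rule mult_left_mono) simp
    with integral_norm_le_sqrt[OF dsq] show ?thesis by (rule order_trans)
  qed
  have "(\<integral>\<^sup>+x. (\<Sum>k. ennreal (norm (f (r (Suc k)) x - f (r k) x))) \<partial>M) =
      (\<Sum>k. \<integral>\<^sup>+x. ennreal (norm (f (r (Suc k)) x - f (r k) x)) \<partial>M)"
    by (rule nn_integral_suminf) measurable
  also have "\<dots> = (\<Sum>k. ennreal (norm_dist M (f (r (Suc k))) (f (r k))))"
    by (intro suminf_cong nn_integral_eq_integral integrable_norm square_integrable_integrable dsq AE_I2) simp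
  also have "\<dots> \<le> (\<Sum>k. ennreal (?A * (1/2)^k))"
    by (intro suminf_le ennreal_leI L1) auto
  also have "\<dots> = ennreal (\<Sum>k. ?A * (1/2)^k)"
    by (intro suminf_ennreal2) (auto intro!: summable_mult)
  also have "\<dots> < \<infinity>" by simp
  finally have "AE x in M. (\<Sum>k. ennreal (norm (f (r (Suc k)) x - f (r k) x))) \<noteq> \<infinity>"
    by (intro nn_integral_noteq_infinite) auto
  then have conv: "AE x in M. convergent (\<lambda>k. f (r k) x)"
  proof eventually_elim
    fix x assume "(\<Sum>k. ennreal (norm (f (r (Suc k)) x - f (r k) x))) \<noteq> \<infinity>"
    then have "summable (\<lambda>k. norm (f (r (Suc k)) x - f (r k) x))"
      by (intro summable_suminf_not_top) auto
    then have "summable (\<lambda>k. f (r (Suc k)) x - f (r k) x)" by (rule summable_norm_cancel)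
    then have "convergent (\<lambda>n. \<Sum>k<n. f (r (Suc k)) x - f (r k) x)" by (simp add: summable_iff_convergent)
    then have "convergent (\<lambda>n. f (r n) x - f (r 0) x)"
      using sum_lessThan_telescope[of "\<lambda>k. f (r k) x"] by simp
    then show "convergent (\<lambda>n. f (r n) x)" by (simp add: convergent_diff_const_right_iff)
  qed
  define F where "F x = lim (\<lambda>k. f (r k) x)" for x
  have [measurable]: "F \<in> borel_measurable M"
    unfolding F_def by (rule borel_measurable_lim_metric) simp
  have lim: "AE x in M. (\<lambda>k. f (r k) x) \<longlonglongrightarrow> F x"
    using conv by eventually_elim (simp add: F_def convergent_LIMSEQ_iff)
  \<comment> \<open>Fatou's lemma along the subsequence\<close>
  have fatou: "(\<integral>\<^sup>+x. ennreal ((norm (f n x - F x))\<^sup>2) \<partial>M) \<le> ennreal e"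
    if e: "\<forall>m\<ge>K. \<forall>n\<ge>K. sq_dist M (f m) (f n) < e" and n: "n \<ge> K" for n K e
  proof -
    have "AE x in M. ennreal ((norm (f n x - F x))\<^sup>2) = liminf (\<lambda>k. ennreal ((norm (f n x - f (r k) x))\<^sup>2))"
      using lim
    proof eventually_elim
      fix x assume "(\<lambda>k. f (r k) x) \<longlonglongrightarrow> F x"
      then have "(\<lambda>k. ennreal ((norm (f n x - f (r k) x))\<^sup>2)) \<longlonglongrightarrow> ennreal ((norm (f n x - F x))\<^sup>2)"
        by (intro tendsto_intros)
      then show "ennreal ((norm (f n x - F x))\<^sup>2) = liminf (\<lambda>k. ennreal ((norm (f n x - f (r k) x))\<^sup>2))"
        by (rule lim_imp_Liminf[OF trivial_limit_sequentially, symmetric])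
    qed
    then have "(\<integral>\<^sup>+x. ennreal ((norm (f n x - F x))\<^sup>2) \<partial>M) =
        (\<integral>\<^sup>+x. liminf (\<lambda>k. ennreal ((norm (f n x - f (r k) x))\<^sup>2)) \<partial>M)"
      by (rule nn_integral_cong_AE)
    also have "\<dots> \<le> liminf (\<lambda>k. \<integral>\<^sup>+x. ennreal ((norm (f n x - f (r k) x))\<^sup>2) \<partial>M)"
      by (rule nn_integral_liminf) measurable
    also have "\<dots> \<le> liminf (\<lambda>k::nat. ennreal e)"
    proof (rule Liminf_mono)
      show "\<forall>\<^sub>F k in sequentially. (\<integral>\<^sup>+x. ennreal ((norm (f n x - f (r k) x))\<^sup>2) \<partial>M) \<le> ennreal e"
        using eventually_ge_at_top[of K]
      proof eventually_elim
        fix k assume "k \<ge> K"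
        then have "r k \<ge> K" using seq_suble[OF sm, of k] by simp
        then have "sq_dist M (f n) (f (r k)) \<le> e" using e n by (simp add: less_imp_le)
        then show "(\<integral>\<^sup>+x. ennreal ((norm (f n x - f (r k) x))\<^sup>2) \<partial>M) \<le> ennreal e"
          using dsq[of n "r k"] by (subst nn_integral_eq_integral) (auto simp: square_integrable_def intro: ennreal_leI)
      qed
    qed
    also have "\<dots> = ennreal e" by (simp add: Liminf_const)
    finally show ?thesis .
  qed
  have dF: "square_integrable M (\<lambda>x. f n x - F x)" if "\<forall>m\<ge>K. \<forall>n\<ge>K. sq_dist M (f m) (f n) < e" "n \<ge> K" for n K e
  proof -
    have "(\<integral>\<^sup>+x. ennreal (norm ((norm (f n x - F x))\<^sup>2)) \<partial>M) < \<infinity>"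
      using fatou[OF that] by (simp add: le_less_trans)
    then show ?thesis unfolding square_integrable_def by (intro conjI integrableI_bounded) measurable
  qed
  have F: "square_integrable M F"
  proof -
    obtain K where "\<forall>m\<ge>K. \<forall>n\<ge>K. sq_dist M (f m) (f n) < 1" using cauchy[of 1] by auto
    from square_integrable_diff[OF f[of K] dF[OF this order_refl]] show ?thesis by simp
  qed
  moreover have "(\<lambda>n. sq_dist M (f n) F) \<longlonglongrightarrow> 0"
  proof (rule LIMSEQ_I)
    fix e :: real assume e: "0 < e"
    then obtain K where K: "\<forall>m\<ge>K. \<forall>n\<ge>K. sq_dist M (f m) (f n) < e / 2"
      using cauchy[of "e / 2"] by auto
    have "norm ((sq_dist M (f n) F) - 0) < e" if n: "n \<ge> K" for n
    proof -
      have "ennreal (sq_dist M (f n) F) \<le> ennreal (e / 2)"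
        using fatou[OF K n] dF[OF K n]
        by (subst (asm) nn_integral_eq_integral) (simp_all add: square_integrable_def)
      then have "sq_dist M (f n) F \<le> e / 2" using e by (simp add: ennreal_le_iff)
      then show ?thesis using e by simp
    qed
    then show "\<exists>no. \<forall>n\<ge>no. norm ((sq_dist M (f n) F) - 0) < e" by blast
  qed
  ultimately show ?thesis by blast
qed

text \<open>Completeness of Lebesgue measure, needed because \<^const>\<open>weak_grad\<close> is only known up to null sets
  and its measurability on all of \<open>G\<close> has to come from another representative.\<close>

lemma measurable_lebesgue_on_AE_eq:
  fixes f g :: "'a::euclidean_space \<Rightarrow> 'b::euclidean_space"
  assumes G: "G \<in> sets lebesgue" and f: "f \<in> borel_measurable (lebesgue_on G)"
    and eq: "AE x in lebesgue_on G. f x = g x"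
  shows "g \<in> borel_measurable (lebesgue_on G)"
proof -
  have G': "G \<inter> space lebesgue \<in> sets lebesgue" using G by simp
  let ?f = "\<lambda>x. indicat_real G x *\<^sub>R f x" and ?g = "\<lambda>x. indicat_real G x *\<^sub>R g x"
  have f': "?f \<in> borel_measurable lebesgue"
    using f borel_measurable_restrict_space_iff[OF G'] by blast
  have "AE x in lebesgue. x \<in> G \<longrightarrow> f x = g x" using eq G' by (simp add: AE_restrict_space_iff)
  then have ae: "AE x in lebesgue. ?f x = ?g x"
  proof eventually_elim
    fix x assume "x \<in> G \<longrightarrow> f x = g x"
    then show "?f x = ?g x" by (cases "x \<in> G") auto
  qed
  have "?g \<in> borel_measurable lebesgue"
  proof (rule measurableI)
    fix A :: "'b set" assume "A \<in> sets borel"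
    then have 1: "?f -` A \<inter> space lebesgue \<in> sets lebesgue" using f' by (rule measurable_sets[rotated])
    have 2: "AE x in lebesgue. x \<in> ?f -` A \<inter> space lebesgue \<longleftrightarrow> x \<in> ?g -` A \<inter> space lebesgue"
      using ae
    proof eventually_elim
      fix x assume "?f x = ?g x"
      then show "x \<in> ?f -` A \<inter> space lebesgue \<longleftrightarrow> x \<in> ?g -` A \<inter> space lebesgue"
        by (simp only: vimage_eq Int_iff)
    qed
    show "?g -` A \<inter> space lebesgue \<in> sets lebesgue"
      by (rule completion.in_sets_AE[OF 2 1]) simp
  qed simp
  then show ?thesis using borel_measurable_restrict_space_iff[OF G'] by blast
qed

section \<open>Sobolev functions with vanishing trace\<close>

text \<open>The gradient is an explicit argument: the identities between gradients below hold pointwise for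
  suitable representatives, but only almost everywhere for \<^const>\<open>weak_grad\<close>.\<close>

definition sobolev1 :: "(real^'n) set \<Rightarrow> (real^'n \<Rightarrow> real) \<Rightarrow> (real^'n \<Rightarrow> real^'n) \<Rightarrow> bool" where
  "sobolev1 G u g \<longleftrightarrow> has_weak_grad G u g \<and>
     integrable (lebesgue_on G) u \<and> integrable (lebesgue_on G) g"

definition sobolev2 :: "(real^'n) set \<Rightarrow> (real^'n \<Rightarrow> real) \<Rightarrow> (real^'n \<Rightarrow> real^'n) \<Rightarrow> bool" where
  "sobolev2 G u g \<longleftrightarrow> has_weak_grad G u g \<and>
     square_integrable (lebesgue_on G) u \<and> square_integrable (lebesgue_on G) g"

lemma Lp_1_iff: "u \<in> Lp 1 G \<longleftrightarrow> integrable (lebesgue_on G) u"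
  by (auto simp: Lp_def integrable_norm_iff)

lemma Lp_2_iff: "u \<in> Lp 2 G \<longleftrightarrow> square_integrable (lebesgue_on G) u"
  by (simp add: Lp_def square_integrable_def)

lemma Lp_norm_1: "Lp_norm 1 G u = (\<integral>x. norm (u x) \<partial>lebesgue_on G)"
  by (simp add: Lp_norm_def)

lemma Lp_norm_2: "Lp_norm 2 G u = sqrt (sq_norm (lebesgue_on G) u)"
  by (simp add: Lp_norm_def powr_half_sqrt)

lemma W1p_1_iff: "u \<in> W1p 1 G \<longleftrightarrow> (\<exists>g. sobolev1 G u g)"
  by (auto simp: W1p_def Lp_1_iff sobolev1_def)

lemma W1p_2_iff: "u \<in> W1p 2 G \<longleftrightarrow> (\<exists>g. sobolev2 G u g)"
  by (auto simp: W1p_def Lp_2_iff sobolev2_def)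

lemma AE_weak_grad:
  "open G \<Longrightarrow> has_weak_grad G u g \<Longrightarrow> AE x in lebesgue_on G. g x = weak_grad G u x"
  using weak_grad_unique has_weak_grad_weak_grad by blast

lemma sobolev1_weak_grad:
  assumes G: "open G" and u: "sobolev1 G u g"
  shows "sobolev1 G u (weak_grad G u)"
proof -
  have ae: "AE x in lebesgue_on G. g x = weak_grad G u x"
    using u by (intro AE_weak_grad[OF G]) (simp add: sobolev1_def)
  have m: "weak_grad G u \<in> borel_measurable (lebesgue_on G)"
    by (rule measurable_lebesgue_on_AE_eq[OF _ _ ae]) (use G u in \<open>auto simp: sobolev1_def\<close>)
  have "integrable (lebesgue_on G) (weak_grad G u)"
    using u integrable_cong_AE_imp[OF _ m ae] by (simp add: sobolev1_def)
  then show ?thesis using u has_weak_grad_weak_grad by (auto simp: sobolev1_def)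
qed

lemma sobolev2_weak_grad:
  assumes G: "open G" and u: "sobolev2 G u g"
  shows "sobolev2 G u (weak_grad G u)"
proof -
  let ?M = "lebesgue_on G"
  have ae: "AE x in ?M. g x = weak_grad G u x"
    using u by (intro AE_weak_grad[OF G]) (simp add: sobolev2_def)
  have m: "weak_grad G u \<in> borel_measurable ?M"
    by (rule measurable_lebesgue_on_AE_eq[OF _ _ ae]) (use G u in \<open>auto simp: sobolev2_def square_integrable_def\<close>)
  have "integrable ?M (\<lambda>x. (norm (weak_grad G u x))\<^sup>2)"
  proof (rule integrable_cong_AE_imp)
    show "integrable ?M (\<lambda>x. (norm (g x))\<^sup>2)" using u by (simp add: sobolev2_def square_integrable_def)
    show "(\<lambda>x. (norm (weak_grad G u x))\<^sup>2) \<in> borel_measurable ?M" using m by measurable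
    show "AE x in ?M. (norm (g x))\<^sup>2 = (norm (weak_grad G u x))\<^sup>2" using ae by eventually_elim simp
  qed
  then show ?thesis using u m has_weak_grad_weak_grad by (auto simp: sobolev2_def square_integrable_def)
qed

lemma sobolev1_measurable:
  assumes "sobolev1 G u g"
  shows "u \<in> borel_measurable (lebesgue_on G)" "g \<in> borel_measurable (lebesgue_on G)"
  using assms by (auto simp: sobolev1_def)

lemma Lp_norm_1_weak_grad:
  assumes G: "open G" and u: "sobolev1 G u g"
  shows "Lp_norm 1 G (weak_grad G u) = (\<integral>x. norm (g x) \<partial>lebesgue_on G)"
proof -
  let ?M = "lebesgue_on G"
  have ae: "AE x in ?M. g x = weak_grad G u x"
    using u by (intro AE_weak_grad[OF G]) (simp add: sobolev1_def)
  have "(\<integral>x. norm (g x) \<partial>?M) = (\<integral>x. norm (weak_grad G u x) \<partial>?M)"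
  proof (rule integral_cong_AE)
    show "(\<lambda>x. norm (g x)) \<in> borel_measurable ?M"
      using sobolev1_measurable(2)[OF u] by measurable
    show "(\<lambda>x. norm (weak_grad G u x)) \<in> borel_measurable ?M"
      using sobolev1_measurable(2)[OF sobolev1_weak_grad[OF G u]] by measurable
    show "AE x in ?M. norm (g x) = norm (weak_grad G u x)" using ae by eventually_elim simp
  qed
  then show ?thesis by (simp add: Lp_norm_1)
qed

lemma W1p_norm_1:
  assumes G: "open G" and u: "sobolev1 G u g"
  shows "W1p_norm 1 G u = (\<integral>x. \<bar>u x\<bar> \<partial>lebesgue_on G) + (\<integral>x. norm (g x) \<partial>lebesgue_on G)"
  unfolding W1p_norm_def Lp_norm_1_weak_grad[OF assms] by (simp add: Lp_norm_1)

lemma sobolev1_lincomb: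
  assumes "open G" "sobolev1 G u g" "sobolev1 G v h"
  shows "sobolev1 G (\<lambda>x. a * u x + b * v x) (\<lambda>x. a *\<^sub>R g x + b *\<^sub>R h x)"
  using assms has_weak_grad_lincomb[of G u g v h a b] by (simp add: sobolev1_def)

lemma sobolev1_diff:
  assumes "open G" "sobolev1 G u g" "sobolev1 G v h"
  shows "sobolev1 G (\<lambda>x. u x - v x) (\<lambda>x. g x - h x)"
  using sobolev1_lincomb[OF assms, of 1 "-1"] by simp

lemma sobolev2_lincomb:
  assumes "open G" "sobolev2 G u g" "sobolev2 G v h"
  shows "sobolev2 G (\<lambda>x. a * u x + b * v x) (\<lambda>x. a *\<^sub>R g x + b *\<^sub>R h x)"
  using assms has_weak_grad_lincomb[of G u g v h a b]
    square_integrable_lincomb[of "lebesgue_on G" u v a b] square_integrable_lincomb[of "lebesgue_on G" g h a b]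
  by (simp add: sobolev2_def)

lemma sobolev2_imp_sobolev1:
  assumes "finite_measure (lebesgue_on G)" "sobolev2 G u g"
  shows "sobolev1 G u g"
  using assms(2)
  by (auto simp: sobolev1_def sobolev2_def intro: finite_measure.square_integrable_integrable[OF assms(1)])

definition approximates :: "(real^'n) set \<Rightarrow> (real^'n) set \<Rightarrow> (nat \<Rightarrow> real^'n \<Rightarrow> real)
    \<Rightarrow> (real^'n \<Rightarrow> real) \<Rightarrow> (real^'n \<Rightarrow> real^'n) \<Rightarrow> bool" where
  "approximates G S \<phi> u g \<longleftrightarrow> (\<forall>n. Ck 1 (\<phi> n)) \<and> (\<forall>n. sobolev1 G (\<phi> n) (grad (\<phi> n))) \<and>
     (\<lambda>n. abs_dist (lebesgue_on G) (\<phi> n) u) \<longlonglongrightarrow> 0 \<and>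
     (\<lambda>n. norm_dist (lebesgue_on G) (grad (\<phi> n)) g) \<longlonglongrightarrow> 0 \<and>
     (\<lambda>n. boundary_L1 S (\<phi> n)) \<longlonglongrightarrow> 0"

text \<open>The kernel of the trace map, with an explicit gradient of the limit and the classical gradients of
  the approximating functions; see \<open>has_trace_zero_iff\<close> for the relation to \<^const>\<open>has_trace\<close>.\<close>

definition zero_trace :: "(real^'n) set \<Rightarrow> (real^'n) set \<Rightarrow> (real^'n \<Rightarrow> real) \<Rightarrow> (real^'n \<Rightarrow> real^'n) \<Rightarrow> bool" where
  "zero_trace G S u g \<longleftrightarrow> sobolev1 G u g \<and> (\<exists>\<phi>. approximates G S \<phi> u g)"

lemma approximatesD:
  assumes "approximates G S \<phi> u g"
  shows "Ck 1 (\<phi> n)" "sobolev1 G (\<phi> n) (grad (\<phi> n))"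
    "(\<lambda>n. abs_dist (lebesgue_on G) (\<phi> n) u) \<longlonglongrightarrow> 0"
    "(\<lambda>n. norm_dist (lebesgue_on G) (grad (\<phi> n)) g) \<longlonglongrightarrow> 0"
    "(\<lambda>n. boundary_L1 S (\<phi> n)) \<longlonglongrightarrow> 0"
  using assms unfolding approximates_def by blast+

lemma zero_traceI:
  assumes "sobolev1 G u g" "\<And>n. Ck 1 (\<phi> n)" "\<And>n. sobolev1 G (\<phi> n) (grad (\<phi> n))"
    "(\<lambda>n. abs_dist (lebesgue_on G) (\<phi> n) u) \<longlonglongrightarrow> 0"
    "(\<lambda>n. norm_dist (lebesgue_on G) (grad (\<phi> n)) g) \<longlonglongrightarrow> 0"
    "(\<lambda>n. boundary_L1 S (\<phi> n)) \<longlonglongrightarrow> 0"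
  shows "zero_trace G S u g"
  unfolding zero_trace_def approximates_def using assms by (intro conjI exI[of _ \<phi>] allI)

text \<open>Classical and weak gradient agree almost everywhere, so integrability passes from one to the other.\<close>

lemma sobolev1_C1:
  assumes G: "open G" and \<phi>: "Ck 1 \<phi>" "sobolev1 G \<phi> g"
  shows "sobolev1 G \<phi> (grad \<phi>)"
proof -
  have w: "has_weak_grad G \<phi> (grad \<phi>)" by (rule has_weak_grad_C1[OF G \<phi>(1)])
  have ae: "AE x in lebesgue_on G. g x = grad \<phi> x"
    using \<phi>(2) by (intro weak_grad_unique[OF G _ w]) (simp add: sobolev1_def)
  have m: "grad \<phi> \<in> borel_measurable (lebesgue_on G)"
    by (rule continuous_measurable_lebesgue_on[OF Ck_1_continuous_grad[OF \<phi>(1)]])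
  have "integrable (lebesgue_on G) (grad \<phi>)"
    using \<phi>(2) integrable_cong_AE_imp[OF _ m ae] by (simp add: sobolev1_def)
  then show ?thesis using \<phi>(2) w by (simp add: sobolev1_def)
qed

lemma tendsto_0_add_iff:
  fixes a b :: "nat \<Rightarrow> real"
  assumes "\<And>n. 0 \<le> a n" "\<And>n. 0 \<le> b n"
  shows "(\<lambda>n. a n + b n) \<longlonglongrightarrow> 0 \<longleftrightarrow> a \<longlonglongrightarrow> 0 \<and> b \<longlonglongrightarrow> 0"
proof
  assume l: "(\<lambda>n. a n + b n) \<longlonglongrightarrow> 0"
  have "a \<longlonglongrightarrow> 0" by (rule Lim_null_comparison[OF _ l]) (simp add: assms)
  moreover have "b \<longlonglongrightarrow> 0" by (rule Lim_null_comparison[OF _ l]) (simp add: assms)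
  ultimately show "a \<longlonglongrightarrow> 0 \<and> b \<longlonglongrightarrow> 0" ..
next
  assume "a \<longlonglongrightarrow> 0 \<and> b \<longlonglongrightarrow> 0"
  then show "(\<lambda>n. a n + b n) \<longlonglongrightarrow> 0" using tendsto_add[of a 0 sequentially b 0] by simp
qed

lemma has_trace_zero_iff:
  assumes G: "open G" and u: "sobolev1 G u g"
  shows "has_trace G S u (\<lambda>_. 0) \<longleftrightarrow> zero_trace G S u g"
proof -
  have u1: "u \<in> W1p 1 G" using u by (auto simp: W1p_1_iff)
  have *: "\<phi> \<in> W1p 1 G \<longleftrightarrow> sobolev1 G \<phi> (grad \<phi>)" if "Ck 1 \<phi>" for \<phi>
    using sobolev1_C1[OF G that] by (auto simp: W1p_1_iff)
  have **: "((\<lambda>n. W1p_norm 1 G (\<lambda>x. \<phi> n x - u x)) \<longlonglongrightarrow> 0) \<longleftrightarrow>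
      ((\<lambda>n. abs_dist (lebesgue_on G) (\<phi> n) u) \<longlonglongrightarrow> 0 \<and>
       (\<lambda>n. norm_dist (lebesgue_on G) (grad (\<phi> n)) g) \<longlonglongrightarrow> 0)"
    if "\<And>n. sobolev1 G (\<phi> n) (grad (\<phi> n))" for \<phi>
    using W1p_norm_1[OF G sobolev1_diff[OF G that u]]
    by (subst tendsto_0_add_iff[symmetric]) simp_all
  show ?thesis
    unfolding has_trace_def zero_trace_def approximates_def all_conj_distrib using u u1 * **
    by (simp cong: conj_cong)
qed

lemma sets_hausdorff1: "sets (hausdorff1 :: 'a::euclidean_space measure) = sets borel"
  unfolding hausdorff1_def by (subst sets_measure_of) (auto simp: sets.sigma_sets_eq[of borel, simplified])

text \<open>Only Borel measurability of the integrand is at stake; it makes the boundary integral additive and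
  homogeneous.\<close>

lemma measurable_hausdorff1:
  fixes f :: "'a::euclidean_space \<Rightarrow> real"
  assumes f: "continuous_on UNIV f" and S: "S \<in> sets borel"
  shows "(\<lambda>x. ennreal \<bar>f x\<bar> * indicator S x) \<in> borel_measurable hausdorff1"
proof -
  have [measurable]: "f \<in> borel_measurable borel" using f by (rule borel_measurable_continuous_onI)
  have "(\<lambda>x. ennreal \<bar>f x\<bar> * indicator S x) \<in> borel_measurable borel" using S by measurable
  then show ?thesis by (simp add: measurable_cong_sets[OF sets_hausdorff1 refl])
qed

lemma tendsto_0_le_ennreal:
  fixes a b :: "nat \<Rightarrow> ennreal"
  assumes "b \<longlonglongrightarrow> 0" "\<And>n. a n \<le> b n"
  shows "a \<longlonglongrightarrow> 0"
  by (rule tendsto_sandwich[OF _ _ tendsto_const assms(1)]) (use assms(2) in simp_all)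

lemma tendsto_0_le_real:
  fixes a b :: "nat \<Rightarrow> real"
  assumes "b \<longlonglongrightarrow> 0" "\<And>n. 0 \<le> a n" "\<And>n. a n \<le> b n"
  shows "a \<longlonglongrightarrow> 0"
  by (rule tendsto_sandwich[OF _ _ tendsto_const assms(1)]) (use assms(2,3) in simp_all)

lemma Ck_1_grad:
  assumes "Ck 1 \<phi>" shows "(\<phi> has_derivative (\<lambda>h. grad \<phi> x \<bullet> h)) (at x)"
  using assms Ck_SucD(1)[of 0] by simp

lemma grad_lincomb:
  assumes "Ck 1 \<phi>" "Ck 1 \<psi>"
  shows "grad (\<lambda>x. a * \<phi> x + b * \<psi> x) = (\<lambda>x. a *\<^sub>R grad \<phi> x + b *\<^sub>R grad \<psi> x)"
proof
  fix x
  have "((\<lambda>x. a * \<phi> x + b * \<psi> x) has_derivative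
      (\<lambda>h. a * (grad \<phi> x \<bullet> h) + b * (grad \<psi> x \<bullet> h))) (at x)"
    by (intro has_derivative_add has_derivative_mult_right Ck_1_grad assms)
  then show "grad (\<lambda>x. a * \<phi> x + b * \<psi> x) x = a *\<^sub>R grad \<phi> x + b *\<^sub>R grad \<psi> x"
    by (intro grad_eqI) (simp add: inner_add_left)
qed

lemma L1_dist_lincomb:
  fixes p q r s :: "'a \<Rightarrow> 'b::{banach, second_countable_topology}"
  assumes i: "integrable M p" "integrable M q" "integrable M r" "integrable M s"
  shows "(\<integral>x. norm (a *\<^sub>R p x + b *\<^sub>R q x - (a *\<^sub>R r x + b *\<^sub>R s x)) \<partial>M)
    \<le> \<bar>a\<bar> * norm_dist M p r + \<bar>b\<bar> * norm_dist M q s"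
proof -
  have "(\<integral>x. norm (a *\<^sub>R p x + b *\<^sub>R q x - (a *\<^sub>R r x + b *\<^sub>R s x)) \<partial>M)
      \<le> (\<integral>x. \<bar>a\<bar> * norm (p x - r x) + \<bar>b\<bar> * norm (q x - s x) \<partial>M)"
  proof (rule integral_mono)
    fix x
    have "norm (a *\<^sub>R (p x - r x) + b *\<^sub>R (q x - s x)) \<le> \<bar>a\<bar> * norm (p x - r x) + \<bar>b\<bar> * norm (q x - s x)"
      by (metis norm_scaleR norm_triangle_ineq)
    then show "norm (a *\<^sub>R p x + b *\<^sub>R q x - (a *\<^sub>R r x + b *\<^sub>R s x))
        \<le> \<bar>a\<bar> * norm (p x - r x) + \<bar>b\<bar> * norm (q x - s x)"
      by (simp add: algebra_simps)
  qed (use i in simp_all)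
  also have "\<dots> = \<bar>a\<bar> * norm_dist M p r + \<bar>b\<bar> * norm_dist M q s"
    using i by simp
  finally show ?thesis .
qed

lemma L1_dist_triangle:
  fixes p q r :: "'a \<Rightarrow> 'b::{banach, second_countable_topology}"
  assumes "integrable M p" "integrable M q" "integrable M r"
  shows "norm_dist M p r \<le> norm_dist M p q + norm_dist M q r"
  using L1_dist_lincomb[of M "\<lambda>x. p x - q x" "\<lambda>x. q x - r x" "\<lambda>x. 0" "\<lambda>x. 0" 1 1] assms by simp

text \<open>Linear combinations of the approximating sequences approximate the linear combination.\<close>

lemma zero_trace_lincomb:
  assumes G: "open G" and S: "S \<in> sets borel"
    and u: "zero_trace G S u g" and v: "zero_trace G S v h"
  shows "zero_trace G S (\<lambda>x. a * u x + b * v x) (\<lambda>x. a *\<^sub>R g x + b *\<^sub>R h x)"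
proof -
  let ?M = "lebesgue_on G"
  have u1: "sobolev1 G u g" and v1: "sobolev1 G v h" using u v by (auto simp: zero_trace_def)
  obtain \<phi> where "approximates G S \<phi> u g"
    using u unfolding zero_trace_def by blast
  note \<phi> = approximatesD[OF this]
  obtain \<psi> where "approximates G S \<psi> v h"
    using v unfolding zero_trace_def by blast
  note \<psi> = approximatesD[OF this]
  let ?\<chi> = "\<lambda>n x. a * \<phi> n x + b * \<psi> n x"
  have gr: "grad (?\<chi> n) = (\<lambda>x. a *\<^sub>R grad (\<phi> n) x + b *\<^sub>R grad (\<psi> n) x)" for n
    by (rule grad_lincomb[OF \<phi>(1) \<psi>(1)])
  have C: "Ck 1 (?\<chi> n)" for n
    by (intro Ck_add Ck_mult Ck_const \<phi> \<psi>)
  have s: "sobolev1 G (?\<chi> n) (grad (?\<chi> n))" for n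
    unfolding gr by (rule sobolev1_lincomb[OF G \<phi>(2) \<psi>(2)])
  have lim: "(\<lambda>n. \<bar>a\<bar> * p n + \<bar>b\<bar> * q n) \<longlonglongrightarrow> 0" if "p \<longlonglongrightarrow> 0" "q \<longlonglongrightarrow> 0" for p q :: "nat \<Rightarrow> real"
    using tendsto_add[OF tendsto_mult_right_zero[OF that(1)] tendsto_mult_right_zero[OF that(2)]] by simp
  note ii = \<phi>(2)[unfolded sobolev1_def] \<psi>(2)[unfolded sobolev1_def] u1[unfolded sobolev1_def] v1[unfolded sobolev1_def]
  have 1: "(\<lambda>n. abs_dist ?M (?\<chi> n) (\<lambda>x. a * u x + b * v x)) \<longlonglongrightarrow> 0"
  proof (rule tendsto_0_le_real[OF lim[OF \<phi>(3) \<psi>(3)]])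
    fix n
    show "abs_dist ?M (?\<chi> n) (\<lambda>x. a * u x + b * v x)
        \<le> \<bar>a\<bar> * abs_dist ?M (\<phi> n) u + \<bar>b\<bar> * abs_dist ?M (\<psi> n) v"
      using L1_dist_lincomb[of ?M "\<phi> n" "\<psi> n" u v a b] ii by simp
  qed simp
  have 2: "(\<lambda>n. norm_dist ?M (grad (?\<chi> n)) (\<lambda>x. a *\<^sub>R g x + b *\<^sub>R h x)) \<longlonglongrightarrow> 0"
  proof (rule tendsto_0_le_real[OF lim[OF \<phi>(4) \<psi>(4)]])
    fix n
    show "norm_dist ?M (grad (?\<chi> n)) (\<lambda>x. a *\<^sub>R g x + b *\<^sub>R h x)
        \<le> \<bar>a\<bar> * norm_dist ?M (grad (\<phi> n)) g + \<bar>b\<bar> * norm_dist ?M (grad (\<psi> n)) h"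
      unfolding gr using L1_dist_lincomb[of ?M "grad (\<phi> n)" "grad (\<psi> n)" g h a b] ii by simp
  qed simp
  have 3: "(\<lambda>n. boundary_L1 S (?\<chi> n)) \<longlonglongrightarrow> 0"
  proof (rule tendsto_0_le_ennreal)
    show "(\<lambda>n. ennreal \<bar>a\<bar> * boundary_L1 S (\<phi> n)
        + ennreal \<bar>b\<bar> * boundary_L1 S (\<psi> n)) \<longlonglongrightarrow> 0"
      using tendsto_add[OF ennreal_tendsto_cmult[OF _ \<phi>(5), of "ennreal \<bar>a\<bar>"] ennreal_tendsto_cmult[OF _ \<psi>(5), of "ennreal \<bar>b\<bar>"]]
      by simp
    fix n
    have "ennreal \<bar>?\<chi> n x\<bar> * indicator S x \<le> ennreal \<bar>a\<bar> * (ennreal \<bar>\<phi> n x\<bar> * indicator S x)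
        + ennreal \<bar>b\<bar> * (ennreal \<bar>\<psi> n x\<bar> * indicator S x)" for x
    proof -
      have "\<bar>?\<chi> n x\<bar> \<le> \<bar>a\<bar> * \<bar>\<phi> n x\<bar> + \<bar>b\<bar> * \<bar>\<psi> n x\<bar>" by (metis abs_mult abs_triangle_ineq)
      then show ?thesis by (auto simp: indicator_def ennreal_leI simp flip: ennreal_mult ennreal_plus)
    qed
    then have le: "boundary_L1 S (?\<chi> n)
      \<le> (\<integral>\<^sup>+x. ennreal \<bar>a\<bar> * (ennreal \<bar>\<phi> n x\<bar> * indicator S x)
        + ennreal \<bar>b\<bar> * (ennreal \<bar>\<psi> n x\<bar> * indicator S x) \<partial>hausdorff1)"
      by (intro nn_integral_mono)
    show "boundary_L1 S (?\<chi> n)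
      \<le> ennreal \<bar>a\<bar> * boundary_L1 S (\<phi> n)
        + ennreal \<bar>b\<bar> * boundary_L1 S (\<psi> n)"
    proof -
      note [measurable] = measurable_hausdorff1[OF Ck_1_continuous[OF \<phi>(1)] S, of n]
        measurable_hausdorff1[OF Ck_1_continuous[OF \<psi>(1)] S, of n]
      have "(\<integral>\<^sup>+x. ennreal \<bar>a\<bar> * (ennreal \<bar>\<phi> n x\<bar> * indicator S x)
        + ennreal \<bar>b\<bar> * (ennreal \<bar>\<psi> n x\<bar> * indicator S x) \<partial>hausdorff1)
        = (\<integral>\<^sup>+x. ennreal \<bar>a\<bar> * (ennreal \<bar>\<phi> n x\<bar> * indicator S x) \<partial>hausdorff1)
        + (\<integral>\<^sup>+x. ennreal \<bar>b\<bar> * (ennreal \<bar>\<psi> n x\<bar> * indicator S x) \<partial>hausdorff1)"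
        by (rule nn_integral_add) measurable
      also have "\<dots> = ennreal \<bar>a\<bar> * boundary_L1 S (\<phi> n)
        + ennreal \<bar>b\<bar> * boundary_L1 S (\<psi> n)"
        by (intro arg_cong2[where f = "(+)"] nn_integral_cmult) measurable
      finally show ?thesis using le by simp
    qed
  qed
  show ?thesis
    by (rule zero_traceI[OF sobolev1_lincomb[OF G u1 v1] C s 1 2 3])
qed

text \<open>A diagonal argument: replace each member of the sequence by a nearby approximating \<open>C\<^sup>1\<close> function.\<close>

lemma zero_trace_closed:
  assumes G: "open G" and S: "S \<in> sets borel"
    and u: "\<And>n. zero_trace G S (u n) (g n)"
    and v: "integrable (lebesgue_on G) v" "integrable (lebesgue_on G) h"
    and lim: "(\<lambda>n. abs_dist (lebesgue_on G) (u n) v) \<longlonglongrightarrow> 0"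
      "(\<lambda>n. norm_dist (lebesgue_on G) (g n) h) \<longlonglongrightarrow> 0"
  shows "zero_trace G S v h"
proof -
  let ?M = "lebesgue_on G"
  have u1: "sobolev1 G (u n) (g n)" for n using u[of n] by (simp add: zero_trace_def)
  note ui = u1[unfolded sobolev1_def]
  have v1: "sobolev1 G v h"
    using has_weak_grad_L1_limit[OF G _ _ _ v lim] ui v by (simp add: sobolev1_def)
  let ?e = "\<lambda>n. inverse (real (Suc n))"
  let ?P = "\<lambda>n \<phi>. Ck 1 \<phi> \<and> sobolev1 G \<phi> (grad \<phi>) \<and>
    (abs_dist ?M \<phi> (u n)) < ?e n \<and>
    (norm_dist ?M (grad \<phi>) (g n)) < ?e n \<and>
    (boundary_L1 S \<phi>) < ennreal (?e n)"
  have "\<exists>\<phi>. ?P n \<phi>" for n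
  proof -
    obtain \<phi> where "approximates G S \<phi> (u n) (g n)"
      using u[of n] unfolding zero_trace_def by blast
    note \<phi> = approximatesD[OF this]
    have e: "0 < ?e n" "0 < ennreal (?e n)" by simp_all
    have "\<forall>\<^sub>F k in sequentially. ?P n (\<phi> k)"
      using order_tendstoD(2)[OF \<phi>(3) e(1)] order_tendstoD(2)[OF \<phi>(4) e(1)] order_tendstoD(2)[OF \<phi>(5) e(2)]
      by eventually_elim (intro conjI \<phi>(1,2))
    then have "\<exists>k. ?P n (\<phi> k)" by (rule eventually_happens'[OF sequentially_bot])
    then show ?thesis by (elim exE) (rule exI)
  qed
  then have "\<forall>n. \<exists>\<phi>. ?P n \<phi>" by (rule allI)
  then obtain \<phi> where \<phi>: "\<forall>n. ?P n (\<phi> n)" by (rule choice[THEN exE])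
  have \<phi>s: "sobolev1 G (\<phi> n) (grad (\<phi> n))" for n using \<phi>[rule_format, of n] by (elim conjE)
  note \<phi>i = \<phi>s[unfolded sobolev1_def]
  have e0: "?e \<longlonglongrightarrow> 0" by (rule LIMSEQ_inverse_real_of_nat)
  show ?thesis
  proof (rule zero_traceI[OF v1 _ \<phi>s])
    show "Ck 1 (\<phi> n)" for n using \<phi>[rule_format, of n] by (elim conjE)
    show "(\<lambda>n. abs_dist ?M (\<phi> n) v) \<longlonglongrightarrow> 0"
    proof (rule tendsto_0_le_real)
      show "(\<lambda>n. ?e n + abs_dist ?M (u n) v) \<longlonglongrightarrow> 0"
        using tendsto_add[OF e0 lim(1)] by (simp only: add_0)
      fix n
      have "abs_dist ?M (\<phi> n) v
          \<le> abs_dist ?M (\<phi> n) (u n) + abs_dist ?M (u n) v"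
        using L1_dist_triangle[of ?M "\<phi> n" "u n" v] \<phi>i[of n] ui[of n] v by simp
      then show "abs_dist ?M (\<phi> n) v \<le> ?e n + abs_dist ?M (u n) v"
        using \<phi>[rule_format, of n] by linarith
    qed simp
    show "(\<lambda>n. norm_dist ?M (grad (\<phi> n)) h) \<longlonglongrightarrow> 0"
    proof (rule tendsto_0_le_real)
      show "(\<lambda>n. ?e n + norm_dist ?M (g n) h) \<longlonglongrightarrow> 0"
        using tendsto_add[OF e0 lim(2)] by (simp only: add_0)
      fix n
      have "norm_dist ?M (grad (\<phi> n)) h
          \<le> norm_dist ?M (grad (\<phi> n)) (g n) + norm_dist ?M (g n) h"
        using L1_dist_triangle[of ?M "grad (\<phi> n)" "g n" h] \<phi>i[of n] ui[of n] v by simp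
      then show "norm_dist ?M (grad (\<phi> n)) h \<le> ?e n + norm_dist ?M (g n) h"
        using \<phi>[rule_format, of n] by linarith
    qed simp
    show "(\<lambda>n. boundary_L1 S (\<phi> n)) \<longlonglongrightarrow> 0"
    proof (rule tendsto_0_le_ennreal)
      show "(\<lambda>n. ennreal (?e n)) \<longlonglongrightarrow> 0" using tendsto_ennrealI[OF e0] by (simp only: ennreal_0)
      show "boundary_L1 S (\<phi> n) \<le> ennreal (?e n)" for n
        using \<phi>[rule_format, of n] by (elim conjE) (rule less_imp_le)
    qed
  qed
qed

lemma C1_compose:
  fixes \<phi> :: "real^'n \<Rightarrow> real"
  assumes \<phi>: "Ck 1 \<phi>" and \<psi>: "\<And>t. (\<psi> has_real_derivative \<psi>' t) (at t)" "continuous_on UNIV \<psi>'"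
  shows "Ck 1 (\<lambda>x. \<psi> (\<phi> x))" "grad (\<lambda>x. \<psi> (\<phi> x)) = (\<lambda>x. \<psi>' (\<phi> x) *\<^sub>R grad \<phi> x)"
proof -
  have d: "((\<lambda>x. \<psi> (\<phi> x)) has_derivative (\<lambda>h. (\<psi>' (\<phi> x) *\<^sub>R grad \<phi> x) \<bullet> h)) (at x)" for x
    using has_derivative_compose[OF Ck_1_grad[OF \<phi>] \<psi>(1)[unfolded has_field_derivative_def], of x]
    by simp
  have "Ck 0 (\<lambda>x. (\<psi>' (\<phi> x) *\<^sub>R grad \<phi> x) $ i)" for i
    using Ck_1_continuous_grad[OF \<phi>] Ck_1_continuous[OF \<phi>]
    by (auto intro!: continuous_intros continuous_on_compose2[OF \<psi>(2)])
  from Ck_SucI[OF d this] show "Ck 1 (\<lambda>x. \<psi> (\<phi> x))" by simp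
  show "grad (\<lambda>x. \<psi> (\<phi> x)) = (\<lambda>x. \<psi>' (\<phi> x) *\<^sub>R grad \<phi> x)"
    by (rule ext, rule grad_eqI[OF d])
qed

text \<open>The chain rule, applied to the approximating \<open>C\<^sup>1\<close> functions. Along a subsequence they converge
  almost everywhere, so that \<open>\<psi>'\<close> of them converges and is bounded by \<open>L\<close>; dominated convergence
  identifies the limit of the gradients. On the boundary \<open>\<bar>\<psi> t\<bar> \<le> L \<bar>t\<bar>\<close>, as \<open>\<psi>\<close> vanishes at the origin.\<close>

lemma zero_trace_compose:
  fixes u :: "real^'n \<Rightarrow> real"
  assumes G: "open G" and S: "S \<in> sets borel" and u: "zero_trace G S u g"
    and \<psi>0: "\<psi> 0 = 0"
    and \<psi>: "\<And>t. (\<psi> has_real_derivative \<psi>' t) (at t)" "continuous_on UNIV \<psi>'"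
    and L: "\<And>t. \<bar>\<psi>' t\<bar> \<le> L"
  shows "zero_trace G S (\<lambda>x. \<psi> (u x)) (\<lambda>x. \<psi>' (u x) *\<^sub>R g x)"
proof -
  let ?M = "lebesgue_on G"
  have L0: "L \<ge> 0" using L[of 0] by linarith
  have lip: "\<bar>\<psi> s - \<psi> t\<bar> \<le> L * \<bar>s - t\<bar>" for s t
  proof -
    have "norm (\<psi> s - \<psi> t) \<le> L * norm (s - t)"
      by (rule field_differentiable_bound[of UNIV]) (use \<psi>(1) L in auto)
    then show ?thesis by simp
  qed
  have lip0: "\<bar>\<psi> t\<bar> \<le> L * \<bar>t\<bar>" for t using lip[of t 0] \<psi>0 by simp
  have c\<psi>: "continuous_on UNIV \<psi>"
    by (intro continuous_at_imp_continuous_on ballI DERIV_isCont[OF \<psi>(1)])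
  have [measurable]: "\<psi> \<in> borel_measurable borel" "\<psi>' \<in> borel_measurable borel"
    using c\<psi> \<psi>(2) by (auto intro: borel_measurable_continuous_onI)
  have u1: "sobolev1 G u g" using u by (simp add: zero_trace_def)
  have ui: "integrable ?M u" "integrable ?M g" using u1 by (simp_all add: sobolev1_def)
  note [measurable] = sobolev1_measurable[OF u1]
  have comp_int: "integrable ?M (\<lambda>x. \<psi> (v x))" if v: "integrable ?M v" for v
  proof (rule integrable_norm_le_mult[OF v])
    show "(\<lambda>x. \<psi> (v x)) \<in> borel_measurable ?M"
      using borel_measurable_integrable[OF v] by measurable
    show "norm (\<psi> (v x)) \<le> L * norm (v x)" for x using lip0 by simp
  qed
  have comp_int': "integrable ?M (\<lambda>x. \<psi>' (v x) *\<^sub>R k x)"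
    if v: "integrable ?M v" and k: "integrable ?M k" for v and k :: "real^'n \<Rightarrow> real^'n"
  proof (rule integrable_bounded_scaleR[OF _ k L])
    show "(\<lambda>x. \<psi>' (v x)) \<in> borel_measurable ?M"
      using borel_measurable_integrable[OF v] by measurable
  qed
  obtain \<phi>0 where "approximates G S \<phi>0 u g"
    using u unfolding zero_trace_def by blast
  note \<phi>0 = approximatesD[OF this]
  have "\<exists>r::nat\<Rightarrow>nat. strict_mono r \<and> (AE x in ?M. (\<lambda>n. \<phi>0 (r n) x - u x) \<longlonglongrightarrow> 0)"
  proof (rule tendsto_L1_AE_subseq)
    show "integrable ?M (\<lambda>x. \<phi>0 n x - u x)" for n
      using \<phi>0(2)[of n] ui by (simp add: sobolev1_def)
    show "(\<lambda>n. norm_dist ?M (\<phi>0 n) u) \<longlonglongrightarrow> 0" using \<phi>0(3) by simp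
  qed
  then obtain r :: "nat \<Rightarrow> nat" where r: "strict_mono r"
    and ae0: "AE x in ?M. (\<lambda>n. \<phi>0 (r n) x - u x) \<longlonglongrightarrow> 0" by blast
  define \<phi> where "\<phi> n = \<phi>0 (r n)" for n
  have \<phi>: "\<And>n. Ck 1 (\<phi> n)" "\<And>n. sobolev1 G (\<phi> n) (grad (\<phi> n))"
       "(\<lambda>n. abs_dist ?M (\<phi> n) u) \<longlonglongrightarrow> 0"
       "(\<lambda>n. norm_dist ?M (grad (\<phi> n)) g) \<longlonglongrightarrow> 0"
       "(\<lambda>n. boundary_L1 S (\<phi> n)) \<longlonglongrightarrow> 0"
    unfolding \<phi>_def using \<phi>0(1,2) \<phi>0(3-5)[THEN LIMSEQ_subseq_LIMSEQ, OF r] by (simp_all only: o_def)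
  have ae: "AE x in ?M. (\<lambda>n. \<phi> n x) \<longlonglongrightarrow> u x"
    using ae0 unfolding \<phi>_def by eventually_elim (rule LIM_zero_cancel)
  have \<phi>i: "integrable ?M (\<phi> n)" "integrable ?M (grad (\<phi> n))" for n
    using \<phi>(2)[of n] by (simp_all add: sobolev1_def)
  note cc = C1_compose[OF \<phi>(1) \<psi>]
  have s: "sobolev1 G (\<lambda>x. \<psi> (\<phi> n x)) (grad (\<lambda>x. \<psi> (\<phi> n x)))" for n
    unfolding sobolev1_def
    using has_weak_grad_C1[OF G cc(1)] comp_int[OF \<phi>i(1)] comp_int'[OF \<phi>i] by (simp add: cc(2))
  have lim1: "(\<lambda>n. abs_dist ?M (\<lambda>x. \<psi> (\<phi> n x)) (\<lambda>x. \<psi> (u x))) \<longlonglongrightarrow> 0"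
  proof (rule tendsto_0_le_real[OF tendsto_mult_right_zero[OF \<phi>(3), of L]])
    fix n
    have "abs_dist ?M (\<lambda>x. \<psi> (\<phi> n x)) (\<lambda>x. \<psi> (u x)) \<le> (\<integral>x. L * \<bar>\<phi> n x - u x\<bar> \<partial>?M)"
      using comp_int[OF \<phi>i(1)] comp_int[OF ui(1)] \<phi>i(1) ui(1) lip by (intro integral_mono) simp_all
    then show "abs_dist ?M (\<lambda>x. \<psi> (\<phi> n x)) (\<lambda>x. \<psi> (u x)) \<le> L * abs_dist ?M (\<phi> n) u" by simp
  qed simp
  have lim2a: "(\<lambda>n. norm_dist ?M (\<lambda>x. \<psi>' (\<phi> n x) *\<^sub>R g x) (\<lambda>x. \<psi>' (u x) *\<^sub>R g x))
      \<longlonglongrightarrow> (\<integral>x. 0 \<partial>?M)"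
  proof (rule integral_dominated_convergence[where w = "\<lambda>x. 2 * L * norm (g x)"])
    show "(\<lambda>x. norm (\<psi>' (\<phi> n x) *\<^sub>R g x - \<psi>' (u x) *\<^sub>R g x)) \<in> borel_measurable ?M" for n
      using borel_measurable_integrable[OF comp_int'[OF \<phi>i(1) ui(2)]]
        borel_measurable_integrable[OF comp_int'[OF ui]] by measurable
    show "integrable ?M (\<lambda>x. 2 * L * norm (g x))" using ui(2) by simp
    show "AE x in ?M. (\<lambda>n. norm (\<psi>' (\<phi> n x) *\<^sub>R g x - \<psi>' (u x) *\<^sub>R g x)) \<longlonglongrightarrow> 0"
      using ae
    proof eventually_elim
      fix x assume l: "(\<lambda>n. \<phi> n x) \<longlonglongrightarrow> u x"
      have "isCont \<psi>' (u x)" using \<psi>(2) by (simp add: continuous_on_eq_continuous_at)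
      from isCont_tendsto_compose[OF this l]
      have "(\<lambda>n. \<psi>' (\<phi> n x) *\<^sub>R g x) \<longlonglongrightarrow> \<psi>' (u x) *\<^sub>R g x" by (intro tendsto_scaleR tendsto_const)
      then show "(\<lambda>n. norm (\<psi>' (\<phi> n x) *\<^sub>R g x - \<psi>' (u x) *\<^sub>R g x)) \<longlonglongrightarrow> 0"
        by (intro tendsto_norm_zero LIM_zero)
    qed
    show "AE x in ?M. norm (norm (\<psi>' (\<phi> n x) *\<^sub>R g x - \<psi>' (u x) *\<^sub>R g x)) \<le> 2 * L * norm (g x)" for n
    proof (rule AE_I2)
      fix x
      have "\<bar>\<psi>' (\<phi> n x) - \<psi>' (u x)\<bar> \<le> 2 * L" using L[of "\<phi> n x"] L[of "u x"] by linarith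
      then have "\<bar>\<psi>' (\<phi> n x) - \<psi>' (u x)\<bar> * norm (g x) \<le> 2 * L * norm (g x)" by (rule mult_right_mono) simp
      then show "norm (norm (\<psi>' (\<phi> n x) *\<^sub>R g x - \<psi>' (u x) *\<^sub>R g x)) \<le> 2 * L * norm (g x)"
        by (simp flip: scaleR_left_diff_distrib)
    qed
  qed simp
  have lim2: "(\<lambda>n. norm_dist ?M (grad (\<lambda>x. \<psi> (\<phi> n x))) (\<lambda>x. \<psi>' (u x) *\<^sub>R g x)) \<longlonglongrightarrow> 0"
  proof (rule tendsto_0_le_real)
    show "(\<lambda>n. L * norm_dist ?M (grad (\<phi> n)) g
        + norm_dist ?M (\<lambda>x. \<psi>' (\<phi> n x) *\<^sub>R g x) (\<lambda>x. \<psi>' (u x) *\<^sub>R g x)) \<longlonglongrightarrow> 0"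
      using tendsto_add[OF tendsto_mult_right_zero[OF \<phi>(4), of L] lim2a] by simp
    fix n
    have i: "integrable ?M (\<lambda>x. norm (grad (\<phi> n) x - g x))"
       "integrable ?M (\<lambda>x. norm (\<psi>' (\<phi> n x) *\<^sub>R g x - \<psi>' (u x) *\<^sub>R g x))"
       "integrable ?M (\<lambda>x. norm (\<psi>' (\<phi> n x) *\<^sub>R grad (\<phi> n) x - \<psi>' (u x) *\<^sub>R g x))"
      using \<phi>i(2)[of n] ui(2) comp_int'[OF \<phi>i] comp_int'[OF \<phi>i(1) ui(2)] comp_int'[OF ui] by simp_all
    have "norm_dist ?M (\<lambda>x. \<psi>' (\<phi> n x) *\<^sub>R grad (\<phi> n) x) (\<lambda>x. \<psi>' (u x) *\<^sub>R g x) \<le>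
        (\<integral>x. L * norm (grad (\<phi> n) x - g x) + norm (\<psi>' (\<phi> n x) *\<^sub>R g x - \<psi>' (u x) *\<^sub>R g x) \<partial>?M)"
    proof (rule integral_mono)
      fix x
      have "norm (\<psi>' (\<phi> n x) *\<^sub>R grad (\<phi> n) x - \<psi>' (u x) *\<^sub>R g x)
          \<le> norm (\<psi>' (\<phi> n x) *\<^sub>R (grad (\<phi> n) x - g x)) + norm (\<psi>' (\<phi> n x) *\<^sub>R g x - \<psi>' (u x) *\<^sub>R g x)"
        by (rule order_trans[OF _ norm_triangle_ineq]) (simp add: scaleR_right_diff_distrib)
      moreover have "norm (\<psi>' (\<phi> n x) *\<^sub>R (grad (\<phi> n) x - g x)) \<le> L * norm (grad (\<phi> n) x - g x)"
        using mult_right_mono[OF L[of "\<phi> n x"] norm_ge_zero] by simp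
      ultimately show "norm (\<psi>' (\<phi> n x) *\<^sub>R grad (\<phi> n) x - \<psi>' (u x) *\<^sub>R g x)
          \<le> L * norm (grad (\<phi> n) x - g x) + norm (\<psi>' (\<phi> n x) *\<^sub>R g x - \<psi>' (u x) *\<^sub>R g x)" by linarith
    qed (use i in simp_all)
    then show "norm_dist ?M (grad (\<lambda>x. \<psi> (\<phi> n x))) (\<lambda>x. \<psi>' (u x) *\<^sub>R g x) \<le>
        L * norm_dist ?M (grad (\<phi> n)) g
        + norm_dist ?M (\<lambda>x. \<psi>' (\<phi> n x) *\<^sub>R g x) (\<lambda>x. \<psi>' (u x) *\<^sub>R g x)"
      using i by (simp add: cc(2))
  qed simp
  have lim3: "(\<lambda>n. boundary_L1 S (\<lambda>x. \<psi> (\<phi> n x))) \<longlonglongrightarrow> 0"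
  proof (rule tendsto_0_le_ennreal)
    show "(\<lambda>n. ennreal L * boundary_L1 S (\<phi> n)) \<longlonglongrightarrow> 0"
      using ennreal_tendsto_cmult[OF _ \<phi>(5), of "ennreal L"] by simp
    fix n
    have "boundary_L1 S (\<lambda>x. \<psi> (\<phi> n x))
        \<le> (\<integral>\<^sup>+x. ennreal L * (ennreal \<bar>\<phi> n x\<bar> * indicator S x) \<partial>hausdorff1)"
    proof (rule nn_integral_mono)
      fix x
      have "ennreal \<bar>\<psi> (\<phi> n x)\<bar> \<le> ennreal (L * \<bar>\<phi> n x\<bar>)" by (rule ennreal_leI[OF lip0])
      then show "ennreal \<bar>\<psi> (\<phi> n x)\<bar> * indicator S x \<le> ennreal L * (ennreal \<bar>\<phi> n x\<bar> * indicator S x)"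
        using L0 by (simp add: ennreal_mult indicator_def)
    qed
    also have "\<dots> = ennreal L * boundary_L1 S (\<phi> n)"
      by (rule nn_integral_cmult[OF measurable_hausdorff1[OF Ck_1_continuous[OF \<phi>(1)] S]])
    finally show "boundary_L1 S (\<lambda>x. \<psi> (\<phi> n x))
        \<le> ennreal L * boundary_L1 S (\<phi> n)" .
  qed
  have w: "has_weak_grad G (\<lambda>x. \<psi> (u x)) (\<lambda>x. \<psi>' (u x) *\<^sub>R g x)"
    by (rule has_weak_grad_L1_limit[OF G _ _ _ comp_int[OF ui(1)] comp_int'[OF ui] lim1 lim2])
      (use s in \<open>simp_all add: sobolev1_def\<close>)
  show ?thesis
  proof (rule zero_traceI[OF _ cc(1) s lim1 lim2 lim3])
    show "sobolev1 G (\<lambda>x. \<psi> (u x)) (\<lambda>x. \<psi>' (u x) *\<^sub>R g x)"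
      unfolding sobolev1_def using w comp_int[OF ui(1)] comp_int'[OF ui] by blast
  qed
qed

section \<open>From the Poincare inequality in the first power to the second\<close>

text \<open>Apply the inequality to \<open>u\<^sup>2\<close>, whose gradient is \<open>2 u g\<close>, and absorb half of the left-hand side by
  Young's inequality. Since \<open>t \<mapsto> t\<^sup>2\<close> has an unbounded derivative, it is first replaced by
  \<open>\<psi> t = t\<^sup>2 / (1 + \<epsilon> t\<^sup>2)\<close>; what makes the absorption work is \<open>\<psi>'\<^sup>2 \<le> 4 \<psi>\<close>, uniformly in \<open>\<epsilon>\<close>.\<close>

lemma square_le_poincare:
  fixes u :: "real^'n \<Rightarrow> real"
  assumes G: "open G" and S: "S \<in> sets borel" and u: "zero_trace G S u g"
    and sq: "square_integrable (lebesgue_on G) u" "square_integrable (lebesgue_on G) g"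
    and poincare: "\<And>v h. zero_trace G S v h \<Longrightarrow>
      (\<integral>x. \<bar>v x\<bar> \<partial>lebesgue_on G) \<le> c * (\<integral>x. norm (h x) \<partial>lebesgue_on G)"
    and c: "c \<ge> 0"
  shows "(\<integral>x. (u x)\<^sup>2 \<partial>lebesgue_on G) \<le> 4 * c\<^sup>2 * sq_norm (lebesgue_on G) g"
proof -
  let ?M = "lebesgue_on G"
  have u2: "integrable ?M (\<lambda>x. (u x)\<^sup>2)" and g2: "integrable ?M (\<lambda>x. (norm (g x))\<^sup>2)"
    using sq by (simp_all add: square_integrable_def)
  define e where "e n = inverse (real (Suc n))" for n
  have e: "0 < e n" for n by (simp add: e_def)
  define \<psi> where "\<psi> n t = t\<^sup>2 / (1 + e n * t\<^sup>2)" for n and t :: real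
  define \<psi>' where "\<psi>' n t = 2 * t / (1 + e n * t\<^sup>2)\<^sup>2" for n and t :: real
  have pos: "0 < 1 + e n * t\<^sup>2" "1 \<le> 1 + e n * t\<^sup>2" for n t
    using mult_nonneg_nonneg[OF less_imp_le[OF e[of n]] zero_le_power2[of t]] by linarith+
  have d: "(\<psi> n has_real_derivative \<psi>' n t) (at t)" for n t
    unfolding \<psi>_def \<psi>'_def using pos(1)[of n t]
    by (auto intro!: derivative_eq_intros simp: power2_eq_square field_simps)
  have cont: "continuous_on UNIV (\<psi>' n)" for n
    unfolding \<psi>'_def using pos(1)[of n] by (intro continuous_intros ballI) (metis less_irrefl power_eq_0_iff)
  have le: "0 \<le> \<psi> n t" "\<psi> n t \<le> t\<^sup>2" for n t
    using pos[of n t] mult_left_mono[OF pos(2)[of n t] zero_le_power2[of t]]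
    by (simp_all add: \<psi>_def field_simps)
  have sqle: "(\<psi>' n t)\<^sup>2 \<le> 4 * \<psi> n t" for n t
  proof -
    let ?q = "1 + e n * t\<^sup>2"
    have "?q \<le> (?q\<^sup>2)\<^sup>2" using self_le_power[OF pos(2)[of n t], of 4] by (simp flip: power_mult)
    then have "4 * t\<^sup>2 / (?q\<^sup>2)\<^sup>2 \<le> 4 * t\<^sup>2 / ?q"
      using pos(1)[of n t] by (intro divide_left_mono mult_pos_pos zero_less_power) simp_all
    then show ?thesis by (simp add: \<psi>_def \<psi>'_def power_divide power_mult_distrib)
  qed
  have bnd: "\<bar>\<psi>' n t\<bar> \<le> 4 / e n + 1" for n t
  proof -
    have "\<psi> n t \<le> 1 / e n"
      using pos(1)[of n t] e[of n] by (simp add: \<psi>_def field_simps)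
    then have "(\<psi>' n t)\<^sup>2 \<le> 4 / e n" using sqle[of n t] by linarith
    moreover have "2 * \<bar>\<psi>' n t\<bar> \<le> (\<psi>' n t)\<^sup>2 + 1"
      using zero_le_power2[of "\<bar>\<psi>' n t\<bar> - 1"] by (simp add: power2_diff)
    moreover have "4 / e n > 0" using e[of n] by simp
    ultimately show ?thesis by linarith
  qed
  let ?R = "4 * c\<^sup>2 * sq_norm ?M g"
  have est: "(\<integral>x. \<psi> n (u x) \<partial>?M) \<le> ?R" for n
  proof -
    have z: "zero_trace G S (\<lambda>x. \<psi> n (u x)) (\<lambda>x. \<psi>' n (u x) *\<^sub>R g x)"
      by (rule zero_trace_compose[OF G S u _ d cont bnd]) (simp add: \<psi>_def)
    then have "sobolev1 G (\<lambda>x. \<psi> n (u x)) (\<lambda>x. \<psi>' n (u x) *\<^sub>R g x)" unfolding zero_trace_def by (elim conjE)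
    then have i: "integrable ?M (\<lambda>x. \<psi> n (u x))"
      and i': "integrable ?M (\<lambda>x. \<psi>' n (u x) *\<^sub>R g x)"
      by (simp_all add: sobolev1_def)
    have "(\<integral>x. \<psi> n (u x) \<partial>?M) \<le> c * (\<integral>x. norm (\<psi>' n (u x) *\<^sub>R g x) \<partial>?M)"
      using poincare[OF z] le(1) by simp
    also have "\<dots> = (\<integral>x. c * norm (\<psi>' n (u x) *\<^sub>R g x) \<partial>?M)" by simp
    also have "\<dots> \<le> (\<integral>x. \<psi> n (u x) / 2 + 2 * c\<^sup>2 * (norm (g x))\<^sup>2 \<partial>?M)"
    proof (rule integral_mono)
      show "integrable ?M (\<lambda>x. c * norm (\<psi>' n (u x) *\<^sub>R g x))" by (intro integrable_mult_right integrable_norm i')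
      show "integrable ?M (\<lambda>x. \<psi> n (u x) / 2 + 2 * c\<^sup>2 * (norm (g x))\<^sup>2)" using i g2 by simp
      fix x
      let ?a = "\<bar>\<psi>' n (u x)\<bar>" and ?b = "norm (g x)"
      \<comment> \<open>Young's inequality, weighted so that half of \<open>\<integral> \<psi>\<close> can be absorbed on the left\<close>
      have "0 \<le> (?a - 4 * c * ?b)\<^sup>2" by simp
      then have "8 * (c * (?a * ?b)) \<le> ?a\<^sup>2 + 16 * c\<^sup>2 * ?b\<^sup>2"
        by (simp add: power2_diff power_mult_distrib algebra_simps)
      then show "c * norm (\<psi>' n (u x) *\<^sub>R g x) \<le> \<psi> n (u x) / 2 + 2 * c\<^sup>2 * ?b\<^sup>2"
        using sqle[of n "u x"] by simp
    qed
    also have "\<dots> = (\<integral>x. \<psi> n (u x) \<partial>?M) / 2 + 2 * c\<^sup>2 * sq_norm ?M g"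
      using i g2 by simp
    finally show ?thesis by simp
  qed
  have "(\<lambda>n. \<integral>x. \<psi> n (u x) \<partial>?M) \<longlonglongrightarrow> (\<integral>x. (u x)\<^sup>2 \<partial>?M)"
  proof (rule integral_dominated_convergence[where w = "\<lambda>x. (u x)\<^sup>2"])
    have [measurable]: "u \<in> borel_measurable ?M" using sq(1) by (simp add: square_integrable_def)
    show "(\<lambda>x. \<psi> n (u x)) \<in> borel_measurable ?M" for n unfolding \<psi>_def by measurable
    show "AE x in ?M. (\<lambda>n. \<psi> n (u x)) \<longlonglongrightarrow> (u x)\<^sup>2"
    proof (rule AE_I2)
      fix x
      have "e \<longlonglongrightarrow> 0" unfolding e_def by (rule LIMSEQ_inverse_real_of_nat)
      then have "(\<lambda>n. (u x)\<^sup>2 / (1 + e n * (u x)\<^sup>2)) \<longlonglongrightarrow> (u x)\<^sup>2 / (1 + 0 * (u x)\<^sup>2)"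
        by (intro tendsto_intros) simp_all
      then show "(\<lambda>n. \<psi> n (u x)) \<longlonglongrightarrow> (u x)\<^sup>2" by (simp add: \<psi>_def)
    qed
    show "AE x in ?M. norm (\<psi> n (u x)) \<le> (u x)\<^sup>2" for n using le by (intro AE_I2) simp
  qed (use u2 borel_measurable_integrable in auto)
  then show ?thesis by (rule LIMSEQ_le_const2) (use est in blast)
qed

section \<open>Gaussian smoothing\<close>

definition gauss_grad :: "real \<Rightarrow> real^2 \<Rightarrow> real^2" where
  "gauss_grad \<sigma> z = - (gauss_kernel \<sigma> z / \<sigma>\<^sup>2) *\<^sub>R z"

lemma gauss_kernel_has_derivative:
  assumes "\<sigma> > 0"
  shows "(gauss_kernel \<sigma> has_derivative (\<lambda>h. gauss_grad \<sigma> z \<bullet> h)) (at z)"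
proof -
  let ?C = "1 / (2 * pi * \<sigma>\<^sup>2)" and ?b = "- inverse (2 * \<sigma>\<^sup>2)"
  have k: "gauss_kernel \<sigma> = (\<lambda>z. ?C * exp (?b * (z \<bullet> z)))"
  proof
    fix z :: "real^2"
    have "- ((norm z)\<^sup>2 / (2 * \<sigma>\<^sup>2)) = ?b * (z \<bullet> z)"
      by (simp only: power2_norm_eq_inner divide_inverse minus_mult_left mult.commute)
    then show "gauss_kernel \<sigma> z = ?C * exp (?b * (z \<bullet> z))" by (simp only: gauss_kernel_def)
  qed
  have "((\<lambda>z. ?C * exp (?b * (z \<bullet> z))) has_derivative
      (\<lambda>h. ?C * (?b * (z \<bullet> h + h \<bullet> z) * exp (?b * (z \<bullet> z))))) (at z)"
    by (intro has_derivative_mult_right has_derivative_exp has_derivative_inner has_derivative_ident)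
  moreover have "?C * (?b * (z \<bullet> h + h \<bullet> z) * exp (?b * (z \<bullet> z))) = gauss_grad \<sigma> z \<bullet> h" for h
    using assms unfolding gauss_grad_def k by (simp add: inner_commute[of h z] field_simps)
  ultimately show ?thesis unfolding k by simp
qed

lemma gauss_kernel_bounds:
  assumes "\<sigma> > 0"
  shows "0 \<le> gauss_kernel \<sigma> z" "gauss_kernel \<sigma> z \<le> 1 / (2 * pi * \<sigma>\<^sup>2)"
  using assms by (auto simp: gauss_kernel_def mult_le_cancel_left1 divide_right_mono)

text \<open>With \<open>t = \<parallel>x\<parallel>\<^sup>2 / (2 \<sigma>\<^sup>2)\<close> the second derivative of the kernel is at most a multiple of
  \<open>(1 + 2 t) exp (- t) \<le> 2\<close>.\<close>

lemma gauss_grad_lipschitz: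
  assumes \<sigma>: "\<sigma> > 0"
  shows "norm (gauss_grad \<sigma> y - gauss_grad \<sigma> z) \<le> 1 / (pi * \<sigma>^4) * norm (y - z)"
proof (rule differentiable_bound[of UNIV])
  let ?k = "gauss_kernel \<sigma>"
  let ?D = "\<lambda>z h. - ((gauss_grad \<sigma> z \<bullet> h) / \<sigma>\<^sup>2) *\<^sub>R z - (?k z / \<sigma>\<^sup>2) *\<^sub>R h"
  fix x :: "real^2"
  show "(gauss_grad \<sigma> has_derivative ?D x) (at x within UNIV)"
  proof -
    have "((\<lambda>z. (- inverse (\<sigma>\<^sup>2) * ?k z) *\<^sub>R z) has_derivative
        (\<lambda>h. (- inverse (\<sigma>\<^sup>2) * ?k x) *\<^sub>R h + (- inverse (\<sigma>\<^sup>2) * (gauss_grad \<sigma> x \<bullet> h)) *\<^sub>R x)) (at x)"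
      by (intro has_derivative_scaleR has_derivative_mult_right gauss_kernel_has_derivative[OF \<sigma>] has_derivative_ident)
    moreover have "(\<lambda>z. (- inverse (\<sigma>\<^sup>2) * ?k z) *\<^sub>R z) = gauss_grad \<sigma>"
      by (simp add: gauss_grad_def fun_eq_iff divide_inverse mult.commute[of "inverse _"])
    moreover have "(\<lambda>h. (- inverse (\<sigma>\<^sup>2) * ?k x) *\<^sub>R h + (- inverse (\<sigma>\<^sup>2) * (gauss_grad \<sigma> x \<bullet> h)) *\<^sub>R x) = ?D x"
      by (simp add: fun_eq_iff divide_inverse mult.commute[of "inverse _"])
    ultimately show ?thesis by simp
  qed
  show "onorm (?D x) \<le> 1 / (pi * \<sigma>^4)"
  proof (rule onorm_bound)
    fix h
    let ?t = "(norm x)\<^sup>2 / (2 * \<sigma>\<^sup>2)"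
    have t: "0 \<le> ?t" by simp
    have e: "(1 + 2 * ?t) * exp (- ?t) \<le> 2"
    proof -
      have "1 + 2 * ?t \<le> 2 * exp ?t" using exp_ge_add_one_self[of ?t] t by linarith
      then have "(1 + 2 * ?t) * exp (- ?t) \<le> 2 * exp ?t * exp (- ?t)" by (rule mult_right_mono) simp
      then show ?thesis by (simp add: mult.assoc flip: exp_add)
    qed
    have g: "\<bar>gauss_grad \<sigma> x \<bullet> h\<bar> \<le> ?k x / \<sigma>\<^sup>2 * norm x * norm h"
      using Cauchy_Schwarz_ineq2[of "gauss_grad \<sigma> x" h] gauss_kernel_bounds(1)[OF \<sigma>, of x]
      by (simp add: gauss_grad_def)
    have "norm (?D x h) \<le> norm (((gauss_grad \<sigma> x \<bullet> h) / \<sigma>\<^sup>2) *\<^sub>R x) + norm ((?k x / \<sigma>\<^sup>2) *\<^sub>R h)"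
      using norm_triangle_ineq4[of "- ((gauss_grad \<sigma> x \<bullet> h) / \<sigma>\<^sup>2) *\<^sub>R x" "(?k x / \<sigma>\<^sup>2) *\<^sub>R h"] by simp
    also have "\<dots> = \<bar>gauss_grad \<sigma> x \<bullet> h\<bar> / \<sigma>\<^sup>2 * norm x + ?k x / \<sigma>\<^sup>2 * norm h"
      using gauss_kernel_bounds(1)[OF \<sigma>, of x] by simp
    also have "\<dots> \<le> (?k x / \<sigma>\<^sup>2 * norm x * norm h) / \<sigma>\<^sup>2 * norm x + ?k x / \<sigma>\<^sup>2 * norm h"
      by (intro add_right_mono mult_right_mono divide_right_mono g) simp_all
    also have "\<dots> = ?k x * (1 + 2 * ?t) / \<sigma>\<^sup>2 * norm h"
      using \<sigma> by (simp add: field_simps power2_eq_square)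
    also have "\<dots> = 1 / (2 * pi * \<sigma>\<^sup>2) * ((1 + 2 * ?t) * exp (- ?t)) / \<sigma>\<^sup>2 * norm h"
      by (simp add: gauss_kernel_def)
    also have "\<dots> \<le> 1 / (2 * pi * \<sigma>\<^sup>2) * 2 / \<sigma>\<^sup>2 * norm h"
      by (intro mult_right_mono divide_right_mono mult_left_mono e) simp_all
    also have "\<dots> = 1 / (pi * \<sigma>^4) * norm h" by (simp add: power2_eq_square power4_eq_xxxx)
    finally show "norm (?D x h) \<le> 1 / (pi * \<sigma>^4) * norm h" .
  qed simp
qed simp_all

lemma gauss_grad_bounded:
  assumes \<sigma>: "\<sigma> > 0"
  shows "norm (gauss_grad \<sigma> z) \<le> 1 / (2 * pi * \<sigma>^3)"
proof -
  let ?t = "(norm z)\<^sup>2 / (2 * \<sigma>\<^sup>2)"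
  have "2 * norm z * \<sigma> \<le> \<sigma>\<^sup>2 + (norm z)\<^sup>2"
    using zero_le_power2[of "norm z - \<sigma>"] by (simp add: power2_diff algebra_simps)
  then have "norm z / \<sigma> \<le> 1 / 2 + ?t"
    using \<sigma> by (simp add: field_simps power2_eq_square)
  also have "\<dots> \<le> exp ?t" using exp_ge_add_one_self[of ?t] by linarith
  finally have "norm z / \<sigma> * exp (- ?t) \<le> exp ?t * exp (- ?t)" by (rule mult_right_mono) simp
  then have "norm z / \<sigma> * exp (- ?t) \<le> 1" by (simp flip: exp_add)
  then have "1 / (2 * pi * \<sigma>^3) * (norm z / \<sigma> * exp (- ?t)) \<le> 1 / (2 * pi * \<sigma>^3) * 1"
    using \<sigma> by (intro mult_left_mono) simp_all
  moreover have "norm (gauss_grad \<sigma> z) = 1 / (2 * pi * \<sigma>^3) * (norm z / \<sigma> * exp (- ?t))"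
    using \<sigma> by (simp add: gauss_grad_def gauss_kernel_def power2_eq_square power3_eq_cube field_simps)
  ultimately show ?thesis by simp
qed

text \<open>The remainder is quadratic uniformly in the base point, so it may be integrated against an \<open>L\<^sup>1\<close>
  function; this is how the smoothed function is seen to be differentiable.\<close>

lemma gauss_kernel_taylor:
  assumes \<sigma>: "\<sigma> > 0"
  shows "\<bar>gauss_kernel \<sigma> y - gauss_kernel \<sigma> x - gauss_grad \<sigma> x \<bullet> (y - x)\<bar> \<le> 1 / (pi * \<sigma>^4) * (norm (y - x))\<^sup>2"
proof -
  let ?L = "1 / (pi * \<sigma>^4)"
  have "norm (gauss_kernel \<sigma> y - gauss_kernel \<sigma> x - gauss_grad \<sigma> x \<bullet> (y - x)) \<le> norm (y - x) * (?L * norm (y - x))"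
  proof (rule differentiable_bound_linearization[of x y "cball x (norm (y - x))" _
        "\<lambda>z h. gauss_grad \<sigma> z \<bullet> h" x])
    show "x + t *\<^sub>R (y - x) \<in> cball x (norm (y - x))" if "t \<in> {0..1}" for t
      using that by (simp add: dist_norm mult_left_le_one_le)
    show "(gauss_kernel \<sigma> has_derivative (\<lambda>h. gauss_grad \<sigma> z \<bullet> h)) (at z within cball x (norm (y - x)))" for z
      using gauss_kernel_has_derivative[OF \<sigma>] by (rule has_derivative_at_withinI)
    fix z assume z: "z \<in> cball x (norm (y - x))"
    have "onorm (\<lambda>h. (gauss_grad \<sigma> z - gauss_grad \<sigma> x) \<bullet> h) \<le> norm (gauss_grad \<sigma> z - gauss_grad \<sigma> x)"
      using Cauchy_Schwarz_ineq2 by (intro onorm_bound) simp_all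
    also have "\<dots> \<le> ?L * norm (z - x)" by (rule gauss_grad_lipschitz[OF \<sigma>])
    also have "\<dots> \<le> ?L * norm (y - x)"
      using z \<sigma> by (intro mult_left_mono) (simp_all add: dist_norm norm_minus_commute)
    finally show "onorm ((\<lambda>h. gauss_grad \<sigma> z \<bullet> h) - (\<lambda>h. gauss_grad \<sigma> x \<bullet> h)) \<le> ?L * norm (y - x)"
      by (simp add: fun_diff_def inner_diff_left)
  qed simp
  then show ?thesis by (simp add: power2_eq_square mult.commute mult.left_commute)
qed

lemma has_derivativeI_quadratic:
  fixes f :: "'a::real_inner \<Rightarrow> real"
  assumes "\<And>y. \<bar>f y - f x - v \<bullet> (y - x)\<bar> \<le> B * (norm (y - x))\<^sup>2"
  shows "(f has_derivative (\<lambda>h. v \<bullet> h)) (at x)"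
  unfolding has_derivative_at_alt
proof (intro conjI allI impI)
  show "bounded_linear ((\<bullet>) v)" by (rule bounded_linear_inner_right)
  fix e :: real assume e: "0 < e"
  show "\<exists>d>0. \<forall>y. norm (y - x) < d \<longrightarrow> norm (f y - f x - v \<bullet> (y - x)) \<le> e * norm (y - x)"
  proof (intro exI[of _ "e / (\<bar>B\<bar> + 1)"] conjI allI impI)
    show "0 < e / (\<bar>B\<bar> + 1)" using e by simp
    fix y assume y: "norm (y - x) < e / (\<bar>B\<bar> + 1)"
    have "B * norm (y - x) \<le> (\<bar>B\<bar> + 1) * norm (y - x)" by (rule mult_right_mono) simp_all
    also have "\<dots> \<le> e" using y by (simp add: field_simps less_imp_le)
    finally have "B * norm (y - x) * norm (y - x) \<le> e * norm (y - x)" by (rule mult_right_mono) simp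
    with assms[of y] show "norm (f y - f x - v \<bullet> (y - x)) \<le> e * norm (y - x)"
      by (simp add: power2_eq_square)
  qed
qed

text \<open>Both bounds depend on \<open>w\<close> only through its \<open>L\<^sup>1\<close> norm. The first controls the ellipticity of the
  diffusion field, the second is the equicontinuity behind the compactness argument.\<close>

lemma smoothed_gradient:
  fixes w :: "real^2 \<Rightarrow> real"
  assumes \<sigma>: "\<sigma> > 0" and w: "integrable (lebesgue_on G) w"
  shows "norm (grad (smoothed G \<sigma> w) x) \<le> 1 / (2 * pi * \<sigma>^3) * (\<integral>z. \<bar>w z\<bar> \<partial>lebesgue_on G)"
    and "norm (grad (smoothed G \<sigma> w) x - grad (smoothed G \<sigma> w) y)
      \<le> 1 / (pi * \<sigma>^4) * (\<integral>z. \<bar>w z\<bar> \<partial>lebesgue_on G) * norm (x - y)"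
proof -
  let ?M = "lebesgue_on G"
  let ?I = "\<integral>z. \<bar>w z\<bar> \<partial>?M"
  let ?V = "\<lambda>x. \<integral>z. w z *\<^sub>R gauss_grad \<sigma> (x - z) \<partial>?M"
  have ck: "continuous_on UNIV (gauss_kernel \<sigma>)"
    using gauss_kernel_has_derivative[OF \<sigma>]
    by (intro continuous_at_imp_continuous_on ballI has_derivative_continuous)
  have cg: "continuous_on UNIV (gauss_grad \<sigma>)"
    unfolding gauss_grad_def[abs_def] by (intro continuous_intros ck) (use \<sigma> in simp)
  have mk: "(\<lambda>z. gauss_kernel \<sigma> (x - z)) \<in> borel_measurable ?M" for x
    by (intro continuous_measurable_lebesgue_on continuous_on_compose2[OF ck] continuous_intros) simp
  have mg: "(\<lambda>z. gauss_grad \<sigma> (x - z)) \<in> borel_measurable ?M" for x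
    by (intro continuous_measurable_lebesgue_on continuous_on_compose2[OF cg] continuous_intros) simp
  have ik: "integrable ?M (\<lambda>z. gauss_kernel \<sigma> (x - z) * w z)" for x
    using integrable_bounded_scaleR[OF mk w, of x "1 / (2 * pi * \<sigma>\<^sup>2)"] gauss_kernel_bounds[OF \<sigma>] by simp
  have ig: "integrable ?M (\<lambda>z. w z *\<^sub>R gauss_grad \<sigma> (x - z))" for x
    by (rule integrable_scaleR_bounded[OF mg w gauss_grad_bounded[OF \<sigma>]])
  have iw: "integrable ?M (\<lambda>z. \<bar>w z\<bar>)" using w by simp
  have "(smoothed G \<sigma> w has_derivative (\<lambda>h. ?V x \<bullet> h)) (at x)" for x
  proof (rule has_derivativeI_quadratic[where B = "1 / (pi * \<sigma>^4) * ?I"])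
    fix y
    let ?r = "\<lambda>z. gauss_kernel \<sigma> (y - z) - gauss_kernel \<sigma> (x - z) - gauss_grad \<sigma> (x - z) \<bullet> (y - x)"
    have ii: "integrable ?M (\<lambda>z. (w z *\<^sub>R gauss_grad \<sigma> (x - z)) \<bullet> (y - x))" by (intro integrable_inner_left ig)
    have rr: "w z * ?r z = gauss_kernel \<sigma> (y - z) * w z - gauss_kernel \<sigma> (x - z) * w z - (w z *\<^sub>R gauss_grad \<sigma> (x - z)) \<bullet> (y - x)" for z
      by (simp add: algebra_simps)
    have ir: "integrable ?M (\<lambda>z. w z * ?r z)"
      unfolding rr by (intro Bochner_Integration.integrable_diff ik ii)
    have "(\<integral>z. w z * ?r z \<partial>?M) = smoothed G \<sigma> w y - smoothed G \<sigma> w x - ?V x \<bullet> (y - x)"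
      unfolding rr smoothed_def
      by (simp only: Bochner_Integration.integral_diff[OF Bochner_Integration.integrable_diff[OF ik ik] ii]
        Bochner_Integration.integral_diff[OF ik ik] integral_inner_left[OF ig])
    then have "\<bar>smoothed G \<sigma> w y - smoothed G \<sigma> w x - ?V x \<bullet> (y - x)\<bar> = \<bar>\<integral>z. w z * ?r z \<partial>?M\<bar>" by simp
    also have "\<dots> \<le> (\<integral>z. \<bar>w z * ?r z\<bar> \<partial>?M)" by (rule integral_abs_bound)
    also have "\<dots> \<le> (\<integral>z. \<bar>w z\<bar> * (1 / (pi * \<sigma>^4) * (norm (y - x))\<^sup>2) \<partial>?M)"
    proof (rule integral_mono)
      show "integrable ?M (\<lambda>z. \<bar>w z * ?r z\<bar>)" using ir by simp
      show "integrable ?M (\<lambda>z. \<bar>w z\<bar> * (1 / (pi * \<sigma>^4) * (norm (y - x))\<^sup>2))" using iw by simp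
      show "\<bar>w z * ?r z\<bar> \<le> \<bar>w z\<bar> * (1 / (pi * \<sigma>^4) * (norm (y - x))\<^sup>2)" for z
        using gauss_kernel_taylor[OF \<sigma>, of "y - z" "x - z"] unfolding abs_mult
        by (intro mult_left_mono) simp_all
    qed
    also have "\<dots> = 1 / (pi * \<sigma>^4) * ?I * (norm (y - x))\<^sup>2" by simp
    finally show "\<bar>smoothed G \<sigma> w y - smoothed G \<sigma> w x - ?V x \<bullet> (y - x)\<bar> \<le> 1 / (pi * \<sigma>^4) * ?I * (norm (y - x))\<^sup>2" .
  qed
  then have V: "grad (smoothed G \<sigma> w) x = ?V x" for x by (rule grad_eqI)
  have "norm (?V x) \<le> (\<integral>z. norm (w z *\<^sub>R gauss_grad \<sigma> (x - z)) \<partial>?M)" by (rule integral_norm_bound)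
  also have "\<dots> \<le> (\<integral>z. \<bar>w z\<bar> * (1 / (2 * pi * \<sigma>^3)) \<partial>?M)"
  proof (rule integral_mono)
    show "norm (w z *\<^sub>R gauss_grad \<sigma> (x - z)) \<le> \<bar>w z\<bar> * (1 / (2 * pi * \<sigma>^3))" for z
      unfolding norm_scaleR using gauss_grad_bounded[OF \<sigma>] by (intro mult_left_mono) simp_all
  qed (intro integrable_norm ig, intro integrable_mult_left iw)
  finally show "norm (grad (smoothed G \<sigma> w) x) \<le> 1 / (2 * pi * \<sigma>^3) * ?I" by (simp add: V)
  have "?V x - ?V y = (\<integral>z. w z *\<^sub>R (gauss_grad \<sigma> (x - z) - gauss_grad \<sigma> (y - z)) \<partial>?M)"
    using ig by (simp add: scaleR_right_diff_distrib)
  also have "norm \<dots> \<le> (\<integral>z. norm (w z *\<^sub>R (gauss_grad \<sigma> (x - z) - gauss_grad \<sigma> (y - z))) \<partial>?M)" by (rule integral_norm_bound)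
  also have "\<dots> \<le> (\<integral>z. \<bar>w z\<bar> * (1 / (pi * \<sigma>^4) * norm (x - y)) \<partial>?M)"
  proof (rule integral_mono)
    show "norm (w z *\<^sub>R (gauss_grad \<sigma> (x - z) - gauss_grad \<sigma> (y - z))) \<le> \<bar>w z\<bar> * (1 / (pi * \<sigma>^4) * norm (x - y))" for z
      unfolding norm_scaleR using gauss_grad_lipschitz[OF \<sigma>, of "x - z" "y - z"] by (intro mult_left_mono) simp_all
    show "integrable ?M (\<lambda>z. norm (w z *\<^sub>R (gauss_grad \<sigma> (x - z) - gauss_grad \<sigma> (y - z))))"
      unfolding scaleR_right_diff_distrib by (intro integrable_norm Bochner_Integration.integrable_diff ig)
  qed (intro integrable_mult_left iw)
  finally show "norm (grad (smoothed G \<sigma> w) x - grad (smoothed G \<sigma> w) y) \<le> 1 / (pi * \<sigma>^4) * ?I * norm (x - y)"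
    by (simp add: V)
qed

section \<open>Quadratic energies and their minimisers\<close>

lemma norm_matrix_vector_mult_le:
  fixes A :: "real^'n^'m"
  shows "norm (A *v x) \<le> norm A * norm x"
proof -
  have "norm (A *v x) \<le> L2_set (\<lambda>i. norm (A $ i) * norm x) UNIV"
    unfolding norm_vec_def[of "A *v x"]
    by (intro L2_set_mono) (simp_all add: matrix_vector_mul_component Cauchy_Schwarz_ineq2)
  also have "\<dots> = norm A * norm x"
    unfolding norm_vec_def[of A] by (rule L2_set_left_distrib[symmetric]) simp
  finally show ?thesis .
qed

definition elliptic_field :: "'a measure \<Rightarrow> real \<Rightarrow> real \<Rightarrow> ('a \<Rightarrow> real^'n^'n) \<Rightarrow> bool" where
  "elliptic_field M c b A \<longleftrightarrow> (\<forall>i j. (\<lambda>x. A x $ i $ j) \<in> borel_measurable M) \<and>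
     (\<forall>x\<in>space M. \<forall>q. c * (norm q)\<^sup>2 \<le> (A x *v q) \<bullet> q \<and> (A x *v q) \<bullet> q \<le> b * (norm q)\<^sup>2)"

definition energy :: "'a measure \<Rightarrow> ('a \<Rightarrow> real^'n^'n) \<Rightarrow> ('a \<Rightarrow> real^'n) \<Rightarrow> real" where
  "energy M A g = (\<integral>x. (A x *v g x) \<bullet> g x \<partial>M)"

lemma energy_density_measurable:
  assumes A: "elliptic_field M c b A" and g: "g \<in> borel_measurable M"
  shows "(\<lambda>x. (A x *v g x) \<bullet> g x) \<in> borel_measurable M"
proof -
  have [measurable]: "(\<lambda>x. A x $ i $ j) \<in> borel_measurable M" for i j
    using A by (simp add: elliptic_field_def)
  have [measurable]: "(\<lambda>x. g x $ i) \<in> borel_measurable M" for i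
    using measurable_compose[OF g borel_measurable_continuous_onI[of "\<lambda>v. v $ i"]]
    by (simp add: continuous_on_component continuous_on_id)
  show ?thesis
    unfolding inner_vec_def matrix_vector_mult_def by simp
qed

lemma energy_density_integrable:
  assumes A: "elliptic_field M c b A" and c: "c \<ge> 0" and g: "square_integrable M g"
  shows "integrable M (\<lambda>x. (A x *v g x) \<bullet> g x)"
proof (rule Bochner_Integration.integrable_bound)
  show "integrable M (\<lambda>x. b * (norm (g x))\<^sup>2)" using g by (simp add: square_integrable_def)
  show "(\<lambda>x. (A x *v g x) \<bullet> g x) \<in> borel_measurable M"
    using g by (intro energy_density_measurable[OF A]) (simp add: square_integrable_def)
  show "AE x in M. norm ((A x *v g x) \<bullet> g x) \<le> norm (b * (norm (g x))\<^sup>2)"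
  proof (rule AE_I2)
    fix x assume "x \<in> space M"
    then have "c * (norm (g x))\<^sup>2 \<le> (A x *v g x) \<bullet> g x" "(A x *v g x) \<bullet> g x \<le> b * (norm (g x))\<^sup>2"
      using A by (simp_all add: elliptic_field_def)
    moreover have "0 \<le> c * (norm (g x))\<^sup>2" using c by simp
    ultimately show "norm ((A x *v g x) \<bullet> g x) \<le> norm (b * (norm (g x))\<^sup>2)" by simp
  qed
qed

lemma energy_bounds:
  assumes A: "elliptic_field M c b A" and c: "c \<ge> 0" and g: "square_integrable M g"
  shows "c * sq_norm M g \<le> energy M A g" "energy M A g \<le> b * sq_norm M g"
proof -
  have g2: "integrable M (\<lambda>x. (norm (g x))\<^sup>2)" using g by (simp add: square_integrable_def)
  note i = energy_density_integrable[OF A c g]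
  have "(\<integral>x. c * (norm (g x))\<^sup>2 \<partial>M) \<le> energy M A g"
    unfolding energy_def using A i g2 by (intro integral_mono) (simp_all add: elliptic_field_def)
  then show "c * sq_norm M g \<le> energy M A g" by simp
  have "energy M A g \<le> (\<integral>x. b * (norm (g x))\<^sup>2 \<partial>M)"
    unfolding energy_def using A i g2 by (intro integral_mono) (simp_all add: elliptic_field_def)
  then show "energy M A g \<le> b * sq_norm M g" by simp
qed

lemma energy_parallelogram:
  assumes A: "elliptic_field M c b A" and c: "c \<ge> 0"
    and g: "square_integrable M g" and h: "square_integrable M h"
  shows "energy M A (\<lambda>x. g x + h x) + energy M A (\<lambda>x. g x - h x) = 2 * energy M A g + 2 * energy M A h"
proof -
  note i = energy_density_integrable[OF A c]
  have "energy M A (\<lambda>x. g x + h x) + energy M A (\<lambda>x. g x - h x)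
     = (\<integral>x. (A x *v (g x + h x)) \<bullet> (g x + h x) + (A x *v (g x - h x)) \<bullet> (g x - h x) \<partial>M)"
    unfolding energy_def
    by (rule Bochner_Integration.integral_add[symmetric]) (intro i square_integrable_add square_integrable_diff g h)+
  also have "(\<lambda>x. (A x *v (g x + h x)) \<bullet> (g x + h x) + (A x *v (g x - h x)) \<bullet> (g x - h x))
     = (\<lambda>x. 2 * ((A x *v g x) \<bullet> g x) + 2 * ((A x *v h x) \<bullet> h x))"
    by (simp add: fun_eq_iff matrix_vector_right_distrib matrix_vector_mult_diff_distrib
        inner_add_left inner_add_right inner_diff_left inner_diff_right)
  also have "(\<integral>x. 2 * ((A x *v g x) \<bullet> g x) + 2 * ((A x *v h x) \<bullet> h x) \<partial>M) = 2 * energy M A g + 2 * energy M A h"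
    unfolding energy_def using i[OF g] i[OF h] by simp
  finally show ?thesis .
qed

lemma energy_scale: "energy M A (\<lambda>x. a *\<^sub>R g x) = a\<^sup>2 * energy M A g"
  unfolding energy_def by (simp add: matrix_vector_mult_scaleR power2_eq_square mult.assoc)

lemma energy_cong_AE:
  assumes A: "elliptic_field M c b A" and g: "g \<in> borel_measurable M" "h \<in> borel_measurable M"
    and ae: "AE x in M. g x = h x"
  shows "energy M A g = energy M A h"
  unfolding energy_def
proof (rule integral_cong_AE)
  show "AE x in M. (A x *v g x) \<bullet> g x = (A x *v h x) \<bullet> h x" using ae by eventually_elim simp
qed (intro energy_density_measurable[OF A] g)+

lemma energy_diff_le:
  assumes A: "elliptic_field M c b A" and B: "elliptic_field M c b B" and c: "c \<ge> 0" and g: "square_integrable M g"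
    and le: "\<And>x. x \<in> space M \<Longrightarrow> norm (A x - B x) \<le> d"
  shows "\<bar>energy M A g - energy M B g\<bar> \<le> d * sq_norm M g"
proof -
  have g2: "integrable M (\<lambda>x. (norm (g x))\<^sup>2)" using g by (simp add: square_integrable_def)
  note i = energy_density_integrable[OF A c g] energy_density_integrable[OF B c g]
  have "energy M A g - energy M B g = (\<integral>x. (A x *v g x) \<bullet> g x - (B x *v g x) \<bullet> g x \<partial>M)"
    unfolding energy_def by (rule Bochner_Integration.integral_diff[OF i, symmetric])
  then have "\<bar>energy M A g - energy M B g\<bar> \<le> abs_dist M (\<lambda>x. (A x *v g x) \<bullet> g x) (\<lambda>x. (B x *v g x) \<bullet> g x)"
    using integral_abs_bound by simp
  also have "\<dots> \<le> (\<integral>x. d * (norm (g x))\<^sup>2 \<partial>M)"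
  proof (rule integral_mono)
    show "integrable M (\<lambda>x. \<bar>(A x *v g x) \<bullet> g x - (B x *v g x) \<bullet> g x\<bar>)" using i by simp
    show "integrable M (\<lambda>x. d * (norm (g x))\<^sup>2)" using g2 by simp
    fix x assume x: "x \<in> space M"
    have "(A x *v g x) \<bullet> g x - (B x *v g x) \<bullet> g x = ((A x - B x) *v g x) \<bullet> g x"
      by (simp add: matrix_vector_mult_diff_rdistrib inner_diff_left)
    also have "\<bar>\<dots>\<bar> \<le> norm ((A x - B x) *v g x) * norm (g x)" by (rule Cauchy_Schwarz_ineq2)
    also have "\<dots> \<le> norm (A x - B x) * norm (g x) * norm (g x)"
      by (intro mult_right_mono norm_matrix_vector_mult_le) simp
    also have "\<dots> \<le> d * norm (g x) * norm (g x)" using le[OF x] by (intro mult_right_mono) simp_all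
    finally show "\<bar>(A x *v g x) \<bullet> g x - (B x *v g x) \<bullet> g x\<bar> \<le> d * (norm (g x))\<^sup>2"
      by (simp add: power2_eq_square mult.assoc)
  qed
  finally show ?thesis by simp
qed

lemma zero_trace_0:
  assumes "open G"
  shows "zero_trace G S (\<lambda>x::real^'n. 0) (\<lambda>x. 0)"
proof (rule zero_traceI)
  have C: "Ck 1 (\<lambda>x::real^'n. 0)" by (rule Ck_const)
  have g: "grad (\<lambda>x::real^'n. 0) = (\<lambda>x. 0)" by (rule ext, rule grad_eqI) simp
  show s: "sobolev1 G (\<lambda>x. 0) (\<lambda>x. 0)"
    using has_weak_grad_C1[OF assms C] unfolding g by (simp add: sobolev1_def)
  show "Ck 1 ((\<lambda>n x. 0) n :: real^'n \<Rightarrow> real)" for n :: nat using C .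
  show "sobolev1 G ((\<lambda>n x. 0) n) (grad ((\<lambda>n x. 0) n))" for n :: nat using s unfolding g .
qed (simp_all add: grad_eqI[of "\<lambda>x::real^'n. 0" 0])

text \<open>The affine space of \<open>W\<^sup>1\<^sup>,\<^sup>2\<close> functions with the boundary values of \<open>f\<close> on \<open>S\<close>, together with a
  Poincare inequality for differences of its members.\<close>

locale dirichlet_class =
  fixes G S :: "(real^'n) set" and f :: "real^'n \<Rightarrow> real" and gf :: "real^'n \<Rightarrow> real^'n" and cP :: real
  assumes G: "open G" "finite_measure (lebesgue_on G)" and S: "S \<in> sets borel"
    and f: "sobolev2 G f gf" and cP: "cP \<ge> 0"
    and poincare: "\<And>v h. zero_trace G S v h \<Longrightarrow>
      (\<integral>x. \<bar>v x\<bar> \<partial>lebesgue_on G) \<le> cP * (\<integral>x. norm (h x) \<partial>lebesgue_on G)"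
begin

abbreviation "M \<equiv> lebesgue_on G"

definition adm :: "(real^'n \<Rightarrow> real) \<Rightarrow> (real^'n \<Rightarrow> real^'n) \<Rightarrow> bool" where
  "adm v g \<longleftrightarrow> sobolev2 G v g \<and> zero_trace G S (\<lambda>x. v x - f x) (\<lambda>x. g x - gf x)"

lemma adm_f: "adm f gf"
  using f zero_trace_0[OF G(1)] by (simp add: adm_def)

lemma adm_sq: "adm v g \<Longrightarrow> square_integrable M v" "adm v g \<Longrightarrow> square_integrable M g"
  by (simp_all add: adm_def sobolev2_def)

lemma adm_diff:
  assumes "adm v g" "adm w h"
  shows "zero_trace G S (\<lambda>x. v x - w x) (\<lambda>x. g x - h x)"
  using zero_trace_lincomb[OF G(1) S, of "\<lambda>x. v x - f x" "\<lambda>x. g x - gf x" "\<lambda>x. w x - f x" "\<lambda>x. h x - gf x" 1 "-1"] assms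
  by (simp add: adm_def)

text \<open>Used with both midpoints and the reflection \<open>2 v - w\<close>, so the weights may be negative.\<close>

lemma adm_affine:
  assumes v: "adm v g" and w: "adm w h" and ab: "a + b = 1"
  shows "adm (\<lambda>x. a * v x + b * w x) (\<lambda>x. a *\<^sub>R g x + b *\<^sub>R h x)"
proof -
  have a: "a = 1 - b" using ab by simp
  have 1: "sobolev2 G (\<lambda>x. a * v x + b * w x) (\<lambda>x. a *\<^sub>R g x + b *\<^sub>R h x)"
    using v w by (intro sobolev2_lincomb G) (simp_all add: adm_def)
  have 2: "zero_trace G S (\<lambda>x. a * (v x - f x) + b * (w x - f x)) (\<lambda>x. a *\<^sub>R (g x - gf x) + b *\<^sub>R (h x - gf x))"
    using v w by (intro zero_trace_lincomb G S) (simp_all add: adm_def)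
  have 3: "(\<lambda>x. a * (v x - f x) + b * (w x - f x)) = (\<lambda>x. a * v x + b * w x - f x)"
    "(\<lambda>x. a *\<^sub>R (g x - gf x) + b *\<^sub>R (h x - gf x)) = (\<lambda>x. a *\<^sub>R g x + b *\<^sub>R h x - gf x)"
    unfolding a by (simp_all add: fun_eq_iff algebra_simps)
  show ?thesis using 1 2 unfolding adm_def 3 by blast
qed

lemma adm_poincare_square:
  assumes "adm v g" "adm w h"
  shows "sq_dist M v w \<le> 4 * cP\<^sup>2 * sq_dist M g h"
  using square_le_poincare[OF G(1) S adm_diff[OF assms] _ _ poincare cP]
    square_integrable_diff[OF adm_sq(1)[OF assms(1)] adm_sq(1)[OF assms(2)]]
    square_integrable_diff[OF adm_sq(2)[OF assms(1)] adm_sq(2)[OF assms(2)]]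
  by simp

text \<open>By the Poincare inequality the functions are Cauchy as soon as their gradients are; vanishing traces
  survive the limit because \<open>L\<^sup>2\<close> convergence implies \<open>L\<^sup>1\<close> convergence on a domain of finite measure.\<close>

lemma adm_complete:
  assumes vg: "\<And>n. adm (v n) (g n)"
    and cauchy: "\<And>e. e > 0 \<Longrightarrow> \<exists>N. \<forall>m\<ge>N. \<forall>n\<ge>N. sq_dist M (g m) (g n) < e"
  shows "\<exists>w h. adm w h \<and> (\<lambda>n. abs_dist M (v n) w) \<longlonglongrightarrow> 0 \<and> (\<lambda>n. norm_dist M (g n) h) \<longlonglongrightarrow> 0
    \<and> (\<lambda>n. sq_dist M (g n) h) \<longlonglongrightarrow> 0"
proof -
  interpret finite_measure M by (rule G(2))
  obtain h where h: "square_integrable M h" "(\<lambda>n. sq_dist M (g n) h) \<longlonglongrightarrow> 0"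
    using square_integrable_complete[OF adm_sq(2)[OF vg] cauchy] by blast
  have v_cauchy: "\<exists>N. \<forall>m\<ge>N. \<forall>n\<ge>N. sq_dist M (v m) (v n) < e" if e: "e > 0" for e
  proof -
    have "0 < e / (4 * cP\<^sup>2 + 1)" using e by (simp add: add_nonneg_pos)
    from cauchy[OF this] obtain N where N: "\<And>m n. m \<ge> N \<Longrightarrow> n \<ge> N \<Longrightarrow> sq_dist M (g m) (g n) < e / (4 * cP\<^sup>2 + 1)"
      by blast
    have "sq_dist M (v m) (v n) < e" if "m \<ge> N" "n \<ge> N" for m n
    proof -
      let ?I = "sq_dist M (g m) (g n)"
      have "sq_dist M (v m) (v n) \<le> 4 * cP\<^sup>2 * ?I" by (rule adm_poincare_square[OF vg vg])
      also have "\<dots> \<le> (4 * cP\<^sup>2 + 1) * ?I" by (intro mult_right_mono) simp_all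
      also have "\<dots> < (4 * cP\<^sup>2 + 1) * (e / (4 * cP\<^sup>2 + 1))"
        using N[OF that] by (intro mult_strict_left_mono) (simp_all add: add_nonneg_pos)
      also have "\<dots> = e"
      proof -
        have "4 * cP\<^sup>2 + 1 \<noteq> 0" using zero_le_power2[of cP] by linarith
        then show ?thesis by simp
      qed
      finally show ?thesis .
    qed
    then show ?thesis by blast
  qed
  obtain w where w: "square_integrable M w" "(\<lambda>n. sq_dist M (v n) w) \<longlonglongrightarrow> 0"
    using square_integrable_complete[OF adm_sq(1)[OF vg] v_cauchy] by blast
  have l1: "(\<lambda>n. norm_dist M (v n) w) \<longlonglongrightarrow> 0"
    by (rule square_limit_imp_L1_limit[OF square_integrable_diff[OF adm_sq(1)[OF vg] w(1)] w(2)])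
  have l2: "(\<lambda>n. norm_dist M (g n) h) \<longlonglongrightarrow> 0"
    by (rule square_limit_imp_L1_limit[OF square_integrable_diff[OF adm_sq(2)[OF vg] h(1)] h(2)])
  have l1': "(\<lambda>n. abs_dist M (v n) w) \<longlonglongrightarrow> 0" using l1 by (simp only: real_norm_def)
  have z: "zero_trace G S (\<lambda>x. w x - f x) (\<lambda>x. h x - gf x)"
  proof (rule zero_trace_closed[OF G(1) S])
    show "zero_trace G S (\<lambda>x. v n x - f x) (\<lambda>x. g n x - gf x)" for n using vg[of n] by (simp only: adm_def)
    have f1: "square_integrable M f" "square_integrable M gf" using f by (simp_all add: sobolev2_def)
    show "integrable M (\<lambda>x. w x - f x)" by (rule square_integrable_integrable[OF square_integrable_diff[OF w(1) f1(1)]])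
    show "integrable M (\<lambda>x. h x - gf x)" by (rule square_integrable_integrable[OF square_integrable_diff[OF h(1) f1(2)]])
    show "(\<lambda>n. abs_dist M (\<lambda>x. v n x - f x) (\<lambda>x. w x - f x)) \<longlonglongrightarrow> 0" using l1' by (simp only: diff_diff_eq2 diff_add_cancel)
    show "(\<lambda>n. norm_dist M (\<lambda>x. g n x - gf x) (\<lambda>x. h x - gf x)) \<longlonglongrightarrow> 0" using l2 by (simp only: diff_diff_eq2 diff_add_cancel)
  qed
  then have "has_weak_grad G (\<lambda>x. w x - f x) (\<lambda>x. h x - gf x)" unfolding zero_trace_def sobolev1_def by (elim conjE)
  moreover have "has_weak_grad G f gf" using f by (simp add: sobolev2_def)
  ultimately have "has_weak_grad G (\<lambda>x. 1 * (w x - f x) + 1 * f x) (\<lambda>x. 1 *\<^sub>R (h x - gf x) + 1 *\<^sub>R gf x)"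
    by (rule has_weak_grad_lincomb[OF G(1)])
  then have "adm w h" using w(1) h(1) z by (simp add: adm_def sobolev2_def)
  then show ?thesis using l1' l2 h(2) by blast
qed

definition minimiser :: "(real^'n \<Rightarrow> real^'n^'n) \<Rightarrow> (real^'n \<Rightarrow> real) \<Rightarrow> (real^'n \<Rightarrow> real^'n) \<Rightarrow> bool" where
  "minimiser A v g \<longleftrightarrow> adm v g \<and> (\<forall>w h. adm w h \<longrightarrow> energy M A g \<le> energy M A h)"

text \<open>The parallelogram law together with the lower bound at the midpoint. For \<open>m\<close> the infimum it shows
  that minimising sequences are Cauchy, and for \<open>m\<close> the minimum that almost minimal functions are
  close to the minimiser.\<close>

lemma midpoint_energy:
  assumes A: "elliptic_field M c b A" and c: "c \<ge> 0" and v: "adm v g" and w: "adm w h"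
    and m: "\<And>v' g'. adm v' g' \<Longrightarrow> m \<le> energy M A g'"
  shows "energy M A (\<lambda>x. g x - h x) \<le> 2 * energy M A g + 2 * energy M A h - 4 * m"
proof -
  have "m \<le> energy M A (\<lambda>x. (1/2) *\<^sub>R g x + (1/2) *\<^sub>R h x)"
    by (rule m[OF adm_affine[OF v w]]) simp
  also have "\<dots> = energy M A (\<lambda>x. (1/2) *\<^sub>R (g x + h x))" by (simp only: scaleR_right_distrib)
  also have "\<dots> = (1/2)\<^sup>2 * energy M A (\<lambda>x. g x + h x)" by (rule energy_scale)
  finally have "4 * m \<le> energy M A (\<lambda>x. g x + h x)" by (simp add: power2_eq_square)
  then show ?thesis
    using energy_parallelogram[OF A c adm_sq(2)[OF v] adm_sq(2)[OF w]] by linarith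
qed

text \<open>The direct method without weak convergence: the gradients of a minimising sequence are Cauchy in
  \<open>L\<^sup>2\<close>. That the limit \<open>w\<close> attains the infimum \<open>m\<close> follows from the parallelogram law once more,
  comparing with the reflection \<open>2 v\<^sub>n - w\<close>, whose energy is at least \<open>m\<close>.\<close>

lemma minimiser_exists:
  assumes A: "elliptic_field M c b A" and c: "c > 0" and b: "b \<ge> 0"
  shows "\<exists>v g. minimiser A v g"
proof -
  have c0: "c \<ge> 0" using c by simp
  let ?E = "{e. \<exists>v g. adm v g \<and> e = energy M A g}"
  define m where "m = Inf ?E"
  have ne: "?E \<noteq> {}" using adm_f by blast
  have nn: "0 \<le> energy M A g" if "adm v g" for v g
  proof -
    have "0 \<le> c * sq_norm M g" using c0 by simp
    also note energy_bounds(1)[OF A c0 adm_sq(2)[OF that]]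
    finally show ?thesis .
  qed
  have bb: "bdd_below ?E" using nn by (intro bdd_belowI[of _ 0]) blast
  have m: "m \<le> energy M A g" if "adm v g" for v g
    unfolding m_def by (rule cInf_lower[OF _ bb]) (use that in blast)
  let ?e = "\<lambda>n. inverse (real (Suc n))"
  have "\<exists>p. adm (fst p) (snd p) \<and> energy M A (snd p) < m + ?e n" for n
  proof -
    have "Inf ?E < m + ?e n" unfolding m_def by simp
    then obtain e where "e \<in> ?E" "e < m + ?e n" using cInf_lessD[OF ne] by blast
    then show ?thesis by force
  qed
  then have "\<forall>n. \<exists>p. adm (fst p) (snd p) \<and> energy M A (snd p) < m + ?e n" by (rule allI)
  then obtain p where p: "\<forall>n. adm (fst (p n)) (snd (p n)) \<and> energy M A (snd (p n)) < m + ?e n" by (rule choice[THEN exE])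
  define v where "v n = fst (p n)" for n
  define g where "g n = snd (p n)" for n
  have vg: "adm (v n) (g n)" and En: "energy M A (g n) < m + ?e n" for n
    using p by (auto simp: v_def g_def)
  have "\<exists>N. \<forall>k\<ge>N. \<forall>n\<ge>N. sq_dist M (g k) (g n) < e" if e: "e > 0" for e
  proof -
    have "0 < e * c / 4" using e c by simp
    then obtain N where N: "?e N < e * c / 4" using reals_Archimedean by blast
    have "sq_dist M (g k) (g n) < e" if "k \<ge> N" "n \<ge> N" for k n
    proof -
      have "?e k \<le> ?e N" "?e n \<le> ?e N" using that by simp_all
      moreover have "energy M A (\<lambda>x. g k x - g n x) \<le> 2 * energy M A (g k) + 2 * energy M A (g n) - 4 * m"
        by (rule midpoint_energy[OF A c0 vg vg]) (rule m)
      ultimately have "energy M A (\<lambda>x. g k x - g n x) < e * c"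
        using En[of k] En[of n] N by linarith
      then have "c * sq_dist M (g k) (g n) < e * c"
        using energy_bounds(1)[OF A c0 square_integrable_diff[OF adm_sq(2)[OF vg[of k]] adm_sq(2)[OF vg[of n]]]] by linarith
      then show ?thesis using c by (simp add: mult.commute)
    qed
    then show ?thesis by blast
  qed
  from adm_complete[OF vg this] obtain w h where wh: "adm w h" "(\<lambda>n. sq_dist M (g n) h) \<longlonglongrightarrow> 0"
    by blast
  have le: "energy M A h \<le> m + 2 * ?e n + 2 * (b * sq_dist M (g n) h)" for n
  proof -
    have d: "square_integrable M (\<lambda>x. g n x - h x)" by (intro square_integrable_diff adm_sq(2)[OF vg] adm_sq(2)[OF wh(1)])
    \<comment> \<open>the reflection of the limit at the \<open>n\<close>-th function is admissible\<close>
    have "m \<le> energy M A (\<lambda>x. 2 *\<^sub>R g n x + (-1) *\<^sub>R h x)" by (rule m[OF adm_affine[OF vg wh(1)]]) simp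
    also have "(\<lambda>x. 2 *\<^sub>R g n x + (-1) *\<^sub>R h x) = (\<lambda>x. g n x + (g n x - h x))" by (simp add: fun_eq_iff scaleR_2)
    finally have "m + energy M A (\<lambda>x. g n x - (g n x - h x)) \<le> 2 * energy M A (g n) + 2 * energy M A (\<lambda>x. g n x - h x)"
      using energy_parallelogram[OF A c0 adm_sq(2)[OF vg[of n]] d] by linarith
    then have "m + energy M A h \<le> 2 * energy M A (g n) + 2 * energy M A (\<lambda>x. g n x - h x)" by simp
    then show ?thesis using energy_bounds(2)[OF A c0 d] En[of n] by linarith
  qed
  have "(\<lambda>n. m + 2 * ?e n + 2 * (b * sq_dist M (g n) h)) \<longlonglongrightarrow> m + 2 * 0 + 2 * (b * 0)"
    by (intro tendsto_add tendsto_mult tendsto_const LIMSEQ_inverse_real_of_nat wh(2))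
  then have "energy M A h \<le> m + 2 * 0 + 2 * (b * 0)" by (rule LIMSEQ_le_const) (use le in blast)
  then have "energy M A h \<le> m" by simp
  then have "minimiser A w h" unfolding minimiser_def using wh(1) m order_trans by blast
  then show ?thesis by blast
qed

text \<open>Use each of the two minimisers as a competitor for the other and add the two inequalities: on the
  right only the differences of the two energies remain.\<close>

lemma minimiser_stability:
  assumes A: "elliptic_field M c b A" and B: "elliptic_field M c b B" and c: "c > 0"
    and v: "minimiser A v g" and w: "minimiser B w h"
    and d: "\<And>x. x \<in> G \<Longrightarrow> norm (A x - B x) \<le> d"
  shows "c * sq_dist M g h \<le> d * (sq_norm M g + sq_norm M h)"
proof -
  have c0: "c \<ge> 0" using c by simp
  have av: "adm v g" and aw: "adm w h" using v w by (simp_all add: minimiser_def)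
  note sq = adm_sq(2)[OF av] adm_sq(2)[OF aw]
  have "energy M A (\<lambda>x. g x - h x) \<le> 2 * energy M A g + 2 * energy M A h - 4 * energy M A g"
    by (rule midpoint_energy[OF A c0 av aw]) (use v in \<open>auto simp: minimiser_def\<close>)
  moreover have "energy M B (\<lambda>x. g x - h x) \<le> 2 * energy M B g + 2 * energy M B h - 4 * energy M B h"
    by (rule midpoint_energy[OF B c0 av aw]) (use w in \<open>auto simp: minimiser_def\<close>)
  moreover note energy_bounds(1)[OF A c0 square_integrable_diff[OF sq]] energy_bounds(1)[OF B c0 square_integrable_diff[OF sq]]
  moreover have "\<bar>energy M A g - energy M B g\<bar> \<le> d * sq_norm M g"
    "\<bar>energy M A h - energy M B h\<bar> \<le> d * sq_norm M h"
    using d by (intro energy_diff_le[OF A B c0] sq; simp)+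
  ultimately show ?thesis unfolding ring_distribs by linarith
qed

end

section \<open>The diffusion fields and the operator T\<close>

lemma has_weak_grad_mono:
  fixes u :: "real^'n \<Rightarrow> real"
  assumes G: "open G" and O: "open \<Omega>" and sub: "G \<subseteq> \<Omega>" and u: "has_weak_grad \<Omega> u g"
  shows "has_weak_grad G u g"
  unfolding has_weak_grad_def
proof (intro conjI ballI)
  show "locally_integrable G u" "locally_integrable G g"
    using u sub unfolding has_weak_grad_def locally_integrable_def by blast+
  fix \<phi> :: "real^'n \<Rightarrow> real" assume \<phi>: "\<phi> \<in> test_functions G"
  obtain S where S: "S \<subseteq> G" "\<And>x. x \<notin> S \<Longrightarrow> \<phi> x = 0" "\<And>x. x \<notin> S \<Longrightarrow> grad \<phi> x = 0"
    using test_functions_support[OF \<phi>] by metis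
  have off: "\<phi> x = 0" "grad \<phi> x = 0" if "x \<notin> G" for x
    using S(1) S(2,3)[of x] that by blast+
  have "\<phi> \<in> test_functions \<Omega>" using \<phi> sub by (auto simp: test_functions_def)
  then have "(\<integral>x. u x *\<^sub>R grad \<phi> x \<partial>lebesgue_on \<Omega>) = - (\<integral>x. \<phi> x *\<^sub>R g x \<partial>lebesgue_on \<Omega>)"
    using u by (simp add: has_weak_grad_def)
  moreover have "(\<integral>x. u x *\<^sub>R grad \<phi> x \<partial>lebesgue_on \<Omega>) = (\<integral>x. u x *\<^sub>R grad \<phi> x \<partial>lebesgue_on G)"
    using G O sub off by (intro integrable_restrict_supp(2)) auto
  moreover have "(\<integral>x. \<phi> x *\<^sub>R g x \<partial>lebesgue_on \<Omega>) = (\<integral>x. \<phi> x *\<^sub>R g x \<partial>lebesgue_on G)"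
    using G O sub off by (intro integrable_restrict_supp(2)) auto
  ultimately show "(\<integral>x. u x *\<^sub>R grad \<phi> x \<partial>lebesgue_on G) = - (\<integral>x. \<phi> x *\<^sub>R g x \<partial>lebesgue_on G)" by simp
qed

lemma square_integrable_lebesgue_on_subset:
  fixes h :: "'a::euclidean_space \<Rightarrow> 'b::euclidean_space"
  assumes \<Omega>: "\<Omega> \<in> sets lebesgue" and G: "G \<in> sets lebesgue" "G \<subseteq> \<Omega>"
    and h: "square_integrable (lebesgue_on \<Omega>) h"
  shows "square_integrable (lebesgue_on G) h"
  unfolding square_integrable_def
proof
  show "h \<in> borel_measurable (lebesgue_on G)"
    by (rule measurable_restrict_mono[OF _ G(2)]) (use h in \<open>simp add: square_integrable_def\<close>)
  show "integrable (lebesgue_on G) (\<lambda>x. (norm (h x))\<^sup>2)"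
    by (rule integrable_lebesgue_on_subset[OF \<Omega> G]) (use h in \<open>simp add: square_integrable_def\<close>)
qed

lemma sobolev2_mono:
  fixes u :: "real^'n \<Rightarrow> real"
  assumes G: "open G" and O: "open \<Omega>" and sub: "G \<subseteq> \<Omega>" and u: "sobolev2 \<Omega> u g"
  shows "sobolev2 G u g"
proof -
  have "G \<in> sets lebesgue" "\<Omega> \<in> sets lebesgue" using G O by simp_all
  note sq = square_integrable_lebesgue_on_subset[OF this(2,1) sub]
  show ?thesis using u has_weak_grad_mono[OF G O sub] unfolding sobolev2_def by (blast intro: sq)
qed

text \<open>The assumed inequality concerns functions with the boundary values of \<open>f\<close> and contains a term in
  \<open>f\<close>. Inserting \<open>f + t v\<close> and letting \<open>t\<close> tend to infinity removes this term.\<close>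

lemma L1_poincare_zero_trace:
  assumes G: "open G" and S: "S \<in> sets borel" and f: "f \<in> W1p 1 G"
    and P: "\<And>w. w \<in> W1p 1 G \<Longrightarrow> eq_trace G S w f \<Longrightarrow>
           Lp_norm 1 G w \<le> c * (Lp_norm 1 G (weak_grad G (\<lambda>x. w x - f x)) + Lp_norm 1 G f)"
    and v: "zero_trace G S v h"
  shows "(\<integral>x. \<bar>v x\<bar> \<partial>lebesgue_on G) \<le> c * (\<integral>x. norm (h x) \<partial>lebesgue_on G)"
proof (rule ccontr)
  let ?M = "lebesgue_on G"
  let ?I = "\<integral>x. \<bar>v x\<bar> \<partial>?M" and ?H = "\<integral>x. norm (h x) \<partial>?M"
  let ?F = "\<integral>x. \<bar>f x\<bar> \<partial>?M"
  assume "\<not> ?I \<le> c * ?H"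
  then have pos: "0 < ?I - c * ?H" by simp
  obtain gf where gf: "sobolev1 G f gf" using f by (auto simp: W1p_1_iff)
  have v1: "sobolev1 G v h" using v unfolding zero_trace_def by (elim conjE)
  have i: "integrable ?M v" "integrable ?M f"
    using v1 gf by (simp_all add: sobolev1_def)
  have est: "t * (?I - c * ?H) \<le> (c + 1) * ?F" if t: "t > 0" for t
  proof -
    let ?w = "\<lambda>x. f x + t * v x"
    have w1: "sobolev1 G ?w (\<lambda>x. gf x + t *\<^sub>R h x)"
      using sobolev1_lincomb[OF G gf v1, of 1 t] by simp
    have z: "zero_trace G S (\<lambda>x. t * v x) (\<lambda>x. t *\<^sub>R h x)"
      using zero_trace_lincomb[OF G S v v, of t 0] by simp
    then have z1: "sobolev1 G (\<lambda>x. t * v x) (\<lambda>x. t *\<^sub>R h x)" unfolding zero_trace_def by (elim conjE)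
    have d: "(\<lambda>x. ?w x - f x) = (\<lambda>x. t * v x)" by simp
    have "eq_trace G S ?w f"
      unfolding eq_trace_def d by (rule has_trace_zero_iff[OF G z1, THEN iffD2, OF z])
    then have "Lp_norm 1 G ?w \<le> c * (Lp_norm 1 G (weak_grad G (\<lambda>x. ?w x - f x)) + Lp_norm 1 G f)"
      using w1 by (intro P) (auto simp: W1p_1_iff)
    then have "(\<integral>x. \<bar>?w x\<bar> \<partial>?M) \<le> c * (t * ?H + ?F)"
      unfolding d Lp_norm_1_weak_grad[OF G z1] using t by (simp add: Lp_norm_1)
    moreover have "t * ?I - ?F \<le> (\<integral>x. \<bar>?w x\<bar> \<partial>?M)"
    proof -
      have "t * ?I - ?F = (\<integral>x. t * \<bar>v x\<bar> - \<bar>f x\<bar> \<partial>?M)" using i by simp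
      also have "\<dots> \<le> (\<integral>x. \<bar>?w x\<bar> \<partial>?M)"
      proof (rule integral_mono)
        show "t * \<bar>v x\<bar> - \<bar>f x\<bar> \<le> \<bar>?w x\<bar>" for x
          using abs_triangle_ineq4[of "?w x" "f x"] t by (simp add: abs_mult)
      qed (use i in simp_all)
      finally show ?thesis .
    qed
    ultimately show ?thesis by (simp add: algebra_simps)
  qed
  \<comment> \<open>large enough that the left-hand side of \<open>est\<close> exceeds its right-hand side\<close>
  define t where "t = (\<bar>(c + 1) * ?F\<bar> + 1) / (?I - c * ?H)"
  have "t > 0" unfolding t_def using pos by (intro divide_pos_pos) linarith+
  moreover have "t * (?I - c * ?H) = \<bar>(c + 1) * ?F\<bar> + 1" unfolding t_def using pos by simp
  ultimately show False using est[of t] by linarith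
qed

lemma coercivity_factor:
  fixes p :: "'a::real_normed_vector"
  assumes "norm p \<le> m"
  shows "1 / (1 + m) \<le> (1 + (norm p)\<^sup>2) powr (-1/2)"
proof -
  have "sqrt (1 + (norm p)\<^sup>2) \<le> 1 + norm p"
    by (rule real_le_lsqrt) (simp_all add: power2_eq_square algebra_simps)
  then have le: "sqrt (1 + (norm p)\<^sup>2) \<le> 1 + m" using assms by simp
  have pos: "0 < sqrt (1 + (norm p)\<^sup>2)" by (simp add: add_pos_nonneg)
  have "(1 + (norm p)\<^sup>2) powr (-1/2) = 1 / sqrt (1 + (norm p)\<^sup>2)"
    using powr_minus_divide[of "1 + (norm p)\<^sup>2" "1/2"] by (simp add: powr_half_sqrt add_nonneg_nonneg)
  then show ?thesis using frac_le[of 1 1, OF _ _ pos le] by simp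
qed

lemma diffusion_elliptic:
  fixes D :: "real^2 \<Rightarrow> real^2^2"
  assumes D: "continuous_on UNIV D" and c1: "c1 > 0"
    and lower: "\<And>p q. c1 * (1 + (norm p)\<^sup>2) powr (-1/2) * (norm q)\<^sup>2 \<le> (D p *v q) \<bullet> q"
    and upper: "\<And>p q. (D p *v q) \<bullet> q \<le> c2 * (norm q)\<^sup>2"
    and \<sigma>: "\<sigma> > 0" and w: "integrable (lebesgue_on G) w"
    and m: "1 / (2 * pi * \<sigma>^3) * (\<integral>z. \<bar>w z\<bar> \<partial>lebesgue_on G) \<le> m"
  shows "elliptic_field (lebesgue_on G) (c1 / (1 + m)) c2 (\<lambda>x. D (grad (smoothed G \<sigma> w) x))"
  unfolding elliptic_field_def
proof (intro conjI allI ballI)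
  note sm = smoothed_gradient[OF \<sigma> w]
  let ?p = "grad (smoothed G \<sigma> w)"
  have L: "(1 / (pi * \<sigma>^4) * (\<integral>z. \<bar>w z\<bar> \<partial>lebesgue_on G))-lipschitz_on UNIV ?p"
    by (rule lipschitz_onI) (use sm(2) \<sigma> in \<open>simp_all add: dist_norm\<close>)
  have cp: "continuous_on UNIV ?p" by (rule lipschitz_on_continuous_on[OF L])
  have "continuous_on UNIV (\<lambda>x. D (?p x) $ i $ j)" for i j
    by (intro continuous_on_component continuous_on_compose2[OF D cp]) simp
  then show "(\<lambda>x. D (?p x) $ i $ j) \<in> borel_measurable (lebesgue_on G)" for i j
    by (rule continuous_measurable_lebesgue_on)
  fix x and q :: "real^2"
  have "norm (?p x) \<le> m" using sm(1)[of x] m by linarith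
  from coercivity_factor[OF this] have "c1 / (1 + m) \<le> c1 * (1 + (norm (?p x))\<^sup>2) powr (-1/2)"
    using mult_left_mono[of _ _ c1] c1 by fastforce
  then have "c1 / (1 + m) * (norm q)\<^sup>2 \<le> c1 * (1 + (norm (?p x))\<^sup>2) powr (-1/2) * (norm q)\<^sup>2"
    by (rule mult_right_mono) simp
  then show "c1 / (1 + m) * (norm q)\<^sup>2 \<le> (D (?p x) *v q) \<bullet> q" using lower[of "?p x" q] by linarith
  show "(D (?p x) *v q) \<bullet> q \<le> c2 * (norm q)\<^sup>2" by (rule upper)
qed

lemma J_functional_eq_energy:
  "J_functional G D \<sigma> w v = energy (lebesgue_on G) (\<lambda>x. D (grad (smoothed G \<sigma> w) x)) (weak_grad G v)"
  by (simp add: J_functional_def energy_def)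

locale planar_dirichlet_class = dirichlet_class G "frontier K" f gf cP
  for G K :: "(real^2) set" and f gf cP
begin

lemma adm_imp_admissible:
  assumes "adm v g"
  shows "v \<in> admissible G K f"
proof -
  have v: "sobolev2 G v g" and z: "zero_trace G (frontier K) (\<lambda>x. v x - f x) (\<lambda>x. g x - gf x)"
    using assms by (simp_all add: adm_def)
  have z1: "sobolev1 G (\<lambda>x. v x - f x) (\<lambda>x. g x - gf x)" using z unfolding zero_trace_def by (elim conjE)
  have "eq_trace G (frontier K) v f"
    unfolding eq_trace_def by (rule has_trace_zero_iff[OF G(1) z1, THEN iffD2, OF z])
  then show ?thesis using v by (auto simp: admissible_def W1p_2_iff)
qed

lemma admissible_imp_adm:
  assumes "v \<in> admissible G K f"
  shows "adm v (weak_grad G v)"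
proof -
  obtain g where "sobolev2 G v g" using assms by (auto simp: admissible_def W1p_2_iff)
  then have v: "sobolev2 G v (weak_grad G v)" by (rule sobolev2_weak_grad[OF G(1)])
  have s: "sobolev1 G (\<lambda>x. v x - f x) (\<lambda>x. weak_grad G v x - gf x)"
    by (intro sobolev1_diff G sobolev2_imp_sobolev1 v f)
  have "has_trace G (frontier K) (\<lambda>x. v x - f x) (\<lambda>_. 0)"
    using assms by (simp add: admissible_def eq_trace_def)
  then have "zero_trace G (frontier K) (\<lambda>x. v x - f x) (\<lambda>x. weak_grad G v x - gf x)"
    by (rule has_trace_zero_iff[OF G(1) s, THEN iffD1])
  then show ?thesis using v by (simp add: adm_def)
qed

lemma energy_weak_grad:
  assumes A: "elliptic_field M c b A" and v: "adm v g"
  shows "energy M A (weak_grad G v) = energy M A g"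
proof (rule energy_cong_AE[OF A])
  have "sobolev2 G v g" using v by (simp add: adm_def)
  then have w: "has_weak_grad G v g" by (simp add: sobolev2_def)
  show "AE x in M. weak_grad G v x = g x"
    using AE_weak_grad[OF G(1) w] by eventually_elim simp
  show "weak_grad G v \<in> borel_measurable M"
    using admissible_imp_adm[OF adm_imp_admissible[OF v]] adm_sq(2) by (simp add: square_integrable_def)
  show "g \<in> borel_measurable M" using adm_sq(2)[OF v] by (simp add: square_integrable_def)
qed

text \<open>A minimiser exists, so the choice operator in the definition of \<open>T\<close> selects one; minimality among
  admissible functions, measured with the chosen weak gradients, is minimality among admissible pairs.\<close>

lemma T_op_minimiser:
  assumes A: "elliptic_field M c b (\<lambda>x. D (grad (smoothed G \<sigma> w) x))" and c: "c > 0" and b: "b \<ge> 0"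
  shows "minimiser (\<lambda>x. D (grad (smoothed G \<sigma> w) x)) (T_op G K f D \<sigma> w) (weak_grad G (T_op G K f D \<sigma> w))"
proof -
  let ?A = "\<lambda>x. D (grad (smoothed G \<sigma> w) x)"
  define P where "P = (\<lambda>v. v \<in> admissible G K f \<and> (\<forall>v'\<in>admissible G K f. J_functional G D \<sigma> w v \<le> J_functional G D \<sigma> w v'))"
  obtain v g where vg: "minimiser ?A v g" using minimiser_exists[OF A c b] by blast
  have v: "adm v g" using vg by (simp add: minimiser_def)
  have "P v"
    unfolding P_def
  proof (intro conjI ballI)
    show "v \<in> admissible G K f" by (rule adm_imp_admissible[OF v])
    fix v' assume "v' \<in> admissible G K f"
    then have "energy M ?A g \<le> energy M ?A (weak_grad G v')"
      using vg admissible_imp_adm unfolding minimiser_def by blast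
    then show "J_functional G D \<sigma> w v \<le> J_functional G D \<sigma> w v'"
      unfolding J_functional_eq_energy by (simp only: energy_weak_grad[OF A v])
  qed
  then have "P (SOME v. P v)" by (rule Hilbert_Choice.someI[of P v])
  moreover have "T_op G K f D \<sigma> w = (SOME v. P v)" by (simp only: T_op_def P_def)
  ultimately have P: "T_op G K f D \<sigma> w \<in> admissible G K f"
    "\<And>v'. v' \<in> admissible G K f \<Longrightarrow> J_functional G D \<sigma> w (T_op G K f D \<sigma> w) \<le> J_functional G D \<sigma> w v'"
    by (simp_all add: P_def)
  show ?thesis
    unfolding minimiser_def
  proof (intro conjI allI impI)
    show "adm (T_op G K f D \<sigma> w) (weak_grad G (T_op G K f D \<sigma> w))"
      by (rule admissible_imp_adm[OF P(1)])
    fix v' h assume v': "adm v' h"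
    then have "J_functional G D \<sigma> w (T_op G K f D \<sigma> w) \<le> J_functional G D \<sigma> w v'"
      by (intro P(2) adm_imp_admissible)
    then show "energy M ?A (weak_grad G (T_op G K f D \<sigma> w)) \<le> energy M ?A h"
      unfolding J_functional_eq_energy by (simp only: energy_weak_grad[OF A v'])
  qed
qed

lemma adm_L1_bound:
  assumes "adm v g"
  shows "(\<integral>x. \<bar>v x\<bar> \<partial>M) \<le> (cP * (\<integral>x. norm (gf x) \<partial>M) + (\<integral>x. \<bar>f x\<bar> \<partial>M))
    + cP * sqrt (measure M (space M)) * sqrt (sq_norm M g)"
proof -
  interpret finite_measure M by (rule G(2))
  have i: "integrable M v" "integrable M g" "integrable M f" "integrable M gf"
    using adm_sq[OF assms] adm_sq[OF adm_f] by (auto intro: square_integrable_integrable)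
  have 1: "(\<integral>x. \<bar>v x\<bar> \<partial>M) \<le> abs_dist M v f + (\<integral>x. \<bar>f x\<bar> \<partial>M)"
    using L1_dist_triangle[of M v f "\<lambda>x. 0"] i by simp
  have 2: "abs_dist M v f \<le> cP * norm_dist M g gf"
    by (rule poincare[OF adm_diff[OF assms adm_f]])
  have "norm_dist M g gf \<le> (\<integral>x. norm (g x) \<partial>M) + (\<integral>x. norm (gf x) \<partial>M)"
    using L1_dist_triangle[of M g "\<lambda>x. 0" gf] i by simp
  then have "norm_dist M g gf
      \<le> sqrt (measure M (space M)) * sqrt (sq_norm M g) + (\<integral>x. norm (gf x) \<partial>M)"
    using integral_norm_le_sqrt[OF adm_sq(2)[OF assms]] by linarith
  then have "cP * norm_dist M g gf
      \<le> cP * (sqrt (measure M (space M)) * sqrt (sq_norm M g) + (\<integral>x. norm (gf x) \<partial>M))"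
    using cP by (rule mult_left_mono)
  also have "\<dots> = cP * (\<integral>x. norm (gf x) \<partial>M) + cP * sqrt (measure M (space M)) * sqrt (sq_norm M g)"
    by (simp only: distrib_left mult.assoc add.commute)
  finally show ?thesis using 1 2 by linarith
qed

lemma adm_L2_bound:
  assumes "adm v g"
  shows "(\<integral>x. (v x)\<^sup>2 \<partial>M) \<le> 16 * cP\<^sup>2 * (sq_norm M g + sq_norm M gf)
    + 2 * (\<integral>x. (f x)\<^sup>2 \<partial>M)"
proof -
  have sq: "integrable M (\<lambda>x. (v x)\<^sup>2)" "integrable M (\<lambda>x. (f x)\<^sup>2)" "integrable M (\<lambda>x. (norm (g x))\<^sup>2)"
     "integrable M (\<lambda>x. (norm (gf x))\<^sup>2)" "integrable M (\<lambda>x. (v x - f x)\<^sup>2)" "integrable M (\<lambda>x. (norm (g x - gf x))\<^sup>2)"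
    using adm_sq[OF assms] adm_sq[OF adm_f] square_integrable_diff[OF adm_sq(1)[OF assms] adm_sq(1)[OF adm_f]]
      square_integrable_diff[OF adm_sq(2)[OF assms] adm_sq(2)[OF adm_f]]
    by (simp_all add: square_integrable_def)
  have "(\<integral>x. (v x)\<^sup>2 \<partial>M) \<le> (\<integral>x. 2 * (v x - f x)\<^sup>2 + 2 * (f x)\<^sup>2 \<partial>M)"
  proof (rule integral_mono)
    show "(v x)\<^sup>2 \<le> 2 * (v x - f x)\<^sup>2 + 2 * (f x)\<^sup>2" for x
      using norm_add_sq_le[of "v x - f x" "f x"] by simp
  qed (use sq in simp_all)
  also have "\<dots> = 2 * (\<integral>x. (v x - f x)\<^sup>2 \<partial>M) + 2 * (\<integral>x. (f x)\<^sup>2 \<partial>M)" using sq by simp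
  finally have 1: "(\<integral>x. (v x)\<^sup>2 \<partial>M) \<le> 2 * (\<integral>x. (v x - f x)\<^sup>2 \<partial>M) + 2 * (\<integral>x. (f x)\<^sup>2 \<partial>M)" .
  have 2: "(\<integral>x. (v x - f x)\<^sup>2 \<partial>M) \<le> 4 * cP\<^sup>2 * sq_dist M g gf"
    using adm_poincare_square[OF assms adm_f] by simp
  have "sq_dist M g gf \<le> (\<integral>x. 2 * (norm (g x))\<^sup>2 + 2 * (norm (gf x))\<^sup>2 \<partial>M)"
  proof (rule integral_mono)
    show "(norm (g x - gf x))\<^sup>2 \<le> 2 * (norm (g x))\<^sup>2 + 2 * (norm (gf x))\<^sup>2" for x
      using norm_add_sq_le[of "g x" "- gf x"] by simp
  qed (use sq in simp_all)
  also have "\<dots> = 2 * (sq_norm M g + sq_norm M gf)" using sq by simp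
  finally have "4 * cP\<^sup>2 * sq_dist M g gf
      \<le> 4 * cP\<^sup>2 * (2 * (sq_norm M g + sq_norm M gf))"
    by (rule mult_left_mono) simp
  with 1 2 show ?thesis by linarith
qed

end

section \<open>Boundedness and compactness along the iteration\<close>

text \<open>Young's inequality linearises the square root with slope one half: \<open>b (Suc j) \<le> C + b j / 2\<close>, and
  \<open>max (b 0) (2 * C)\<close> is then an upper bound.\<close>

lemma sublinear_recursion_bounded:
  fixes a b :: "nat \<Rightarrow> real"
  assumes nonneg: "\<alpha> \<ge> 0" "\<beta> \<ge> 0" "\<gamma> \<ge> 0" "\<kappa> \<ge> 0" "\<And>j. b j \<ge> 0"
    and a: "\<And>j. a (Suc j) \<le> \<gamma> * (1 + \<kappa> * b j)"
    and b: "\<And>j. b (Suc j) \<le> \<alpha> + \<beta> * sqrt (a (Suc j))"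
  shows "\<exists>R\<ge>0. \<forall>j. b j \<le> R"
proof -
  define C where "C = \<alpha> + \<beta>\<^sup>2 * \<gamma> * (1 + \<kappa>) / 2 + 1/2"
  have step: "b (Suc j) \<le> C + b j / 2" for j
  proof -
    have "a (Suc j) \<le> \<gamma> * ((1 + \<kappa>) * (1 + b j))"
      using nonneg(4) nonneg(5)[of j]
      by (intro order_trans[OF a] mult_left_mono nonneg(3)) (simp add: algebra_simps)
    then have "\<beta> * sqrt (a (Suc j)) \<le> \<beta> * sqrt (\<gamma> * ((1 + \<kappa>) * (1 + b j)))"
      using nonneg by (intro mult_left_mono real_sqrt_le_mono)
    also have "\<dots> = (\<beta> * sqrt (\<gamma> * (1 + \<kappa>))) * sqrt (1 + b j)"
      by (simp add: real_sqrt_mult)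
    also have "\<dots> \<le> (\<beta> * sqrt (\<gamma> * (1 + \<kappa>)))\<^sup>2 / 2 + (sqrt (1 + b j))\<^sup>2 / 2"
      using zero_le_power2[of "\<beta> * sqrt (\<gamma> * (1 + \<kappa>)) - sqrt (1 + b j)"] unfolding power2_diff by linarith
    also have "\<dots> = \<beta>\<^sup>2 * \<gamma> * (1 + \<kappa>) / 2 + (1 + b j) / 2"
      using nonneg(3,4) nonneg(5)[of j] by (simp add: power_mult_distrib mult.assoc)
    finally show ?thesis using b[of j] unfolding C_def by (simp add: add_divide_distrib)
  qed
  have C: "C \<ge> 0" unfolding C_def using nonneg by (intro add_nonneg_nonneg) simp_all
  have "b j \<le> max (b 0) (2 * C)" for j
  proof (induction j)
    case (Suc j)
    have "b (Suc j) \<le> C + max (b 0) (2 * C) / 2" using step[of j] Suc by linarith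
    also have "\<dots> \<le> max (b 0) (2 * C)" by linarith
    finally show ?case .
  qed simp
  moreover have "max (b 0) (2 * C) \<ge> 0" using C by linarith
  ultimately show ?thesis by blast
qed

text \<open>The theorem of Arzela and Ascoli on the closure of \<open>G\<close> for the gradients of the smoothed
  functions; \<open>D\<close> preserves uniform convergence because these gradients stay in a fixed ball.\<close>

lemma smoothed_diffusion_uniform_Cauchy_subseq:
  fixes D :: "real^2 \<Rightarrow> real^2^2" and u :: "nat \<Rightarrow> real^2 \<Rightarrow> real"
  assumes G: "bounded G" and \<sigma>: "\<sigma> > 0" and D: "continuous_on UNIV D"
    and u: "\<And>j. integrable (lebesgue_on G) (u j)" and R: "\<And>j. (\<integral>x. \<bar>u j x\<bar> \<partial>lebesgue_on G) \<le> R"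
  shows "\<exists>k :: nat \<Rightarrow> nat. strict_mono k \<and> (\<forall>e>0. \<exists>N. \<forall>m\<ge>N. \<forall>n\<ge>N. \<forall>x\<in>G.
     norm (D (grad (smoothed G \<sigma> (u (k m))) x) - D (grad (smoothed G \<sigma> (u (k n))) x)) \<le> e)"
proof -
  let ?p = "\<lambda>j. grad (smoothed G \<sigma> (u j))"
  define m where "m = 1 / (2 * pi * \<sigma>^3) * R"
  define L where "L = 1 / (pi * \<sigma>^4) * R"
  have R0: "R \<ge> 0" using R[of 0] by (rule order_trans[rotated]) simp
  have L0: "L \<ge> 0" unfolding L_def using R0 \<sigma> by simp
  have bound: "norm (?p j x) \<le> m" for j x
    using smoothed_gradient(1)[OF \<sigma> u, of j x] mult_left_mono[OF R[of j], of "1 / (2 * pi * \<sigma>^3)"] \<sigma>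
    unfolding m_def by simp
  have lip: "norm (?p j x - ?p j y) \<le> L * norm (x - y)" for j x y
  proof -
    have "1 / (pi * \<sigma>^4) * (\<integral>z. \<bar>u j z\<bar> \<partial>lebesgue_on G) \<le> L"
      unfolding L_def using R[of j] \<sigma> by (intro mult_left_mono) simp_all
    then show ?thesis
      by (intro order_trans[OF smoothed_gradient(2)[OF \<sigma> u]] mult_right_mono) simp_all
  qed
  have K: "compact (closure G)" using G by simp
  obtain g k where k: "strict_mono (k :: nat \<Rightarrow> nat)"
    and conv: "\<And>e. 0 < e \<Longrightarrow> \<exists>N. \<forall>n x. n \<ge> N \<and> x \<in> closure G \<longrightarrow> norm (?p (k n) x - g x) < e"
  proof (rule Arzela_Ascoli[OF K, of ?p m])
    show "norm (?p n x) \<le> m" for n x by (rule bound)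
    fix x :: "real^2" and e :: real assume e: "0 < e"
    show "\<exists>d>0. \<forall>n y. y \<in> closure G \<and> norm (x - y) < d \<longrightarrow> norm (?p n x - ?p n y) < e"
    proof (intro exI[of _ "e / (L + 1)"] conjI allI impI)
      show "0 < e / (L + 1)" using e L0 by simp
      fix n y assume y: "y \<in> closure G \<and> norm (x - y) < e / (L + 1)"
      have "norm (?p n x - ?p n y) \<le> L * norm (x - y)" by (rule lip)
      also have "\<dots> \<le> (L + 1) * norm (x - y)" by (intro mult_right_mono) simp_all
      also have "\<dots> < e" using y L0 by (simp add: field_simps)
      finally show "norm (?p n x - ?p n y) < e" .
    qed
  qed blast
  have uc: "uniformly_continuous_on (cball 0 m) D"
    by (intro compact_uniformly_continuous continuous_on_subset[OF D]) simp_all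
  have "\<exists>N. \<forall>i\<ge>N. \<forall>n\<ge>N. \<forall>x\<in>G. norm (D (?p (k i) x) - D (?p (k n) x)) \<le> e" if e: "e > 0" for e
  proof -
    obtain d where d: "d > 0" "\<And>p q. p \<in> cball 0 m \<Longrightarrow> q \<in> cball 0 m \<Longrightarrow> dist q p < d \<Longrightarrow> dist (D q) (D p) < e"
      using uc e unfolding uniformly_continuous_on_def by blast
    obtain N where N: "\<And>n x. n \<ge> N \<Longrightarrow> x \<in> closure G \<Longrightarrow> norm (?p (k n) x - g x) < d / 2"
      using conv[of "d / 2"] d(1) by auto
    have "norm (D (?p (k i) x) - D (?p (k n) x)) \<le> e" if "i \<ge> N" "n \<ge> N" "x \<in> G" for i n x
    proof -
      have x: "x \<in> closure G" using that(3) closure_subset by blast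
      have "dist (?p (k i) x) (?p (k n) x) < d"
        using N[OF that(1) x, folded dist_norm] N[OF that(2) x, folded dist_norm]
          dist_triangle2[of "?p (k i) x" "?p (k n) x" "g x"] by linarith
      then have "dist (D (?p (k i) x)) (D (?p (k n) x)) < e"
        by (intro d(2)) (simp_all only: mem_cball_0 bound)
      then show ?thesis unfolding dist_norm by (rule less_imp_le)
    qed
    then show ?thesis by blast
  qed
  with k show ?thesis by blast
qed

locale diffusion_iteration = planar_dirichlet_class G K f gf cP
  for G K :: "(real^2) set" and f gf cP +
  fixes D :: "real^2 \<Rightarrow> real^2^2" and c1 c2 \<sigma> :: real and u :: "nat \<Rightarrow> real^2 \<Rightarrow> real"
  assumes bounded_G: "bounded G"
    and D: "continuous_on UNIV D" and c1: "c1 > 0" and c2: "c2 > 0"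
    and lower: "\<And>p q. c1 * (1 + (norm p)\<^sup>2) powr (-1/2) * (norm q)\<^sup>2 \<le> (D p *v q) \<bullet> q"
    and upper: "\<And>p q. (D p *v q) \<bullet> q \<le> c2 * (norm q)\<^sup>2"
    and \<sigma>: "\<sigma> > 0"
    and u_0: "integrable (lebesgue_on G) (u 0)"
    and u_Suc: "\<And>j. u (Suc j) = T_op G K f D \<sigma> (u j)"
begin

abbreviation "field j x \<equiv> D (grad (smoothed G \<sigma> (u j)) x)"
abbreviation "mass j \<equiv> \<integral>x. \<bar>u j x\<bar> \<partial>M"
abbreviation "dirichlet j \<equiv> sq_norm M (weak_grad G (u j))"

text \<open>The gradient estimate compares the energy of the minimiser with that of \<open>f\<close>. The reciprocal of the
  ellipticity constant \<open>c1 / (1 + m)\<close> grows only linearly in the \<open>L\<^sup>1\<close> norm of the preceding iterate,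
  and so does the bound for the squared gradient norm.\<close>

lemma T_op_step:
  assumes u: "integrable M (u j)" and m: "1 / (2 * pi * \<sigma>^3) * mass j \<le> m"
  shows "elliptic_field M (c1 / (1 + m)) c2 (field j)"
    and "minimiser (field j) (u (Suc j)) (weak_grad G (u (Suc j)))"
    and "dirichlet (Suc j) \<le> c2 / c1 * sq_norm M gf * (1 + m)"
proof -
  have "0 \<le> 1 / (2 * pi * \<sigma>^3) * mass j" using \<sigma> by (intro mult_nonneg_nonneg) simp_all
  then have m0: "m \<ge> 0" using m by linarith
  then have c: "c1 / (1 + m) > 0" using c1 by (intro divide_pos_pos) linarith+
  show A: "elliptic_field M (c1 / (1 + m)) c2 (field j)"
    by (rule diffusion_elliptic[OF D c1 lower upper \<sigma> u m])
  show min: "minimiser (field j) (u (Suc j)) (weak_grad G (u (Suc j)))"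
    unfolding u_Suc by (rule T_op_minimiser[OF A c]) (use c2 in simp)
  have a: "adm (u (Suc j)) (weak_grad G (u (Suc j)))"
    and le: "energy M (field j) (weak_grad G (u (Suc j))) \<le> energy M (field j) gf"
    using min adm_f by (auto simp: minimiser_def)
  have "c1 / (1 + m) * dirichlet (Suc j) \<le> c2 * sq_norm M gf"
    using energy_bounds(1)[OF A less_imp_le[OF c] adm_sq(2)[OF a]]
      energy_bounds(2)[OF A less_imp_le[OF c] adm_sq(2)[OF adm_f]] le by linarith
  then show "dirichlet (Suc j) \<le> c2 / c1 * sq_norm M gf * (1 + m)"
    using c1 m0 by (simp add: field_simps)
qed

lemma integrable_iterates: "integrable M (u j)"
proof (induction j)
  case 0 show ?case by (rule u_0)
next
  case (Suc j)
  have "adm (u (Suc j)) (weak_grad G (u (Suc j)))"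
    using T_op_step(2)[OF Suc order_refl] by (simp add: minimiser_def)
  then show ?case by (intro finite_measure.square_integrable_integrable[OF G(2)] adm_sq(1))
qed

lemma adm_iterates: "adm (u (Suc j)) (weak_grad G (u (Suc j)))"
  using T_op_step(2)[OF integrable_iterates order_refl] by (simp add: minimiser_def)

text \<open>The \<open>L\<^sup>1\<close> norm of an iterate is at most affine in the \<open>L\<^sup>2\<close> norm of its gradient, hence grows like the
  square root of the \<open>L\<^sup>1\<close> norm of its predecessor.\<close>

lemma mass_bounded: "\<exists>R\<ge>0. \<forall>j. mass j \<le> R"
proof (rule sublinear_recursion_bounded)
  show "0 \<le> cP * (\<integral>x. norm (gf x) \<partial>M) + (\<integral>x. \<bar>f x\<bar> \<partial>M)"
    using cP by (intro add_nonneg_nonneg mult_nonneg_nonneg) simp_all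
  show "0 \<le> cP * sqrt (measure M (space M))" using cP by simp
  show "0 \<le> c2 / c1 * sq_norm M gf" using c1 c2 by simp
  show "0 \<le> 1 / (2 * pi * \<sigma>^3)" using \<sigma> by simp
  show "dirichlet (Suc j) \<le> c2 / c1 * sq_norm M gf * (1 + 1 / (2 * pi * \<sigma>^3) * mass j)" for j
    by (rule T_op_step(3)[OF integrable_iterates order_refl])
  show "mass (Suc j) \<le> cP * (\<integral>x. norm (gf x) \<partial>M) + (\<integral>x. \<bar>f x\<bar> \<partial>M)
      + cP * sqrt (measure M (space M)) * sqrt (dirichlet (Suc j))" for j
    by (rule adm_L1_bound[OF adm_iterates])
qed simp

lemma uniform_bounds:
  "\<exists>R c E. c > 0 \<and> (\<forall>j. mass j \<le> R) \<and> (\<forall>j. elliptic_field M c c2 (field j)) \<and>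
    (\<forall>j. minimiser (field j) (u (Suc j)) (weak_grad G (u (Suc j)))) \<and> (\<forall>j. dirichlet (Suc j) \<le> E)"
proof -
  obtain R where R: "R \<ge> 0" "\<And>j. mass j \<le> R" using mass_bounded by blast
  define m where "m = 1 / (2 * pi * \<sigma>^3) * R"
  have le: "1 / (2 * pi * \<sigma>^3) * mass j \<le> m" for j
    unfolding m_def using R(2)[of j] \<sigma> by (intro mult_left_mono) simp_all
  have m0: "m \<ge> 0" unfolding m_def using R(1) \<sigma> by simp
  then have c: "c1 / (1 + m) > 0" using c1 by (intro divide_pos_pos) linarith+
  show ?thesis
    by (intro exI conjI allI, rule c, rule R(2)) (rule T_op_step[OF integrable_iterates le])+
qed

text \<open>Along the subsequence the diffusion fields are uniformly Cauchy. Stability of minimisers makes the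
  gradients of the next iterates Cauchy, whence the shift \<open>Suc (k n)\<close> in the subsequence.\<close>

lemma convergent_subsequence:
  "\<exists>(r :: nat \<Rightarrow> nat) w. strict_mono r \<and> w \<in> W1p 1 G \<and> (\<forall>k. u (r k) \<in> W1p 1 G) \<and>
     (\<lambda>k. W1p_norm 1 G (\<lambda>x. u (r k) x - w x)) \<longlonglongrightarrow> 0"
proof -
  from uniform_bounds obtain R c E where c: "c > 0" and *: "\<forall>j. mass j \<le> R"
      "\<forall>j. elliptic_field M c c2 (field j)"
      "\<forall>j. minimiser (field j) (u (Suc j)) (weak_grad G (u (Suc j)))" "\<forall>j. dirichlet (Suc j) \<le> E"
    by (elim exE conjE)
  note R = *(1)[rule_format] and A = *(2)[rule_format] and min = *(3)[rule_format] and E = *(4)[rule_format]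
  have E0: "E \<ge> 0" by (rule order_trans[OF _ E[of 0]]) simp
  from smoothed_diffusion_uniform_Cauchy_subseq[where u = u, OF bounded_G \<sigma> D integrable_iterates R]
  obtain k :: "nat \<Rightarrow> nat" where k: "strict_mono k"
    and k_cauchy: "\<forall>e>0. \<exists>N. \<forall>m\<ge>N. \<forall>n\<ge>N. \<forall>x\<in>G. norm (field (k m) x - field (k n) x) \<le> e"
    by (elim exE conjE)
  let ?v = "\<lambda>n. u (Suc (k n))" and ?g = "\<lambda>n. weak_grad G (u (Suc (k n)))"
  have "\<exists>N. \<forall>m\<ge>N. \<forall>n\<ge>N. sq_dist M (?g m) (?g n) < e" if e: "e > 0" for e
  proof -
    \<comment> \<open>the summand \<open>1\<close> makes the final inequality strict and avoids division by zero\<close>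
    define d where "d = c * e / (2 * E + 1)"
    have d: "d > 0" unfolding d_def using c e E0 by (intro divide_pos_pos mult_pos_pos) linarith+
    obtain N where N: "\<And>m n x. m \<ge> N \<Longrightarrow> n \<ge> N \<Longrightarrow> x \<in> G \<Longrightarrow> norm (field (k m) x - field (k n) x) \<le> d"
      using k_cauchy[rule_format, OF d] by blast
    have "sq_dist M (?g m) (?g n) < e" if mn: "m \<ge> N" "n \<ge> N" for m n
    proof -
      have "c * sq_dist M (?g m) (?g n) \<le> d * (dirichlet (Suc (k m)) + dirichlet (Suc (k n)))"
        by (rule minimiser_stability[OF A A c min min N[OF mn]])
      also have "\<dots> \<le> d * (2 * E)" using E[of "k m"] E[of "k n"] d by (intro mult_left_mono) linarith+
      also have "\<dots> < d * (2 * E + 1)" using d by (intro mult_strict_left_mono) simp_all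
      also have "\<dots> = c * e" unfolding d_def using E0 by simp
      finally show ?thesis using c by simp
    qed
    then show ?thesis by blast
  qed
  from adm_complete[of ?v ?g, OF adm_iterates this] obtain w h where wh: "adm w h"
    "(\<lambda>n. abs_dist M (?v n) w) \<longlonglongrightarrow> 0" "(\<lambda>n. norm_dist M (?g n) h) \<longlonglongrightarrow> 0" by blast
  have s: "sobolev1 G v' g'" if "adm v' g'" for v' g'
    using that sobolev2_imp_sobolev1[OF G(2)] by (simp add: adm_def)
  have norm: "W1p_norm 1 G (\<lambda>x. ?v n x - w x) = abs_dist M (?v n) w + norm_dist M (?g n) h" for n
    by (rule W1p_norm_1[OF G(1) sobolev1_diff[OF G(1) s[OF adm_iterates] s[OF wh(1)]]])
  have "(\<lambda>n. W1p_norm 1 G (\<lambda>x. ?v n x - w x)) \<longlonglongrightarrow> 0"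
    using tendsto_add[OF wh(2,3)] unfolding norm by (simp only: add_0)
  moreover have "strict_mono (\<lambda>n. Suc (k n))" using k by (simp add: strict_mono_def)
  moreover have "w \<in> W1p 1 G" "\<forall>n. ?v n \<in> W1p 1 G"
    using s[OF wh(1)] s[OF adm_iterates] unfolding W1p_1_iff by blast+
  ultimately show ?thesis by (intro exI[of _ "\<lambda>n. Suc (k n)"] exI[of _ w] conjI)
qed

lemma iterates_W1p_2: "u (Suc j) \<in> W1p 2 G"
  using adm_iterates[of j] by (auto simp: adm_def W1p_2_iff)

lemma W1p_2_norm_bounded: "\<exists>B. \<forall>j. W1p_norm 2 G (u (Suc j)) \<le> B"
proof -
  from uniform_bounds obtain E where "\<forall>j. dirichlet (Suc j) \<le> E" by (elim exE conjE)
  note E = this[rule_format]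
  let ?B = "16 * cP\<^sup>2 * (E + sq_norm M gf) + 2 * (\<integral>x. (f x)\<^sup>2 \<partial>M) + E"
  have "W1p_norm 2 G (u (Suc j)) \<le> sqrt ?B" for j
  proof -
    have "16 * cP\<^sup>2 * (dirichlet (Suc j) + sq_norm M gf) \<le> 16 * cP\<^sup>2 * (E + sq_norm M gf)"
      using E[of j] by (intro mult_left_mono add_right_mono) simp_all
    then have "(\<integral>x. (u (Suc j) x)\<^sup>2 \<partial>M) + dirichlet (Suc j) \<le> ?B"
      using adm_L2_bound[OF adm_iterates[of j]] E[of j] by linarith
    moreover have "W1p_norm 2 G (u (Suc j)) = sqrt ((\<integral>x. (u (Suc j) x)\<^sup>2 \<partial>M) + dirichlet (Suc j))"
      by (simp add: W1p_norm_def Lp_norm_2 powr_half_sqrt)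
    ultimately show ?thesis by simp
  qed
  then show ?thesis by blast
qed

end

theorem corollary4p1:
  fixes \<Omega> CC K G :: "(real^2) set" and C :: "nat \<Rightarrow> (real^2) set" and N :: nat
    and f :: "real^2 \<Rightarrow> real" and D :: "real^2 \<Rightarrow> real^2^2"
    and c1 c2 cP \<sigma> \<rho> \<rho>1 \<rho>2 :: real
    and u :: "nat \<Rightarrow> real^2 \<Rightarrow> real"
  assumes "lipschitz_domain \<Omega>"
    and "N \<ge> 1"
    and "\<And>i. i \<in> {1..N} \<Longrightarrow> lipschitz_domain (C i) \<and> C i \<subseteq> \<Omega> \<and> C i \<noteq> \<Omega>"
    and "\<And>i j. i \<in> {1..N} \<Longrightarrow> j \<in> {1..N} \<Longrightarrow> i \<noteq> j \<Longrightarrow>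
           C i \<inter> C j = {} \<and> setdist (C i) (C j) > 0"
    and "CC = (\<Union>i\<in>{1..N}. C i)" and "K = closure CC" and "G = \<Omega> - K"
    and "compact K" and "K \<subseteq> \<Omega>"
    and "f \<in> W1p 2 CC" and "\<And>x. x \<in> CC \<Longrightarrow> 0 \<le> f x \<and> f x \<le> 1" and "f \<in> W1p 2 \<Omega>"
    and "continuous_on UNIV D" and "\<And>p. transpose (D p) = D p"
    and "c1 > 0" and "c2 > 0"
    and "\<And>p q. c1 * (1 + (norm p)\<^sup>2) powr (-1/2) * (norm q)\<^sup>2 \<le> (D p *v q) \<bullet> q"
    and "\<And>p q. (D p *v q) \<bullet> q \<le> c2 * (norm q)\<^sup>2"
    and "\<sigma> > 0"
    and "cP > 0"
    and "\<And>w. w \<in> W1p 1 G \<Longrightarrow> eq_trace G (frontier K) w f \<Longrightarrow>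
           Lp_norm 1 G w \<le> cP * (Lp_norm 1 G (weak_grad G (\<lambda>x. w x - f x)) + Lp_norm 1 G f)"
    and "u 0 \<in> W1p 1 G" and "eq_trace G (frontier K) (u 0) f"
    and "\<And>j. u (Suc j) = T_op G K f D \<sigma> (u j)"
    and "\<rho>1 = 2 * sqrt (c2 / c1) * Lp_norm 2 G (weak_grad G f) *
           (1 + measure lebesgue G / (2 * pi * \<sigma> ^ 4) * cP *
              (Lp_norm 1 G f + Lp_norm 1 G (weak_grad G f)))"
    and "\<rho>2 = 2 * sqrt (c2 / c1) * Lp_norm 2 G (weak_grad G f) * (measure lebesgue G / (2 * pi)) * cP"
    and "\<rho> = max \<rho>1 \<rho>2"
    and "\<sigma> ^ 4 > \<rho>"
  shows "(\<exists>(r :: nat \<Rightarrow> nat) u_lim. strict_mono r \<and> u_lim \<in> W1p 1 G \<and>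
            (\<forall>k. u (r k) \<in> W1p 1 G) \<and>
            (\<lambda>k. W1p_norm 1 G (\<lambda>x. u (r k) x - u_lim x)) \<longlonglongrightarrow> 0) \<and>
         ((\<forall>j\<ge>1. u j \<in> W1p 2 G) \<and>
          bdd_above ((\<lambda>j. W1p_norm 2 G (u j)) ` {1..}) \<and>
          (u 0 \<in> W1p 2 G \<longrightarrow> bdd_above (range (\<lambda>j. W1p_norm 2 G (u j)))))"
proof -
  note K = assms(5-9) and f = assms(12) and D = assms(13) and c1 = assms(15) and c2 = assms(16)
    and lower = assms(17) and upper = assms(18) and \<sigma> = assms(19) and cP = assms(20)
    and poincare = assms(21) and u0 = assms(22) and u_Suc = assms(24)
  have \<Omega>: "open \<Omega>" "bounded \<Omega>" using assms(1) by (auto simp: lipschitz_domain_def)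
  have G_open: "open G" unfolding \<open>G = \<Omega> - K\<close> using \<Omega>(1) \<open>compact K\<close> by (intro open_Diff compact_imp_closed)
  have G_sub: "G \<subseteq> \<Omega>" unfolding \<open>G = \<Omega> - K\<close> by blast
  have G_bdd: "bounded G" using \<Omega>(2) G_sub by (rule bounded_subset)
  have fin: "finite_measure (lebesgue_on G)"
    using G_open G_bdd by (intro finite_measure_lebesgue_on bounded_set_imp_lmeasurable) simp_all
  have S: "frontier K \<in> sets borel" by (intro borel_closed frontier_closed)
  obtain gf where "sobolev2 \<Omega> f gf" using f by (auto simp: W1p_2_iff)
  then have gf: "sobolev2 G f gf" by (rule sobolev2_mono[OF G_open \<Omega>(1) G_sub])
  have f1: "f \<in> W1p 1 G" using sobolev2_imp_sobolev1[OF fin gf] by (auto simp: W1p_1_iff)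
  interpret diffusion_iteration G K f gf cP D c1 c2 \<sigma> u
  proof (intro diffusion_iteration.intro planar_dirichlet_class.intro dirichlet_class.intro
      diffusion_iteration_axioms.intro)
    show "(\<integral>x. \<bar>v x\<bar> \<partial>lebesgue_on G) \<le> cP * (\<integral>x. norm (h x) \<partial>lebesgue_on G)"
      if "zero_trace G (frontier K) v h" for v h
      by (rule L1_poincare_zero_trace[OF G_open S f1 poincare that])
    show "integrable (lebesgue_on G) (u 0)" using u0 by (auto simp: W1p_1_iff sobolev1_def)
    show "finite_measure (lebesgue_on G)" by (rule fin)
  qed (use G_open S gf cP G_bdd D c1 c2 lower upper \<sigma> u_Suc in simp_all)
  obtain B where B: "\<And>j. W1p_norm 2 G (u (Suc j)) \<le> B" using W1p_2_norm_bounded by blast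
  have B': "W1p_norm 2 G (u j) \<le> B" if "j \<ge> 1" for j using B[of "j - 1"] that by simp
  show ?thesis
  proof (intro conjI impI allI)
    show "\<exists>(r :: nat \<Rightarrow> nat) u_lim. strict_mono r \<and> u_lim \<in> W1p 1 G \<and> (\<forall>k. u (r k) \<in> W1p 1 G) \<and>
        (\<lambda>k. W1p_norm 1 G (\<lambda>x. u (r k) x - u_lim x)) \<longlonglongrightarrow> 0"
      by (rule convergent_subsequence)
    show "u j \<in> W1p 2 G" if "j \<ge> 1" for j using iterates_W1p_2[of "j - 1"] that by simp
    show "bdd_above ((\<lambda>j. W1p_norm 2 G (u j)) ` {1..})"
      using B' by (intro bdd_aboveI[of _ B]) auto
    show "bdd_above (range (\<lambda>j. W1p_norm 2 G (u j)))"
    proof (rule bdd_aboveI[of _ "max B (W1p_norm 2 G (u 0))"])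
      fix y assume "y \<in> range (\<lambda>j. W1p_norm 2 G (u j))"
      then obtain j where "y = W1p_norm 2 G (u j)" by blast
      then show "y \<le> max B (W1p_norm 2 G (u 0))" using B'[of j] by (cases j) (auto simp: le_max_iff_disj)
    qed
  qed
qed

end
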